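(* Fix a connected graph $H$ with at least two vertices and fix $\lambda\in(0,1/2)$. Let $n\ge 1$, $p\in(\lambda,1-\lambda)$, and let $G$ be sampled from $G(n,p)$. Let $X_H$ be the number of subgraphs of $G$ isomorphic to $H$ (copies of $H$ in $G$), let $\mu_H$ and $\sigma_H$ be the mean and standard deviation of $X_H$, and let $Z_H=(X_H-\mu_H)/\sigma_H$. Then for every $\varepsilon>0$, \[\sup_{z\in(\mathbb{Z}-\mu_H)/\sigma_H}\big|\sigma_H\,\mathbb{P}[Z_H=z]-\mathcal{N}(z)\big|\lesssim_{H,\lambda,\varepsilon} n^{\varepsilon-1/2},\qquad \sum_{z\in(\mathbb{Z}-\mu_H)/\sigma_H}\big|\mathbb{P}[Z_H=z]-\mathcal{N}(z)/\sigma_H\big|\lesssim_{H,\lambda,\varepsilon} n^{\varepsilon-1/2}.\]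
   Context: $\mathcal{N}(x)=\frac{1}{\sqrt{2\pi}}e^{-x^2/2}$ is the standard normal density. $G(n,p)$ is the Erdős–Rényi random graph on vertex set $[n]$ in which each edge is present independently with probability $p$. The notation $f\lesssim_{a} g$ means $|f|\le Cg$ for a constant $C$ depending only on the subscripted parameters. *)

theory Defs
  imports "HOL-Probability.Probability"
begin

definition simple_graph :: "'a set \<Rightarrow> 'a set set \<Rightarrow> bool" where
  "simple_graph V E \<longleftrightarrow> finite V \<and> (\<forall>e\<in>E. card e = 2 \<and> e \<subseteq> V)"

definition connected_graph :: "'a set \<Rightarrow> 'a set set \<Rightarrow> bool" where
  "connected_graph V E \<longleftrightarrow> (\<forall>u\<in>V. \<forall>v\<in>V. (\<lambda>x y. {x, y} \<in> E)\<^sup>*\<^sup>* u v)"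

definition all_edges :: "nat \<Rightarrow> nat set set" where
  "all_edges n = {e. e \<subseteq> {..<n} \<and> card e = 2}"

definition gnp :: "nat \<Rightarrow> real \<Rightarrow> nat set set pmf" where
  "gnp n p = map_pmf (\<lambda>f. {e \<in> all_edges n. f e})
                     (Pi_pmf (all_edges n) False (\<lambda>_. bernoulli_pmf p))"

definition copies :: "'a set \<Rightarrow> 'a set set \<Rightarrow> nat \<Rightarrow> nat set set \<Rightarrow> nat" where
  "copies VH EH n E = card {(V', E'). V' \<subseteq> {..<n} \<and> E' \<subseteq> E \<and>
      (\<exists>f. bij_betw f VH V' \<and> E' = (\<lambda>e. f ` e) ` EH)}"

end

(* The characteristic function phi of X_H is compared with that of a normal variable and inverted on
   [-pi, pi]; the sum bound follows from the pointwise one together with high moments, bounded by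
   hypercontractivity.

   Expand X_H as a polynomial in the independent centred variables xi_e, where the coefficient of a set F
   of edges is p^(d - |F|) times the number of copies of H containing F. For |theta| up to
   n^(eps - (v - 1)), v = |V(H)|, the linear part dominates and is asymptotically Gaussian, and the terms
   of degree at least 2 are an error that is small in L^2.

   For larger theta, phi has to be superpolynomially small. For 2 <= w <= v take the connected w-vertex
   subset of V(H) spanning the most edges, and plant in [n] many disjoint groups, each a blow-up of this
   pattern with parts of size m. Cauchy-Schwarz, once for every edge of the pattern, decouples the edge
   classes of the blow-up and kills every monomial that misses a class. The survivors are the copies of
   the pattern inside one group, whose phases are independent over the groups, so that each group
   contributes a factor bounded away from 1, and monomials on more than w vertices. The latter are small
   in L^2; they are removed by a Taylor expansion of the exponential whose remainder is controlled by
   hypercontractivity. Choosing m suitably, the values of w together cover all remaining theta, and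
   w = v, m = 1 reaches |theta| = pi. *)
theory Submission
  imports Defs "HOL-Real_Asymp.Real_Asymp"
begin

section \<open>Expectations over finite product spaces\<close>

text \<open>Beyond the Gaussian range no fixed part of the polynomial dominates: the size of
  \<theta> times a coefficient depends on how many vertices its edge set spans. Decoupling selects a
  span w. A survivor has a vertex in each of the w parts, and by connectedness of the pattern one
  with exactly w vertices stays inside a single group. It could still carry more edges than the
  pattern; taking the densest connected w-subset excludes this, so the leading survivors are the m^w
  pattern copies of each group. Their phase has variance of order (\<theta> n^(v-w))^2 m^w, and m is
  tuned to make this a small constant, except when |\<theta>| itself is bounded below. The number of
  groups M is a small power of n: large enough for \<rho>^M to beat every power of n, small enough
  that the remaining survivors have squared norm of order M / n. This norm is only polynomially
  small, so a single L^2 estimate would give one fixed power of n; hence the expansion to high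
  order, whose terms of positive order still profit from almost all groups. The Gaussian range ends
  near n^(eps - (v-1)) because the standard deviation has order n^(v-1).\<close>

definition pexp :: "('b::finite \<Rightarrow> real) \<Rightarrow> 'i set \<Rightarrow> (('i \<Rightarrow> 'b) \<Rightarrow> 'c::real_vector) \<Rightarrow> 'c" where
  "pexp q I g = (\<Sum>x\<in>PiE I (\<lambda>_. UNIV). (\<Prod>i\<in>I. q (x i)) *\<^sub>R g x)"

text \<open>Quantified over all functions and not only over the extensional ones of the product
  space, so that it survives updating and overriding of coordinates outside
  \<open>I\<close>.\<close>

definition depends_on :: "'i set \<Rightarrow> (('i \<Rightarrow> 'b) \<Rightarrow> 'c) \<Rightarrow> bool" where
  "depends_on U g \<longleftrightarrow> (\<forall>x y. (\<forall>i\<in>U. x i = y i) \<longrightarrow> g x = g y)"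

lemma depends_onI:
  assumes "\<And>x y. (\<And>i. i \<in> U \<Longrightarrow> x i = y i) \<Longrightarrow> g x = g y"
  shows "depends_on U g"
  unfolding depends_on_def by (intro allI impI, rule assms) (erule bspec)

lemma depends_onD:
  assumes "depends_on U g" "\<And>i. i \<in> U \<Longrightarrow> x i = y i"
  shows "g x = g y"
  by (rule assms(1)[unfolded depends_on_def, rule_format]) (rule assms(2))

lemma depends_on_mono: "depends_on U g \<Longrightarrow> U \<subseteq> V \<Longrightarrow> depends_on V g"
  unfolding depends_on_def by (simp add: subset_iff)

lemma depends_on_comp:
  fixes g :: "('i \<Rightarrow> 'b) \<Rightarrow> 'c"
  assumes "depends_on U g"
  shows "depends_on U (\<lambda>x. h (g x))"
proof (rule depends_onI)
  fix x y :: "'i \<Rightarrow> 'b" assume "\<And>i. i \<in> U \<Longrightarrow> x i = y i"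
  then have "g x = g y" using assms unfolding depends_on_def by blast
  then show "h (g x) = h (g y)" by simp
qed

lemma depends_on_comp2:
  fixes f :: "('i \<Rightarrow> 'b) \<Rightarrow> 'c" and g :: "('i \<Rightarrow> 'b) \<Rightarrow> 'd"
  assumes "depends_on U f" "depends_on U g"
  shows "depends_on U (\<lambda>x. h (f x) (g x))"
proof (rule depends_onI)
  fix x y :: "'i \<Rightarrow> 'b" assume "\<And>i. i \<in> U \<Longrightarrow> x i = y i"
  then have "f x = f y" "g x = g y" using assms unfolding depends_on_def by blast+
  then show "h (f x) (g x) = h (f y) (g y)" by simp
qed

lemma depends_on_sum: "(\<And>a. a \<in> A \<Longrightarrow> depends_on U (f a)) \<Longrightarrow> depends_on U (\<lambda>x. \<Sum>a\<in>A. f a x)"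
  unfolding depends_on_def by (auto intro!: sum.cong)

lemma depends_on_prod: "(\<And>a. a \<in> A \<Longrightarrow> depends_on U (f a)) \<Longrightarrow> depends_on U (\<lambda>x. \<Prod>a\<in>A. f a x)"
  unfolding depends_on_def by (auto intro!: prod.cong)

lemma depends_on_upd: "depends_on U g \<Longrightarrow> depends_on (U - {i}) (\<lambda>x. g (x(i := b)))"
  unfolding depends_on_def by simp

lemma depends_on_upd_same: "depends_on U g \<Longrightarrow> i \<notin> U \<Longrightarrow> g (x(i := b)) = g x"
  unfolding depends_on_def by (erule allE[of _ "x(i := b)"], erule allE[of _ x]) auto

lemma pexp_empty [simp]: "pexp q {} g = g (\<lambda>_. undefined)"
  by (simp add: pexp_def)

lemma pexp_insert:
  fixes q :: "'b::finite \<Rightarrow> real" and g :: "('i \<Rightarrow> 'b) \<Rightarrow> 'c::real_vector"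
  assumes "finite I" "i \<notin> I"
  shows "pexp q (insert i I) g = (\<Sum>b\<in>UNIV. q b *\<^sub>R pexp q I (\<lambda>x. g (x(i := b))))"
proof -
  have "pexp q (insert i I) g = (\<Sum>z\<in>UNIV \<times> PiE I (\<lambda>_. UNIV).
     (\<Prod>j\<in>insert i I. q ((case z of (y, x) \<Rightarrow> x(i := y)) j)) *\<^sub>R g (case z of (y, x) \<Rightarrow> x(i := y)))"
    unfolding pexp_def PiE_insert_eq
    by (subst sum.reindex[OF inj_combinator[OF assms(2)]]) (simp add: o_def)
  also have "\<dots> = (\<Sum>z\<in>UNIV \<times> PiE I (\<lambda>_. UNIV). case z of (b, x) \<Rightarrow>
     q b *\<^sub>R ((\<Prod>j\<in>I. q (x j)) *\<^sub>R g (x(i := b))))"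
  proof (rule sum.cong[OF refl])
    fix z :: "'b \<times> ('i \<Rightarrow> 'b)"
    obtain b x where z: "z = (b, x)" by (cases z)
    have "(\<Prod>j\<in>I. q ((x(i := b)) j)) = (\<Prod>j\<in>I. q (x j))"
      using assms by (intro prod.cong) auto
    then have "(\<Prod>j\<in>insert i I. q ((x(i := b)) j)) = q b * (\<Prod>j\<in>I. q (x j))"
      using assms by simp
    then show "(\<Prod>j\<in>insert i I. q ((case z of (y, x) \<Rightarrow> x(i := y)) j)) *\<^sub>R g (case z of (y, x) \<Rightarrow> x(i := y)) =
         (case z of (b, x) \<Rightarrow> q b *\<^sub>R ((\<Prod>j\<in>I. q (x j)) *\<^sub>R g (x(i := b))))"
      unfolding z by simp
  qed
  also have "\<dots> = (\<Sum>b\<in>UNIV. q b *\<^sub>R pexp q I (\<lambda>x. g (x(i := b))))"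
    unfolding pexp_def scaleR_sum_right sum.cartesian_product ..
  finally show ?thesis .
qed

lemma pexp_add: "pexp q I (\<lambda>x. f x + g x) = pexp q I f + pexp q I g"
  by (simp add: pexp_def scaleR_add_right sum.distrib)

lemma pexp_diff: "pexp q I (\<lambda>x. f x - g x) = pexp q I f - pexp q I g"
  by (simp add: pexp_def scaleR_diff_right sum_subtractf)

lemma pexp_sum: "pexp q I (\<lambda>x. \<Sum>a\<in>A. f a x) = (\<Sum>a\<in>A. pexp q I (f a))"
  unfolding pexp_def scaleR_sum_right by (rule sum.swap)

lemma pexp_zero [simp]: "pexp q I (\<lambda>x. 0) = 0"
  by (simp add: pexp_def)

lemma pexp_mult_left: "pexp q I (\<lambda>x. a * f x) = a * pexp q I f" for a :: "'c::real_algebra"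
  by (simp add: pexp_def sum_distrib_left)

lemma pexp_mult_right: "pexp q I (\<lambda>x. f x * a) = pexp q I f * a" for a :: "'c::real_algebra"
  by (simp add: pexp_def sum_distrib_right)

lemma pexp_of_real: "pexp q I (\<lambda>x. of_real (f x)) = (of_real (pexp q I f) :: 'c::real_algebra_1)"
  by (simp add: pexp_def scaleR_conv_of_real)

lemma pexp_cnj: "pexp q I (\<lambda>x. cnj (f x)) = cnj (pexp q I f)"
  by (simp add: pexp_def)

lemma pexp_cong: "(\<And>x. x \<in> PiE I (\<lambda>_. UNIV) \<Longrightarrow> f x = g x) \<Longrightarrow> pexp q I f = pexp q I g"
  by (auto simp: pexp_def intro!: sum.cong)

text \<open>Probability is done with finite weighted sums. Values may lie in any real vector space,
  so moments and characteristic functions share one operator, and the doubled space is another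
  instance of this locale. Measure theory is needed only to translate the random graph and for
  Fourier inversion.\<close>

locale weights =
  fixes q :: "'b::finite \<Rightarrow> real"
  assumes nonneg: "0 \<le> q b" and sum_1: "(\<Sum>b\<in>UNIV. q b) = 1"
begin

abbreviation "E \<equiv> pexp q"

lemma pexp_const [simp]:
  assumes "finite I" shows "E I (\<lambda>x. c) = c"
  using assms by (induction I) (auto simp: pexp_insert scaleR_sum_left[symmetric] sum_1)

lemma pexp_mono: "(\<And>x. x \<in> PiE I (\<lambda>_. UNIV) \<Longrightarrow> f x \<le> g x) \<Longrightarrow> E I f \<le> E I g" for f :: "_ \<Rightarrow> real"
  unfolding pexp_def real_scaleR_def by (intro sum_mono mult_left_mono prod_nonneg) (auto simp: nonneg)

lemma pexp_nonneg: "(\<And>x. x \<in> PiE I (\<lambda>_. UNIV) \<Longrightarrow> 0 \<le> f x) \<Longrightarrow> 0 \<le> E I f" for f :: "_ \<Rightarrow> real"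
  unfolding pexp_def real_scaleR_def by (intro sum_nonneg mult_nonneg_nonneg prod_nonneg) (auto simp: nonneg)

lemma norm_pexp_le: "norm (E I f) \<le> E I (\<lambda>x. norm (f x))" for f :: "_ \<Rightarrow> 'c::real_normed_vector"
  unfolding pexp_def
  by (rule order_trans[OF norm_sum]) (auto intro!: sum_mono simp: abs_prod nonneg prod_nonneg)

lemma norm_pexp_bound:
  fixes f :: "_ \<Rightarrow> 'c::real_normed_vector"
  assumes "finite I" "\<And>x. norm (f x) \<le> B"
  shows "norm (E I f) \<le> B"
proof -
  have "norm (E I f) \<le> E I (\<lambda>x. norm (f x))" by (rule norm_pexp_le)
  also have "\<dots> \<le> E I (\<lambda>x. B)" by (intro pexp_mono assms)
  finally show ?thesis using assms by simp
qed

lemma pexp_insert_indep: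
  assumes "finite I" "i \<notin> I" "depends_on U g" "i \<notin> U"
  shows "E (insert i I) g = E I g"
proof -
  have "E (insert i I) g = (\<Sum>b\<in>UNIV. q b *\<^sub>R E I (\<lambda>x. g (x(i := b))))"
    by (rule pexp_insert) fact+
  also have "\<dots> = (\<Sum>b\<in>UNIV. q b *\<^sub>R E I g)"
    using depends_on_upd_same[OF assms(3,4)] by simp
  also have "\<dots> = E I g" by (simp add: scaleR_sum_left[symmetric] sum_1)
  finally show ?thesis .
qed

lemma pexp_mult_indep:
  fixes g h :: "('i \<Rightarrow> 'b) \<Rightarrow> 'c::{real_algebra,comm_ring}"
  assumes "finite I" "depends_on A g" "depends_on B h" "A \<inter> B = {}"
  shows "E I (\<lambda>x. g x * h x) = E I g * E I h"
  using assms
proof (induction I arbitrary: g h A B)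
  case empty
  then show ?case by simp
next
  case (insert i I)
  \<comment> \<open>By disjointness the new coordinate is missing from one of the two sets. The case
    of \<open>A\<close> is proved once; the other follows by commuting the factors.\<close>
  have aux: "E (insert i I) (\<lambda>x. g x * h x) = E (insert i I) g * E (insert i I) h"
    if dg: "depends_on A g" and dh: "depends_on B h" and d: "A \<inter> B = {}" and i: "i \<notin> A"
    for g h :: "('i \<Rightarrow> 'b) \<Rightarrow> 'c" and A B
  proof -
    have "E (insert i I) (\<lambda>x. g x * h x) = (\<Sum>b\<in>UNIV. q b *\<^sub>R E I (\<lambda>x. g x * h (x(i := b))))"
      using insert.hyps depends_on_upd_same[OF dg i] by (simp add: pexp_insert)
    also have "\<dots> = (\<Sum>b\<in>UNIV. q b *\<^sub>R (E I g * E I (\<lambda>x. h (x(i := b)))))"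
      using d by (subst insert.IH[OF dg depends_on_upd[OF dh, of i]]) auto
    also have "\<dots> = E I g * E (insert i I) h"
      using insert.hyps by (simp add: pexp_insert sum_distrib_left)
    also have "E I g = E (insert i I) g"
      using insert.hyps by (subst pexp_insert_indep[OF _ _ dg i]) auto
    finally show ?thesis .
  qed
  show ?case
  proof (cases "i \<in> A")
    case False
    then show ?thesis using aux insert.prems by blast
  next
    case True
    then have "i \<notin> B" using insert.prems by auto
    then have "E (insert i I) (\<lambda>x. h x * g x) = E (insert i I) h * E (insert i I) g"
      using aux[of B h A g] insert.prems by (simp add: Int_commute)
    then show ?thesis by (simp add: mult.commute)
  qed
qed

lemma pexp_prod_indep:
  fixes g :: "'j \<Rightarrow> ('i \<Rightarrow> 'b) \<Rightarrow> 'c::{real_algebra_1,comm_ring_1}"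
  assumes "finite I" "finite J" "\<And>j. j \<in> J \<Longrightarrow> depends_on (A j) (g j)" "disjoint_family_on A J"
  shows "E I (\<lambda>x. \<Prod>j\<in>J. g j x) = (\<Prod>j\<in>J. E I (g j))"
  using assms(2-)
proof (induction J)
  case empty
  then show ?case using assms(1) by simp
next
  case (insert j J)
  have "E I (\<lambda>x. g j x * (\<Prod>j\<in>J. g j x)) = E I (g j) * E I (\<lambda>x. \<Prod>j\<in>J. g j x)"
  proof (rule pexp_mult_indep[where A = "A j" and B = "\<Union>j\<in>J. A j"])
    show "depends_on (\<Union>j\<in>J. A j) (\<lambda>x. \<Prod>j\<in>J. g j x)"
      using insert.prems by (intro depends_on_prod) (auto intro: depends_on_mono)
    show "A j \<inter> (\<Union>j\<in>J. A j) = {}"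
      using insert.prems(2) insert.hyps(2) by (force simp: disjoint_family_on_def)
  qed (use insert.prems assms(1) in auto)
  moreover have "disjoint_family_on A J"
    using insert.prems(2) by (auto simp: disjoint_family_on_def)
  ultimately show ?case using insert by simp
qed

lemma pexp_square_le: "(E I f)\<^sup>2 \<le> E I (\<lambda>x. (f x)\<^sup>2)" if "finite I" for f :: "_ \<Rightarrow> real"
proof -
  have "0 \<le> E I (\<lambda>x. (f x - E I f)\<^sup>2)" by (intro pexp_nonneg) auto
  also have "(\<lambda>x. (f x - E I f)\<^sup>2) = (\<lambda>x. (f x)\<^sup>2 - (2 * E I f) * f x + (E I f)\<^sup>2)"
    by (auto simp: power2_eq_square algebra_simps)
  also have "E I \<dots> = E I (\<lambda>x. (f x)\<^sup>2) - (E I f)\<^sup>2"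
    using that by (simp add: pexp_add pexp_diff pexp_mult_left) (simp add: power2_eq_square)
  finally show ?thesis by simp
qed

end

text \<open>Fubini in the form used for conditioning: the coordinates of \<open>B\<close> are
  written over an assignment of \<open>A\<close>.\<close>

lemma pexp_union:
  fixes q :: "'b::finite \<Rightarrow> real" and g :: "('i \<Rightarrow> 'b) \<Rightarrow> 'c::real_vector"
  assumes "finite A" "finite B" "A \<inter> B = {}"
  shows "pexp q (A \<union> B) g = pexp q A (\<lambda>x. pexp q B (\<lambda>y. g (override_on x y B)))"
  using assms(1,3)
proof (induction A arbitrary: g)
  case empty
  have "override_on (\<lambda>_. undefined) y B = y" if "y \<in> PiE B (\<lambda>_. UNIV)" for y :: "'i \<Rightarrow> 'b"
    using that by (auto simp: override_on_def fun_eq_iff PiE_def extensional_def)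
  then have "pexp q B g = pexp q B (\<lambda>y. g (override_on (\<lambda>_. undefined) y B))"
    by (intro pexp_cong) simp
  then show ?case by simp
next
  case (insert i A)
  have *: "(override_on x y B)(i := b) = override_on (x(i := b)) y B" for x y :: "'i \<Rightarrow> 'b" and b
    using insert.prems by (auto simp: override_on_def fun_eq_iff)
  have "pexp q (insert i (A \<union> B)) g = (\<Sum>b\<in>UNIV. q b *\<^sub>R pexp q (A \<union> B) (\<lambda>x. g (x(i := b))))"
    using insert assms by (subst pexp_insert) auto
  also have "\<dots> = (\<Sum>b\<in>UNIV. q b *\<^sub>R pexp q A (\<lambda>x. pexp q B (\<lambda>y. g (override_on (x(i := b)) y B))))"
    using insert.prems by (subst insert.IH) (simp_all add: * del: fun_upd_apply)
  also have "\<dots> = pexp q (insert i A) (\<lambda>x. pexp q B (\<lambda>y. g (override_on x y B)))"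
    using insert.hyps by (subst pexp_insert) auto
  finally show ?case by simp
qed

section \<open>Two independent copies of the product space\<close>

definition pair_weight :: "('b \<Rightarrow> real) \<Rightarrow> 'b \<times> 'b \<Rightarrow> real" where
  "pair_weight q z = q (fst z) * q (snd z)"

lemma sum_pair_weight:
  fixes q :: "'b::finite \<Rightarrow> real" and f g :: "'b \<Rightarrow> 'c::real_algebra"
  shows "(\<Sum>z\<in>UNIV. pair_weight q z *\<^sub>R (f (fst z) * g (snd z))) = (\<Sum>b\<in>UNIV. q b *\<^sub>R f b) * (\<Sum>b\<in>UNIV. q b *\<^sub>R g b)"
  unfolding UNIV_Times_UNIV[symmetric] sum_product sum.cartesian_product
  by (auto intro!: sum.cong simp: pair_weight_def)

lemma (in weights) weights_pair: "weights (pair_weight q)"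
proof
  show "0 \<le> pair_weight q b" for b by (simp add: pair_weight_def nonneg)
  show "(\<Sum>b\<in>UNIV. pair_weight q b) = 1"
    using sum_pair_weight[of q "\<lambda>_. 1::real" "\<lambda>_. 1"] by (simp add: sum_1)
qed

lemma pexp_pair:
  fixes H K :: "('i \<Rightarrow> 'b::finite) \<Rightarrow> 'c::real_algebra"
  assumes "finite I" "depends_on I H" "depends_on I K"
  shows "pexp (pair_weight q) I (\<lambda>x. H (fst \<circ> x) * K (snd \<circ> x)) = pexp q I H * pexp q I K"
  using assms
proof (induction I arbitrary: H K)
  case empty
  have "H (fst \<circ> (\<lambda>_::'i. undefined :: 'b \<times> 'b)) = H (\<lambda>_. undefined)"
    by (rule depends_onD[OF empty(1)]) simp
  moreover have "K (snd \<circ> (\<lambda>_::'i. undefined :: 'b \<times> 'b)) = K (\<lambda>_. undefined)"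
    by (rule depends_onD[OF empty(2)]) simp
  ultimately show ?case by (simp only: pexp_empty)
next
  case (insert i I)
  have "depends_on I (\<lambda>x. H (x(i := b)))" "depends_on I (\<lambda>x. K (x(i := b)))" for b
    using depends_on_upd[OF insert.prems(1), of i b] depends_on_upd[OF insert.prems(2), of i b] insert.hyps
    by (simp_all del: fun_upd_apply)
  then have "pexp (pair_weight q) I (\<lambda>x. H ((fst \<circ> x)(i := fst b)) * K ((snd \<circ> x)(i := snd b))) =
     pexp q I (\<lambda>x. H (x(i := fst b))) * pexp q I (\<lambda>x. K (x(i := snd b)))" for b
    by (rule insert.IH)
  moreover have "fst \<circ> x(i := b) = (fst \<circ> x)(i := fst b)" "snd \<circ> x(i := b) = (snd \<circ> x)(i := snd b)"
    for x :: "'i \<Rightarrow> 'b \<times> 'b" and b by auto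
  ultimately show ?case
    by (simp only: pexp_insert[OF insert.hyps]
      sum_pair_weight[of q "\<lambda>b. pexp q I (\<lambda>x. H (x(i := b)))" "\<lambda>b. pexp q I (\<lambda>x. K (x(i := b)))"])
qed

definition sel :: "('i \<Rightarrow> bool) \<Rightarrow> ('i \<Rightarrow> 'b \<times> 'b) \<Rightarrow> 'i \<Rightarrow> 'b" where
  "sel h x = (\<lambda>i. if h i then snd (x i) else fst (x i))"

text \<open>Both components of a doubled coordinate have law \<open>q\<close>, so any selection of
  components fixed in advance has the law of a single copy.\<close>

lemma (in weights) pexp_sel:
  fixes f :: "('i \<Rightarrow> 'b) \<Rightarrow> 'c::real_algebra_1"
  assumes "finite I" "depends_on I f"
  shows "pexp (pair_weight q) I (\<lambda>x. f (sel h x)) = E I f"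
  using assms
proof (induction I arbitrary: f)
  case empty
  have "f (sel h (\<lambda>_. undefined)) = f (\<lambda>_. undefined)"
    by (rule depends_onD[OF empty]) simp
  then show ?case by (simp only: pexp_empty)
next
  case (insert i I)
  have up: "sel h (x(i := b)) = (sel h x)(i := if h i then snd b else fst b)" for x and b :: "'b \<times> 'b"
    by (auto simp: sel_def fun_eq_iff)
  have "depends_on I (\<lambda>x. f (x(i := b)))" for b
    using depends_on_upd[OF insert.prems, of i b] insert.hyps by (simp del: fun_upd_apply)
  then have "pexp (pair_weight q) I (\<lambda>x. f ((sel h x)(i := b))) = E I (\<lambda>x. f (x(i := b)))" for b
    by (rule insert.IH)
  then have "pexp (pair_weight q) (insert i I) (\<lambda>x. f (sel h x)) =
    (\<Sum>z\<in>UNIV. pair_weight q z *\<^sub>R E I (\<lambda>x. f (x(i := if h i then snd z else fst z))))"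
    using insert.hyps by (simp add: pexp_insert up del: fun_upd_apply)
  also have "\<dots> = E (insert i I) f"
    using insert.hyps sum_pair_weight[of q "\<lambda>b. E I (\<lambda>x. f (x(i := b)))" "\<lambda>_. 1"]
      sum_pair_weight[of q "\<lambda>_. 1" "\<lambda>b. E I (\<lambda>x. f (x(i := b)))"]
    by (cases "h i") (simp_all add: pexp_insert scaleR_sum_left[symmetric] sum_1)
  finally show ?case .
qed

section \<open>Polynomials in independent centred variables\<close>

definition mon :: "('b \<Rightarrow> real) \<Rightarrow> 'i set \<Rightarrow> ('i \<Rightarrow> 'b) \<Rightarrow> real" where
  "mon \<zeta> F x = (\<Prod>i\<in>F. \<zeta> (x i))"

text \<open>The multilinear (Fourier-Walsh) expansion over a product space. The sum runs over all of
  \<open>Pow I\<close>; the support is left to the coefficient function.\<close>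

definition pol :: "('b \<Rightarrow> real) \<Rightarrow> 'i set \<Rightarrow> ('i set \<Rightarrow> real) \<Rightarrow> ('i \<Rightarrow> 'b) \<Rightarrow> real" where
  "pol \<zeta> I c x = (\<Sum>F\<in>Pow I. c F * mon \<zeta> F x)"

lemma depends_on_mon: "depends_on F (mon \<zeta> F)"
  unfolding mon_def by (intro depends_on_prod depends_onI) auto

lemma depends_on_pol: "depends_on I (pol \<zeta> I c)"
  unfolding pol_def
  by (intro depends_on_sum depends_on_comp[where h = "\<lambda>y. c _ * y"] depends_on_mono[OF depends_on_mon]) auto

lemma abs_mon_le: "(\<And>b. \<bar>\<zeta> b\<bar> \<le> 1) \<Longrightarrow> \<bar>mon \<zeta> F x\<bar> \<le> 1"
  by (auto simp: mon_def abs_prod intro!: prod_le_1)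

lemma sum_Pow_insert:
  assumes "finite I" "i \<notin> I"
  shows "(\<Sum>F\<in>Pow (insert i I). f F) = (\<Sum>F\<in>Pow I. f F) + (\<Sum>F\<in>Pow I. f (insert i F))"
proof -
  have "inj_on (insert i) (Pow I)" using assms by (auto simp: inj_on_def)
  then show ?thesis
    unfolding Pow_insert using assms
    by (subst sum.union_disjoint) (auto simp: sum.reindex)
qed

text \<open>A multilinear polynomial is affine in each single variable; the inductions over
  coordinates below rest on this.\<close>

lemma pol_insert:
  assumes "finite I" "i \<notin> I"
  shows "pol \<zeta> (insert i I) c (x(i := b)) = pol \<zeta> I c x + \<zeta> b * pol \<zeta> I (\<lambda>F. c (insert i F)) x"
proof -
  have 1: "mon \<zeta> F (x(i := b)) = mon \<zeta> F x" if "F \<in> Pow I" for F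
    unfolding mon_def using that assms by (intro prod.cong) auto
  have 2: "mon \<zeta> (insert i F) (x(i := b)) = \<zeta> b * mon \<zeta> F x" if "F \<in> Pow I" for F
  proof -
    have "finite F" "i \<notin> F" using that assms finite_subset by auto
    then have "mon \<zeta> (insert i F) (x(i := b)) = \<zeta> b * mon \<zeta> F (x(i := b))"
      by (simp add: mon_def del: fun_upd_apply) simp
    then show ?thesis using 1[OF that] by simp
  qed
  show ?thesis
    unfolding pol_def sum_Pow_insert[OF assms] sum_distrib_left
    by (intro arg_cong2[where f = "(+)"] sum.cong) (auto simp: 1 2)
qed

locale centred = weights q for q :: "'b::finite \<Rightarrow> real" +
  fixes \<zeta> :: "'b \<Rightarrow> real"
  assumes centred: "(\<Sum>b\<in>UNIV. q b * \<zeta> b) = 0" and bounded: "\<bar>\<zeta> b\<bar> \<le> 1"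
begin

definition "var = (\<Sum>b\<in>UNIV. q b * (\<zeta> b)\<^sup>2)"

lemma pexp_pol: "finite I \<Longrightarrow> E I (pol \<zeta> I c) = c {}"
proof (induction I arbitrary: c rule: finite_induct)
  case empty
  then show ?case by (simp add: pol_def mon_def)
next
  case (insert i I)
  have "E (insert i I) (pol \<zeta> (insert i I) c)
     = (\<Sum>b\<in>UNIV. q b * (c {} + \<zeta> b * c {i}))"
    using insert by (simp add: pexp_insert pol_insert pexp_add pexp_mult_left)
  also have "\<dots> = (\<Sum>b\<in>UNIV. q b) * c {} + (\<Sum>b\<in>UNIV. q b * \<zeta> b) * c {i}"
    by (simp add: sum_distrib_right sum_distrib_left sum.distrib algebra_simps)
  finally show ?case by (simp add: sum_1 centred)
qed

text \<open>Parseval's identity: in the induction the mixed term carries the mean of \<zeta> and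
  vanishes.\<close>

lemma pexp_pol_square: "finite I \<Longrightarrow> E I (\<lambda>x. (pol \<zeta> I c x)\<^sup>2) = (\<Sum>F\<in>Pow I. var ^ card F * (c F)\<^sup>2)"
proof (induction I arbitrary: c rule: finite_induct)
  case empty
  then show ?case by (simp add: pol_def mon_def)
next
  case (insert i I)
  define g where "g = pol \<zeta> I c"
  define h where "h = pol \<zeta> I (\<lambda>F. c (insert i F))"
  have "E (insert i I) (\<lambda>x. (pol \<zeta> (insert i I) c x)\<^sup>2)
     = (\<Sum>b\<in>UNIV. q b * E I (\<lambda>x. (g x + \<zeta> b * h x)\<^sup>2))"
    using insert by (simp add: pexp_insert pol_insert g_def h_def del: fun_upd_apply)
  also have "\<dots> = (\<Sum>b\<in>UNIV. q b * (E I (\<lambda>x. (g x)\<^sup>2) + 2 * \<zeta> b * E I (\<lambda>x. g x * h x) + (\<zeta> b)\<^sup>2 * E I (\<lambda>x. (h x)\<^sup>2)))"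
  proof (intro sum.cong refl)
    fix b
    have "(\<lambda>x. (g x + \<zeta> b * h x)\<^sup>2) = (\<lambda>x. (g x)\<^sup>2 + 2 * \<zeta> b * (g x * h x) + (\<zeta> b)\<^sup>2 * (h x)\<^sup>2)"
      by (simp add: power2_eq_square algebra_simps)
    then show "q b * E I (\<lambda>x. (g x + \<zeta> b * h x)\<^sup>2) = q b * (E I (\<lambda>x. (g x)\<^sup>2) + 2 * \<zeta> b * E I (\<lambda>x. g x * h x) + (\<zeta> b)\<^sup>2 * E I (\<lambda>x. (h x)\<^sup>2))"
      by (simp only: pexp_add pexp_mult_left)
  qed
  also have "\<dots> = (\<Sum>b\<in>UNIV. q b) * E I (\<lambda>x. (g x)\<^sup>2) + 2 * (\<Sum>b\<in>UNIV. q b * \<zeta> b) * E I (\<lambda>x. g x * h x)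
      + var * E I (\<lambda>x. (h x)\<^sup>2)"
    by (simp add: sum_distrib_right sum_distrib_left sum.distrib algebra_simps var_def)
  also have "\<dots> = E I (\<lambda>x. (g x)\<^sup>2) + var * E I (\<lambda>x. (h x)\<^sup>2)"
    by (simp add: sum_1 centred)
  also have "\<dots> = (\<Sum>F\<in>Pow I. var ^ card F * (c F)\<^sup>2) + (\<Sum>F\<in>Pow I. var * (var ^ card F * (c (insert i F))\<^sup>2))"
    by (simp add: g_def h_def insert.IH sum_distrib_left)
  also have "(\<Sum>F\<in>Pow I. var * (var ^ card F * (c (insert i F))\<^sup>2)) = (\<Sum>F\<in>Pow I. var ^ card (insert i F) * (c (insert i F))\<^sup>2)"
  proof (intro sum.cong refl)
    fix F assume "F \<in> Pow I"
    then have "finite F" "i \<notin> F" using insert.hyps finite_subset by auto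
    then show "var * (var ^ card F * (c (insert i F))\<^sup>2) = var ^ card (insert i F) * (c (insert i F))\<^sup>2"
      by simp
  qed
  finally show ?case using insert.hyps by (simp add: sum_Pow_insert)
qed

end

section \<open>Hypercontractive moment bounds\<close>

lemma mult_pow_le_sum_pow:
  fixes a b :: real assumes "0 \<le> a" "0 \<le> b"
  shows "a ^ i * b ^ j \<le> a ^ (i + j) + b ^ (i + j)"
proof (cases "a \<le> b")
  case True
  then have "a ^ i * b ^ j \<le> b ^ i * b ^ j" using assms by (intro mult_right_mono power_mono) auto
  moreover have "0 \<le> a ^ (i + j)" using assms by simp
  ultimately show ?thesis unfolding power_add[of b] by linarith
next
  case False
  then have "a ^ i * b ^ j \<le> a ^ i * a ^ j" using assms by (intro mult_left_mono power_mono) auto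
  moreover have "0 \<le> b ^ (i + j)" using assms by simp
  ultimately show ?thesis unfolding power_add[of a] by linarith
qed

context centred
begin

text \<open>In the binomial expansion the term of first order in \<open>h\<close> vanishes because
  \<zeta> is centred, and every term of order at least 2 contains a factor \<open>b\<close>. Hence
  adding a coordinate only adds a multiple of \<open>b\<close> to \<open>a\<close>, with a constant
  depending on \<open>k\<close> alone and not on the weights.\<close>

lemma moment_step:
  fixes g h :: "('i \<Rightarrow> 'b) \<Rightarrow> real"
  assumes "finite I" and k: "k \<ge> 1" and a: "a > 0" and b: "b > 0"
    and g: "E I (\<lambda>x. g x ^ (2 * k)) \<le> a ^ k" and h: "E I (\<lambda>x. h x ^ (2 * k)) \<le> b ^ k"
  shows "(\<Sum>c\<in>UNIV. q c * E I (\<lambda>x. (g x + \<zeta> c * h x) ^ (2 * k))) \<le> (a + 4 ^ (k + 1) * b) ^ k"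
proof -
  define \<alpha> \<beta> where "\<alpha> = sqrt a" and "\<beta> = sqrt b"
  have ab: "\<alpha> > 0" "\<beta> > 0" "\<alpha>\<^sup>2 = a" "\<beta>\<^sup>2 = b" using a b by (auto simp: \<alpha>_def \<beta>_def)
  have abk: "\<alpha> ^ (2 * k) = a ^ k" "\<beta> ^ (2 * k) = b ^ k" using ab by (simp_all add: power_mult)
  define mm where "mm j = (\<Sum>c\<in>UNIV. q c * \<zeta> c ^ j)" for j
  define cc where "cc j = E I (\<lambda>x. g x ^ (2 * k - j) * h x ^ j)" for j
  have mm: "\<bar>mm j\<bar> \<le> 1" for j
  proof -
    have "\<bar>mm j\<bar> \<le> (\<Sum>c\<in>UNIV. \<bar>q c * \<zeta> c ^ j\<bar>)" unfolding mm_def by (rule sum_abs)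
    also have "\<dots> \<le> (\<Sum>c\<in>UNIV. q c)"
      using bounded by (intro sum_mono) (auto simp: abs_mult nonneg power_abs intro!: mult_left_le power_le_one)
    finally show ?thesis by (simp add: sum_1)
  qed
  \<comment> \<open>This replaces Hoelder's inequality: after both factors are normalised, a mixed
    power is at most the sum of the two pure powers, which costs the factor 2.\<close>
  have cc: "\<bar>cc j\<bar> \<le> 2 * (\<alpha> ^ (2 * k - j) * \<beta> ^ j)" if "j \<le> 2 * k" for j
  proof -
    have "\<bar>cc j\<bar> \<le> E I (\<lambda>x. \<bar>g x\<bar> ^ (2 * k - j) * \<bar>h x\<bar> ^ j)"
      unfolding cc_def using norm_pexp_le[of I "\<lambda>x. g x ^ (2 * k - j) * h x ^ j"]
      by (simp add: abs_mult power_abs)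
    also have "\<dots> \<le> E I (\<lambda>x. (\<alpha> ^ (2 * k - j) * \<beta> ^ j) * (g x ^ (2 * k) / \<alpha> ^ (2 * k) + h x ^ (2 * k) / \<beta> ^ (2 * k)))"
    proof (rule pexp_mono)
      fix x
      have "(\<bar>g x\<bar> / \<alpha>) ^ (2 * k - j) * (\<bar>h x\<bar> / \<beta>) ^ j \<le> (\<bar>g x\<bar> / \<alpha>) ^ (2 * k) + (\<bar>h x\<bar> / \<beta>) ^ (2 * k)"
        using mult_pow_le_sum_pow[of "\<bar>g x\<bar> / \<alpha>" "\<bar>h x\<bar> / \<beta>" "2 * k - j" j] ab that by simp
      then show "\<bar>g x\<bar> ^ (2 * k - j) * \<bar>h x\<bar> ^ j \<le> (\<alpha> ^ (2 * k - j) * \<beta> ^ j) * (g x ^ (2 * k) / \<alpha> ^ (2 * k) + h x ^ (2 * k) / \<beta> ^ (2 * k))"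
        using ab by (simp add: power_divide field_simps power_even_abs)
    qed
    also have "\<dots> = (\<alpha> ^ (2 * k - j) * \<beta> ^ j) * (E I (\<lambda>x. g x ^ (2 * k)) / \<alpha> ^ (2 * k) + E I (\<lambda>x. h x ^ (2 * k)) / \<beta> ^ (2 * k))"
      by (simp add: pexp_mult_left pexp_add divide_inverse pexp_mult_right)
    also have "\<dots> \<le> (\<alpha> ^ (2 * k - j) * \<beta> ^ j) * (1 + 1)"
      using g h a b by (intro mult_left_mono add_mono) (auto simp: abk ab less_imp_le)
    finally show ?thesis by simp
  qed
  have "(\<Sum>c\<in>UNIV. q c * E I (\<lambda>x. (g x + \<zeta> c * h x) ^ (2 * k)))
     = (\<Sum>c\<in>UNIV. \<Sum>j\<le>2 * k. real (2 * k choose j) * cc j * (q c * \<zeta> c ^ j))"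
  proof (intro sum.cong refl)
    fix c
    have "(\<lambda>x. (g x + \<zeta> c * h x) ^ (2 * k)) = (\<lambda>x. \<Sum>j\<le>2 * k. (real (2 * k choose j) * \<zeta> c ^ j) * (g x ^ (2 * k - j) * h x ^ j))"
    proof
      fix x
      have "(\<zeta> c * h x + g x) ^ (2 * k) = (\<Sum>j\<le>2 * k. (real (2 * k choose j) * \<zeta> c ^ j) * (g x ^ (2 * k - j) * h x ^ j))"
        unfolding binomial_ring by (simp add: power_mult_distrib mult_ac)
      then show "(g x + \<zeta> c * h x) ^ (2 * k) = (\<Sum>j\<le>2 * k. (real (2 * k choose j) * \<zeta> c ^ j) * (g x ^ (2 * k - j) * h x ^ j))"
        by (simp add: add.commute)
    qed
    then have "E I (\<lambda>x. (g x + \<zeta> c * h x) ^ (2 * k)) = (\<Sum>j\<le>2 * k. (real (2 * k choose j) * \<zeta> c ^ j) * cc j)"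
      by (simp only: pexp_sum pexp_mult_left cc_def)
    then show "q c * E I (\<lambda>x. (g x + \<zeta> c * h x) ^ (2 * k)) = (\<Sum>j\<le>2 * k. real (2 * k choose j) * cc j * (q c * \<zeta> c ^ j))"
      by (simp add: sum_distrib_left mult_ac)
  qed
  also have "\<dots> = (\<Sum>j\<le>2 * k. real (2 * k choose j) * cc j * mm j)"
    by (subst sum.swap) (simp add: mm_def sum_distrib_left)
  also have "\<dots> \<le> (\<Sum>j\<le>2 * k. (if j = 0 then a ^ k else 0) + real (2 * k choose j) * (2 * (b * (a ^ (k - 1) + b ^ (k - 1)))))"
  proof (intro sum_mono)
    fix j assume j: "j \<in> {..2 * k}"
    have pos: "0 \<le> real (2 * k choose j) * (2 * (b * (a ^ (k - 1) + b ^ (k - 1))))" using a b by simp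
    consider "j = 0" | "j = 1" | "j \<ge> 2" by linarith
    then show "real (2 * k choose j) * cc j * mm j \<le> (if j = 0 then a ^ k else 0) + real (2 * k choose j) * (2 * (b * (a ^ (k - 1) + b ^ (k - 1))))"
    proof cases
      case 1
      then have "real (2 * k choose j) * cc j * mm j \<le> a ^ k"
        using g by (simp add: cc_def mm_def sum_1)
      then show ?thesis using 1 pos by simp
    next
      case 2
      then have "real (2 * k choose j) * cc j * mm j = 0" by (simp add: mm_def centred)
      moreover have "j \<noteq> 0" using 2 by simp
      ultimately show ?thesis using pos by (simp only: if_False add_0_left)
    next
      case 3
      have "cc j * mm j \<le> \<bar>cc j\<bar>"
        using mult_left_mono[OF mm[of j], of "\<bar>cc j\<bar>"] abs_ge_self[of "cc j * mm j"] by (simp add: abs_mult)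
      also have "\<dots> \<le> 2 * (\<alpha> ^ (2 * k - j) * \<beta> ^ j)" using cc j by auto
      also have "\<beta> ^ j = \<beta> ^ (j - 2) * b" using 3 ab
        by (metis le_add_diff_inverse2 power_add)
      also have "\<alpha> ^ (2 * k - j) * (\<beta> ^ (j - 2) * b) \<le> b * (\<alpha> ^ (2 * k - 2) + \<beta> ^ (2 * k - 2))"
        using mult_left_mono[OF mult_pow_le_sum_pow[of \<alpha> \<beta> "2 * k - j" "j - 2"], of b] ab b 3 j
        by (simp add: mult_ac)
      also have "\<alpha> ^ (2 * k - 2) = a ^ (k - 1)" using ab
        by (metis power_mult right_diff_distrib' mult.right_neutral)
      also have "\<beta> ^ (2 * k - 2) = b ^ (k - 1)" using ab
        by (metis power_mult right_diff_distrib' mult.right_neutral)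
      finally have "cc j * mm j \<le> 2 * (b * (a ^ (k - 1) + b ^ (k - 1)))" by simp
      then have "real (2 * k choose j) * (cc j * mm j) \<le> real (2 * k choose j) * (2 * (b * (a ^ (k - 1) + b ^ (k - 1))))"
        by (rule mult_left_mono) simp
      then show ?thesis using 3 by (simp add: mult.assoc)
    qed
  qed
  also have "\<dots> = a ^ k + 4 ^ k * (2 * (b * (a ^ (k - 1) + b ^ (k - 1))))"
  proof -
    have "(\<Sum>j\<le>2 * k. real (2 * k choose j)) = 4 ^ k"
      using choose_row_sum[of "2 * k"] by (metis of_nat_sum of_nat_power of_nat_numeral power_mult power2_eq_square numeral_times_numeral semiring_norm(12,13) num_double mult_2 numeral_Bit0 of_nat_add)
    then show ?thesis
      by (simp add: sum.distrib sum_distrib_right[symmetric])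
  qed
  \<comment> \<open>With B = 4^(k+1) b the error is exactly B times the average of a^(k-1) and
    b^(k-1), which (a + B)^(k-1) dominates.\<close>
  also have "\<dots> \<le> (a + 4 ^ (k + 1) * b) ^ k"
  proof -
    define B where "B = 4 ^ (k + 1) * b"
    have "1 * b \<le> B" unfolding B_def using b by (intro mult_right_mono one_le_power) auto
    then have Bb: "B \<ge> b" "B > 0" using b by auto
    have "(a + B) ^ k = a * (a + B) ^ (k - 1) + B * (a + B) ^ (k - 1)"
      using k by (metis distrib_right power_minus_mult mult.commute less_eq_Suc_le One_nat_def)
    moreover have "a ^ k \<le> a * (a + B) ^ (k - 1)"
    proof -
      have "a ^ k = a * a ^ (k - 1)" using k by (simp add: power_eq_if)
      also have "\<dots> \<le> a * (a + B) ^ (k - 1)" using a Bb by (intro mult_left_mono power_mono) auto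
      finally show ?thesis .
    qed
    moreover have "B * ((a ^ (k - 1) + b ^ (k - 1)) / 2) \<le> B * (a + B) ^ (k - 1)"
    proof (intro mult_left_mono)
      have "a ^ (k - 1) \<le> (a + B) ^ (k - 1)" "b ^ (k - 1) \<le> (a + B) ^ (k - 1)"
        using a b Bb by (auto intro!: power_mono)
      then show "(a ^ (k - 1) + b ^ (k - 1)) / 2 \<le> (a + B) ^ (k - 1)" by simp
    qed (use Bb in auto)
    moreover have "4 ^ k * (2 * (b * (a ^ (k - 1) + b ^ (k - 1)))) = B * ((a ^ (k - 1) + b ^ (k - 1)) / 2)"
      by (simp add: B_def)
    ultimately show ?thesis unfolding B_def by linarith
  qed
  finally show ?thesis .
qed

text \<open>A Bonami-type inequality, by induction over the coordinates. The price 4^(k+1) per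
  variable is far from sharp but free of the weights, so the right side carries plain squared
  coefficients instead of variances. The term \<delta> keeps both halves strictly positive, as
  \<open>moment_step\<close> divides by them.\<close>

theorem hypercontractivity:
  fixes c :: "'i set \<Rightarrow> real"
  assumes "finite I" "k \<ge> 1" "\<delta> > 0"
  shows "E I (\<lambda>x. pol \<zeta> I c x ^ (2 * k)) \<le> (\<delta> + (\<Sum>F\<in>Pow I. (4 ^ (k + 1)) ^ card F * (c F)\<^sup>2)) ^ k"
  using assms
proof (induction I arbitrary: c \<delta>)
  case empty
  have "pol \<zeta> {} c x ^ (2 * k) = ((c {})\<^sup>2) ^ k" for x
    by (simp add: pol_def mon_def power_mult)
  then show ?case using empty.prems by (auto intro!: power_mono)
next
  case (insert i I)
  let ?C = "4 ^ (k + 1) :: real"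
  define N where "N c = (\<Sum>F\<in>Pow I. ?C ^ card F * (c F)\<^sup>2)" for c :: "'i set \<Rightarrow> real"
  have N: "N c \<ge> 0" for c unfolding N_def by (intro sum_nonneg) auto
  let ?c = "\<lambda>F. c (insert i F)"
  have "E (insert i I) (\<lambda>x. pol \<zeta> (insert i I) c x ^ (2 * k))
     = (\<Sum>b\<in>UNIV. q b * E I (\<lambda>x. (pol \<zeta> I c x + \<zeta> b * pol \<zeta> I ?c x) ^ (2 * k)))"
    using insert by (simp add: pexp_insert pol_insert del: fun_upd_apply)
  \<comment> \<open>The two shares of \<delta> are chosen so that they add up to \<delta> again once
    the second is multiplied by 4^(k+1).\<close>
  also have "\<dots> \<le> ((\<delta> / 2 + N c) + 4 ^ (k + 1) * (\<delta> / (2 * ?C) + N ?c)) ^ k"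
  proof (rule moment_step)
    show "E I (\<lambda>x. pol \<zeta> I c x ^ (2 * k)) \<le> (\<delta> / 2 + N c) ^ k"
      unfolding N_def using insert.prems by (intro insert.IH) auto
    show "E I (\<lambda>x. pol \<zeta> I ?c x ^ (2 * k)) \<le> (\<delta> / (2 * ?C) + N ?c) ^ k"
      unfolding N_def using insert.prems by (intro insert.IH) auto
  qed (use insert N in \<open>auto intro!: add_pos_nonneg\<close>)
  also have "(\<delta> / 2 + N c) + 4 ^ (k + 1) * (\<delta> / (2 * ?C) + N ?c) = \<delta> + (N c + ?C * N ?c)"
    by (simp add: field_simps)
  also have "N c + ?C * N ?c = (\<Sum>F\<in>Pow (insert i I). ?C ^ card F * (c F)\<^sup>2)"
  proof -
    have "?C * N ?c = (\<Sum>F\<in>Pow I. ?C ^ card (insert i F) * (c (insert i F))\<^sup>2)"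
      unfolding N_def sum_distrib_left
    proof (intro sum.cong refl)
      fix F assume "F \<in> Pow I"
      then have "finite F" "i \<notin> F" using insert.hyps finite_subset by auto
      then show "?C * (?C ^ card F * (c (insert i F))\<^sup>2) = ?C ^ card (insert i F) * (c (insert i F))\<^sup>2"
        by simp
    qed
    then show ?thesis using insert.hyps by (simp add: sum_Pow_insert N_def)
  qed
  finally show ?case .
qed

end

section \<open>Decoupling\<close>

text \<open>The alternating sum over the vertices of a cube known from the Gowers-Cauchy-Schwarz
  inequality: each block is read as a whole from one of the two copies.\<close>

definition diffsum :: "('g \<Rightarrow> 'i set) \<Rightarrow> 'g set \<Rightarrow> (('i \<Rightarrow> 'b) \<Rightarrow> real) \<Rightarrow> ('i \<Rightarrow> 'b \<times> 'b) \<Rightarrow> real" where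
  "diffsum B G f x = (\<Sum>s\<in>Pow G. (- 1) ^ card s * f (sel (\<lambda>i. i \<in> (\<Union>g\<in>s. B g)) x))"

text \<open>The second copy is moved into the first place on \<open>A\<close>. The vacated component
  may be \<open>undefined\<close>, since differences over blocks disjoint from \<open>A\<close> read
  only first components there.\<close>

definition second_in :: "'i set \<Rightarrow> ('i \<Rightarrow> 'b \<times> 'b) \<Rightarrow> 'i \<Rightarrow> 'b \<times> 'b" where
  "second_in A z = (\<lambda>i. if i \<in> A then (snd (z i), undefined) else z i)"

lemma diffsum_cong:
  assumes "disjoint_family_on B (insert g G)" "g \<notin> G"
    and "\<And>i. i \<notin> B g \<Longrightarrow> z i = z' i" "\<And>i. i \<in> B g \<Longrightarrow> fst (z i) = fst (z' i)"
  shows "diffsum B G f z = diffsum B G f z'"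
  unfolding diffsum_def
proof (intro sum.cong refl)
  fix s assume s: "s \<in> Pow G"
  have "sel (\<lambda>i. i \<in> (\<Union>g\<in>s. B g)) z = sel (\<lambda>i. i \<in> (\<Union>g\<in>s. B g)) z'"
  proof
    fix i
    show "sel (\<lambda>i. i \<in> (\<Union>g\<in>s. B g)) z i = sel (\<lambda>i. i \<in> (\<Union>g\<in>s. B g)) z' i"
    proof (cases "i \<in> B g")
      case True
      have "i \<notin> (\<Union>g\<in>s. B g)"
      proof
        assume "i \<in> (\<Union>g\<in>s. B g)"
        then obtain g' where "g' \<in> s" "i \<in> B g'" by blast
        moreover have "g' \<in> insert g G" "g' \<noteq> g" using \<open>g' \<in> s\<close> s assms(2) by auto
        ultimately show False
          using assms(1) True by (auto simp: disjoint_family_on_def)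
      qed
      then show ?thesis using assms(4)[OF True] by (simp add: sel_def)
    next
      case False
      then show ?thesis using assms(3)[OF False] by (simp add: sel_def)
    qed
  qed
  then show "(- 1) ^ card s * f (sel (\<lambda>i. i \<in> (\<Union>g\<in>s. B g)) z) = (- 1) ^ card s * f (sel (\<lambda>i. i \<in> (\<Union>g\<in>s. B g)) z')"
    by simp
qed

lemma diffsum_insert:
  assumes "finite G" "g \<notin> G" "disjoint_family_on B (insert g G)"
  shows "diffsum B (insert g G) f z = diffsum B G f z - diffsum B G f (second_in (B g) z)"
proof -
  have "diffsum B (insert g G) f z = diffsum B G f z +
     (\<Sum>s\<in>Pow G. (- 1) ^ card (insert g s) * f (sel (\<lambda>i. i \<in> (\<Union>g\<in>insert g s. B g)) z))"
    unfolding diffsum_def by (rule sum_Pow_insert) fact+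
  also have "(\<Sum>s\<in>Pow G. (- 1) ^ card (insert g s) * f (sel (\<lambda>i. i \<in> (\<Union>g\<in>insert g s. B g)) z))
     = - diffsum B G f (second_in (B g) z)"
    unfolding diffsum_def sum_negf[symmetric]
  proof (intro sum.cong refl)
    fix s assume s: "s \<in> Pow G"
    then have fs: "finite s" "g \<notin> s" using assms finite_subset by auto
    have "sel (\<lambda>i. i \<in> (\<Union>g\<in>insert g s. B g)) z = sel (\<lambda>i. i \<in> (\<Union>g\<in>s. B g)) (second_in (B g) z)"
    proof
      fix i
      have "i \<notin> (\<Union>g\<in>s. B g)" if "i \<in> B g"
      proof
        assume "i \<in> (\<Union>g\<in>s. B g)"
        then obtain g' where "g' \<in> s" "i \<in> B g'" by blast
        moreover have "g' \<in> insert g G" "g' \<noteq> g" using \<open>g' \<in> s\<close> s assms(2) by auto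
        ultimately show False
          using assms(3) that by (auto simp: disjoint_family_on_def)
      qed
      then show "sel (\<lambda>i. i \<in> (\<Union>g\<in>insert g s. B g)) z i = sel (\<lambda>i. i \<in> (\<Union>g\<in>s. B g)) (second_in (B g) z) i"
        by (simp add: sel_def second_in_def)
    qed
    then show "(- 1) ^ card (insert g s) * f (sel (\<lambda>i. i \<in> (\<Union>g\<in>insert g s. B g)) z)
      = - ((- 1) ^ card s * f (sel (\<lambda>i. i \<in> (\<Union>g\<in>s. B g)) (second_in (B g) z)))"
      using fs by simp
  qed
  finally show ?thesis by simp
qed

text \<open>Condition on the coordinates outside the block \<open>B g\<close>. The squared modulus
  of the conditional mean is a mean over two independent copies of the block, and the product with
  the conjugate turns the phase into one more difference. Cauchy-Schwarz moves the square inside the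
  outer mean.\<close>

lemma (in weights) decoupling_step:
  fixes B :: "'g \<Rightarrow> 'i set" and f :: "('i \<Rightarrow> 'b) \<Rightarrow> real"
  assumes "finite I" "finite G" "g \<notin> G" "disjoint_family_on B (insert g G)" "B g \<subseteq> I"
  shows "(norm (pexp (pair_weight q) I (\<lambda>x. cis (diffsum B G f x))))\<^sup>2
    \<le> norm (pexp (pair_weight q) I (\<lambda>x. cis (diffsum B (insert g G) f x)))"
proof -
  interpret W: weights "pair_weight q" by (rule weights_pair)
  define A where "A = B g"
  define F where "F = diffsum B G f"
  define F' where "F' = diffsum B (insert g G) f"
  \<comment> \<open>On the block \<open>A\<close> the phase reads only first components, so a single
    copy \<open>u\<close> is lifted with dummy second components.\<close>
  define H where "H x u = cis (F (override_on x (\<lambda>i. (u i, undefined)) A))" for x and u :: "'i \<Rightarrow> 'b"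
  define \<Phi> where "\<Phi> x = pexp (pair_weight q) A (\<lambda>y. cis (F (override_on x y A)))" for x
  have fin: "finite A" "finite (I - A)" "I = (I - A) \<union> A" "(I - A) \<inter> A = {}"
    using assms by (auto simp: A_def finite_subset)
  have U: "pexp (pair_weight q) I \<Psi> = pexp (pair_weight q) (I - A) (\<lambda>x. pexp (pair_weight q) A (\<lambda>y. \<Psi> (override_on x y A)))"
    for \<Psi> :: "('i \<Rightarrow> 'b \<times> 'b) \<Rightarrow> complex"
    using pexp_union[OF fin(2,1,4), of "pair_weight q" \<Psi>] fin(3) by simp
  have dep: "depends_on A (H x)" for x
  proof (rule depends_onI)
    fix u v :: "'i \<Rightarrow> 'b" assume "\<And>i. i \<in> A \<Longrightarrow> u i = v i"
    then have "override_on x (\<lambda>i. (u i, undefined)) A = override_on x (\<lambda>i. (v i, undefined)) A"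
      by (simp add: override_on_def fun_eq_iff)
    then show "H x u = H x v" by (simp only: H_def)
  qed
  have F1: "cis (F (override_on x y A)) = H x (fst \<circ> y)" for x y
    unfolding H_def F_def A_def
    by (intro arg_cong[where f = cis] diffsum_cong[OF assms(4,3)]) (auto simp: override_on_def)
  have F2: "F (second_in A (override_on x y A)) = F (override_on x (\<lambda>i. (snd (y i), undefined)) A)" for x y
    by (rule arg_cong[where f = F]) (auto simp: second_in_def override_on_def)
  have F3: "H x (fst \<circ> y) * cnj (H x (snd \<circ> y)) = cis (F' (override_on x y A))" for x y
  proof -
    have "F' (override_on x y A) = F (override_on x y A) - F (override_on x (\<lambda>i. (snd (y i), undefined)) A)"
      unfolding F'_def F2[symmetric] unfolding F_def A_def by (rule diffsum_insert) fact+
    then have "cis (F' (override_on x y A)) = cis (F (override_on x y A)) * cnj (cis (F (override_on x (\<lambda>i. (snd (y i), undefined)) A)))"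
      by (simp add: cis_cnj cis_mult)
    moreover have "H x (snd \<circ> y) = cis (F (override_on x (\<lambda>i. (snd (y i), undefined)) A))"
      by (simp add: H_def o_def)
    ultimately show ?thesis by (simp only: F1[symmetric])
  qed
  have \<Phi>: "\<Phi> x = pexp q A (H x)" for x
    using pexp_pair[OF fin(1) dep[of x], of "\<lambda>_. 1" q] fin(1) unfolding \<Phi>_def F1
    by (simp add: depends_on_def)
  have "\<Phi> x * cnj (\<Phi> x) = pexp (pair_weight q) A (\<lambda>y. cis (F' (override_on x y A)))" for x
    unfolding \<Phi> pexp_cnj[symmetric]
    by (subst pexp_pair[symmetric, OF fin(1) dep depends_on_comp[OF dep]]) (simp only: F3)
  then have sq: "of_real ((norm (\<Phi> x))\<^sup>2) = pexp (pair_weight q) A (\<lambda>y. cis (F' (override_on x y A)))" for x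
    by (simp only: complex_norm_square)
  have "(norm (pexp (pair_weight q) I (\<lambda>x. cis (F x))))\<^sup>2 = (norm (pexp (pair_weight q) (I - A) \<Phi>))\<^sup>2"
    unfolding \<Phi>_def by (subst U) (rule refl)
  also have "\<dots> \<le> (pexp (pair_weight q) (I - A) (\<lambda>x. norm (\<Phi> x)))\<^sup>2"
    by (intro power_mono W.norm_pexp_le) auto
  also have "\<dots> \<le> pexp (pair_weight q) (I - A) (\<lambda>x. (norm (\<Phi> x))\<^sup>2)"
    by (rule W.pexp_square_le) (rule fin)
  also have "\<dots> \<le> norm (of_real (pexp (pair_weight q) (I - A) (\<lambda>x. (norm (\<Phi> x))\<^sup>2)) :: complex)"
    by simp
  also have "of_real (pexp (pair_weight q) (I - A) (\<lambda>x. (norm (\<Phi> x))\<^sup>2))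
     = pexp (pair_weight q) (I - A) (\<lambda>x. pexp (pair_weight q) A (\<lambda>y. cis (F' (override_on x y A))))"
    unfolding pexp_of_real[symmetric] sq ..
  also have "\<dots> = pexp (pair_weight q) I (\<lambda>x. cis (F' x))"
    by (rule U[symmetric])
  finally show ?thesis unfolding F_def F'_def .
qed

text \<open>Every class squares the modulus once, whence the exponent 2 ^ card G.\<close>

theorem (in weights) decoupling:
  fixes B :: "'g \<Rightarrow> 'i set" and f :: "('i \<Rightarrow> 'b) \<Rightarrow> real"
  assumes "finite I" "finite G" "disjoint_family_on B G" "\<And>g. g \<in> G \<Longrightarrow> B g \<subseteq> I" "depends_on I f"
  shows "norm (E I (\<lambda>x. cis (f x))) ^ (2 ^ card G) \<le> norm (pexp (pair_weight q) I (\<lambda>x. cis (diffsum B G f x)))"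
  using assms(2-4)
proof (induction G rule: finite_induct)
  case empty
  have "pexp (pair_weight q) I (\<lambda>x. cis (f (sel (\<lambda>i. False) x))) = E I (\<lambda>x. cis (f x))"
    by (rule pexp_sel) (use assms depends_on_comp in auto)
  then show ?case by (simp add: diffsum_def)
next
  case (insert g G)
  have "disjoint_family_on B G"
    using insert.prems by (auto simp: disjoint_family_on_def)
  then have IH: "norm (E I (\<lambda>x. cis (f x))) ^ (2 ^ card G) \<le> norm (pexp (pair_weight q) I (\<lambda>x. cis (diffsum B G f x)))"
    using insert by auto
  have "norm (E I (\<lambda>x. cis (f x))) ^ (2 ^ card (insert g G)) = (norm (E I (\<lambda>x. cis (f x))) ^ (2 ^ card G))\<^sup>2"
    by (simp only: card_insert_disjoint[OF insert.hyps] power_Suc2 power_mult)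
  also have "\<dots> \<le> (norm (pexp (pair_weight q) I (\<lambda>x. cis (diffsum B G f x))))\<^sup>2"
    by (rule power_mono[OF IH]) simp
  also have "\<dots> \<le> norm (pexp (pair_weight q) I (\<lambda>x. cis (diffsum B (insert g G) f x)))"
    by (rule decoupling_step) (use insert assms(1) in auto)
  finally show ?case .
qed

lemma diffsum_linear:
  "diffsum B G (\<lambda>x. \<Sum>a\<in>A. c a * f a x) x = (\<Sum>a\<in>A. c a * diffsum B G (f a) x)"
  unfolding diffsum_def by (simp add: sum_distrib_left mult_ac) (rule sum.swap)

text \<open>The terms with and without \<open>g\<close> differ only on the block \<open>B g\<close>,
  which the monomial does not see, and have opposite signs.\<close>

lemma diffsum_mon_dead:
  assumes "finite G" "g \<in> G" "disjoint_family_on B G" "F \<inter> B g = {}"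
  shows "diffsum B G (mon \<zeta> F) x = 0"
proof -
  define G' where "G' = G - {g}"
  have G: "G = insert g G'" "g \<notin> G'" "finite G'" using assms by (auto simp: G'_def)
  have "diffsum B G' (mon \<zeta> F) (second_in (B g) x) = diffsum B G' (mon \<zeta> F) x"
    unfolding diffsum_def
  proof (intro sum.cong refl arg_cong2[where f = times])
    fix s
    show "mon \<zeta> F (sel (\<lambda>i. i \<in> \<Union> (B ` s)) (second_in (B g) x)) = mon \<zeta> F (sel (\<lambda>i. i \<in> \<Union> (B ` s)) x)"
      unfolding mon_def using assms(4) by (intro prod.cong) (auto simp: sel_def second_in_def)
  qed
  then show ?thesis using G assms(3) by (simp add: diffsum_insert)
qed

text \<open>With exactly one variable in each block the choices of the copy for different blocks are
  made independently, so the alternating sum factors into differences.\<close>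

lemma diffsum_mon_transversal:
  assumes "finite G" "disjoint_family_on B G" "\<And>g. g \<in> G \<Longrightarrow> e g \<in> B g"
  shows "diffsum B G (mon \<zeta> (e ` G)) x = mon (\<lambda>z. \<zeta> (fst z) - \<zeta> (snd z)) (e ` G) x"
proof -
  have disj: "e g \<in> B g' \<longleftrightarrow> g = g'" if "g \<in> G" "g' \<in> G" for g g'
    using assms(2,3) that unfolding disjoint_family_on_def by (metis disjoint_iff)
  have inj: "inj_on e G" using disj assms(3) by (metis inj_onI)
  have "diffsum B G (mon \<zeta> (e ` G)) x =
    (\<Sum>s\<in>Pow G. (- 1) ^ card s * (\<Prod>g\<in>s. \<zeta> (snd (x (e g)))) * (\<Prod>g\<in>G - s. \<zeta> (fst (x (e g)))))"
    unfolding diffsum_def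
  proof (intro sum.cong refl)
    fix s assume s: "s \<in> Pow G"
    have "mon \<zeta> (e ` G) (sel (\<lambda>i. i \<in> \<Union> (B ` s)) x) = (\<Prod>g\<in>G. \<zeta> (sel (\<lambda>i. i \<in> \<Union> (B ` s)) x (e g)))"
      unfolding mon_def by (subst prod.reindex[OF inj]) simp
    also have "\<dots> = (\<Prod>g\<in>G. if g \<in> s then \<zeta> (snd (x (e g))) else \<zeta> (fst (x (e g))))"
    proof (intro prod.cong refl)
      fix g assume g: "g \<in> G"
      have "e g \<in> \<Union> (B ` s) \<longleftrightarrow> g \<in> s" using disj[OF g] s g by auto
      then show "\<zeta> (sel (\<lambda>i. i \<in> \<Union> (B ` s)) x (e g)) = (if g \<in> s then \<zeta> (snd (x (e g))) else \<zeta> (fst (x (e g))))"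
        by (simp add: sel_def)
    qed
    also have "\<dots> = (\<Prod>g\<in>s. \<zeta> (snd (x (e g)))) * (\<Prod>g\<in>G - s. \<zeta> (fst (x (e g))))"
    proof -
      have "G \<inter> {g. g \<in> s} = s" "G \<inter> - {g. g \<in> s} = G - s" using s by auto
      then show ?thesis using assms(1) by (subst prod.If_cases) auto
    qed
    finally show "(- 1) ^ card s * mon \<zeta> (e ` G) (sel (\<lambda>i. i \<in> \<Union> (B ` s)) x)
       = (- 1) ^ card s * (\<Prod>g\<in>s. \<zeta> (snd (x (e g)))) * (\<Prod>g\<in>G - s. \<zeta> (fst (x (e g))))" by simp
  qed
  also have "\<dots> = (\<Prod>g\<in>G. \<zeta> (fst (x (e g))) - \<zeta> (snd (x (e g))))"
    by (rule prod_diff_conv_sum[symmetric]) fact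
  also have "\<dots> = mon (\<lambda>z. \<zeta> (fst z) - \<zeta> (snd z)) (e ` G) x"
    unfolding mon_def by (subst prod.reindex[OF inj]) simp
  finally show ?thesis .
qed

section \<open>Independent phases with a small perturbation\<close>

lemma cis_sum: "finite A \<Longrightarrow> cis (\<Sum>a\<in>A. f a) = (\<Prod>a\<in>A. cis (f a))"
  by (induction A rule: finite_induct) (auto simp: cis_mult[symmetric])

context weights
begin

text \<open>Each coordinate of \<open>U\<close> lies in at most one of the disjoint supports.
  Choosing a common coordinate injects the groups that meet \<open>U\<close> into \<open>U\<close>,
  so at least \<open>card N - card U\<close> phases are independent of everything else and split
  off.\<close>

lemma phase_indep:
  fixes g :: "('i \<Rightarrow> 'b) \<Rightarrow> complex" and P :: "'m \<Rightarrow> ('i \<Rightarrow> 'b) \<Rightarrow> real"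
  assumes "finite I" "finite N" "finite U" and g: "depends_on U g" "\<And>x. norm (g x) \<le> \<beta>"
    and P: "\<And>m. m \<in> N \<Longrightarrow> depends_on (S m) (P m)" "disjoint_family_on S N"
    and \<rho>: "\<And>m. m \<in> N \<Longrightarrow> norm (E I (\<lambda>x. cis (P m x))) \<le> \<rho>" "0 \<le> \<rho>" "\<rho> \<le> 1"
  shows "norm (E I (\<lambda>x. g x * cis (\<Sum>m\<in>N. P m x))) \<le> \<beta> * \<rho> ^ (card N - card U)"
proof -
  define N1 where "N1 = {m\<in>N. S m \<inter> U = {}}"
  define N2 where "N2 = N - N1"
  have N: "N = N2 \<union> N1" "N2 \<inter> N1 = {}" "finite N1" "finite N2" using assms by (auto simp: N1_def N2_def)
  have "\<exists>\<phi>. \<forall>m\<in>N2. \<phi> m \<in> S m \<inter> U" by (intro bchoice) (auto simp: N1_def N2_def)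
  then obtain \<phi> where \<phi>: "\<And>m. m \<in> N2 \<Longrightarrow> \<phi> m \<in> S m \<and> \<phi> m \<in> U" by auto
  have "inj_on \<phi> N2"
  proof (rule inj_onI, rule ccontr)
    fix m m' assume a: "m \<in> N2" "m' \<in> N2" "\<phi> m = \<phi> m'" "m \<noteq> m'"
    then have "S m \<inter> S m' = {}" using P(2) N unfolding disjoint_family_on_def by blast
    then show False using \<phi>[OF a(1)] \<phi>[OF a(2)] a(3) by auto
  qed
  then have "card N2 \<le> card U"
    using \<phi> assms(3) by (intro card_inj_on_le[of \<phi>]) auto
  moreover have "card N = card N2 + card N1" using N card_Un_disjoint by metis
  ultimately have c: "card N - card U \<le> card N1" by simp
  have \<beta>: "0 \<le> \<beta>" using g(2)[of "\<lambda>_. undefined"] norm_ge_zero order_trans by blast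
  have "E I (\<lambda>x. g x * cis (\<Sum>m\<in>N. P m x)) = E I (\<lambda>x. (g x * cis (\<Sum>m\<in>N2. P m x)) * (\<Prod>m\<in>N1. cis (P m x)))"
    using N by (simp add: N(1) sum.union_disjoint cis_mult[symmetric] cis_sum mult.assoc del: cis_mult)
  also have "\<dots> = E I (\<lambda>x. g x * cis (\<Sum>m\<in>N2. P m x)) * E I (\<lambda>x. \<Prod>m\<in>N1. cis (P m x))"
  proof (rule pexp_mult_indep)
    show "depends_on (U \<union> (\<Union>m\<in>N2. S m)) (\<lambda>x. g x * cis (\<Sum>m\<in>N2. P m x))"
    proof (intro depends_on_comp2[where h = times] depends_on_comp[where h = cis] depends_on_sum)
      show "depends_on (U \<union> (\<Union>m\<in>N2. S m)) g" by (rule depends_on_mono[OF g(1)]) auto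
      show "depends_on (U \<union> (\<Union>m\<in>N2. S m)) (P m)" if "m \<in> N2" for m
        by (rule depends_on_mono[OF P(1)]) (use that N in auto)
    qed
    show "depends_on (\<Union>m\<in>N1. S m) (\<lambda>x. \<Prod>m\<in>N1. cis (P m x))"
      by (intro depends_on_prod depends_on_comp[where h = cis], rule depends_on_mono[OF P(1)])
         (use N in auto)
    have "S m \<inter> S m' = {}" if "m \<in> N2" "m' \<in> N1" for m m'
      using P(2) N that unfolding disjoint_family_on_def by (metis UnCI disjoint_iff)
    then show "(U \<union> (\<Union>m\<in>N2. S m)) \<inter> (\<Union>m\<in>N1. S m) = {}"
      by (auto simp: N1_def)
  qed fact
  also have "E I (\<lambda>x. \<Prod>m\<in>N1. cis (P m x)) = (\<Prod>m\<in>N1. E I (\<lambda>x. cis (P m x)))"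
    by (rule pexp_prod_indep[where A = S])
       (use assms(1) N P in \<open>auto intro!: depends_on_comp[where h = cis] simp: disjoint_family_on_def\<close>)
  finally have "norm (E I (\<lambda>x. g x * cis (\<Sum>m\<in>N. P m x))) =
     norm (E I (\<lambda>x. g x * cis (\<Sum>m\<in>N2. P m x))) * (\<Prod>m\<in>N1. norm (E I (\<lambda>x. cis (P m x))))"
    by (simp add: norm_mult prod_norm)
  also have "\<dots> \<le> \<beta> * \<rho> ^ card N1"
  proof (intro mult_mono)
    show "norm (E I (\<lambda>x. g x * cis (\<Sum>m\<in>N2. P m x))) \<le> \<beta>"
      by (rule norm_pexp_bound) (use g assms(1) in \<open>auto simp: norm_mult\<close>)
    have "(\<Prod>m\<in>N1. norm (E I (\<lambda>x. cis (P m x)))) \<le> (\<Prod>m\<in>N1. \<rho>)"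
      by (rule prod_mono) (use \<rho> N in auto)
    then show "(\<Prod>m\<in>N1. norm (E I (\<lambda>x. cis (P m x)))) \<le> \<rho> ^ card N1" by simp
  qed (use \<beta> in \<open>auto intro: prod_nonneg\<close>)
  also have "\<dots> \<le> \<beta> * \<rho> ^ (card N - card U)"
    using c \<rho> \<beta> by (intro mult_left_mono power_decreasing) auto
  finally show ?thesis .
qed

text \<open>Moving one factor of the power into \<open>g\<close> enlarges the set of coordinates of
  \<open>g\<close> by at most \<open>d\<close>, so \<open>d\<close> further groups are lost per
  factor. Truncated subtraction makes the estimate harmless once no group is left.\<close>

lemma phase_power:
  fixes g :: "('i \<Rightarrow> 'b) \<Rightarrow> complex" and P :: "'m \<Rightarrow> ('i \<Rightarrow> 'b) \<Rightarrow> real" and r :: "'a \<Rightarrow> ('i \<Rightarrow> 'b) \<Rightarrow> real"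
  assumes "finite I" "finite N"
    and P: "\<And>m. m \<in> N \<Longrightarrow> depends_on (S m) (P m)" "disjoint_family_on S N"
    and \<rho>: "\<And>m. m \<in> N \<Longrightarrow> norm (E I (\<lambda>x. cis (P m x))) \<le> \<rho>" "0 \<le> \<rho>" "\<rho> \<le> 1"
    and r: "\<And>a. a \<in> A \<Longrightarrow> depends_on (V a) (r a)" "\<And>a. a \<in> A \<Longrightarrow> finite (V a) \<and> card (V a) \<le> d"
      "\<And>a x. a \<in> A \<Longrightarrow> \<bar>r a x\<bar> \<le> b a"
    and "finite U" and g: "depends_on U g" "\<And>x. norm (g x) \<le> \<beta>"
  shows "norm (E I (\<lambda>x. g x * cis (\<Sum>m\<in>N. P m x) * of_real ((\<Sum>a\<in>A. r a x) ^ l)))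
     \<le> \<beta> * (\<Sum>a\<in>A. b a) ^ l * \<rho> ^ (card N - (card U + d * l))"
  using \<open>finite U\<close> g
proof (induction l arbitrary: g U \<beta>)
  case 0
  then show ?case using phase_indep[OF assms(1,2) 0(1,2,3) P \<rho>] by simp
next
  case (Suc l)
  have \<beta>: "0 \<le> \<beta>" using Suc.prems(3)[of "\<lambda>_. undefined"] norm_ge_zero order_trans by blast
  have b: "0 \<le> b a" if "a \<in> A" for a using r(3)[OF that, of "\<lambda>_. undefined"] by linarith
  have "E I (\<lambda>x. g x * cis (\<Sum>m\<in>N. P m x) * of_real ((\<Sum>a\<in>A. r a x) ^ Suc l))
     = (\<Sum>a\<in>A. E I (\<lambda>x. (g x * of_real (r a x)) * cis (\<Sum>m\<in>N. P m x) * of_real ((\<Sum>a\<in>A. r a x) ^ l)))"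
    by (subst pexp_sum[symmetric]) (simp add: sum_distrib_left sum_distrib_right mult_ac)
  also have "norm \<dots> \<le> (\<Sum>a\<in>A. \<beta> * b a * (\<Sum>a\<in>A. b a) ^ l * \<rho> ^ (card N - (card U + d * Suc l)))"
  proof (rule sum_norm_le)
    fix a assume a: "a \<in> A"
    have "norm (E I (\<lambda>x. (g x * of_real (r a x)) * cis (\<Sum>m\<in>N. P m x) * of_real ((\<Sum>a\<in>A. r a x) ^ l)))
      \<le> \<beta> * b a * (\<Sum>a\<in>A. b a) ^ l * \<rho> ^ (card N - (card (U \<union> V a) + d * l))"
    proof (rule Suc.IH)
      show "depends_on (U \<union> V a) (\<lambda>x. g x * complex_of_real (r a x))"
        by (intro depends_on_comp2[where h = "\<lambda>u v. u * complex_of_real v"]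
            depends_on_mono[OF Suc.prems(2)] depends_on_mono[OF r(1)[OF a]]) auto
      show "norm (g x * complex_of_real (r a x)) \<le> \<beta> * b a" for x
        using Suc.prems(3)[of x] r(3)[OF a, of x] \<beta> by (auto simp: norm_mult intro!: mult_mono)
    qed (use Suc.prems r(2)[OF a] in auto)
    also have "\<dots> \<le> \<beta> * b a * (\<Sum>a\<in>A. b a) ^ l * \<rho> ^ (card N - (card U + d * Suc l))"
    proof (intro mult_left_mono power_decreasing)
      have "card (U \<union> V a) \<le> card U + d" using card_Un_le[of U "V a"] r(2)[OF a] by linarith
      then show "card N - (card U + d * Suc l) \<le> card N - (card (U \<union> V a) + d * l)" by simp
      show "0 \<le> \<beta> * b a * (\<Sum>a\<in>A. b a) ^ l"
        using \<beta> b a by (intro mult_nonneg_nonneg zero_le_power sum_nonneg) auto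
    qed (use \<rho> in auto)
    finally show "norm (E I (\<lambda>x. (g x * of_real (r a x)) * cis (\<Sum>m\<in>N. P m x) * of_real ((\<Sum>a\<in>A. r a x) ^ l)))
      \<le> \<beta> * b a * (\<Sum>a\<in>A. b a) ^ l * \<rho> ^ (card N - (card U + d * Suc l))" .
  qed
  also have "\<dots> = \<beta> * (\<Sum>a\<in>A. b a) ^ Suc l * \<rho> ^ (card N - (card U + d * Suc l))"
    by (simp add: sum_distrib_left sum_distrib_right mult_ac)
  finally show ?case .
qed

text \<open>The perturbation has only polynomially small moments while the main factor is
  exponentially small in \<open>card N\<close>. Expanding the exponential keeps that factor, up to
  \<open>d * l\<close> groups, in every term of order \<open>l\<close>; only the remainder relies on
  moments, and a large \<open>L\<close> makes it smaller than any given power.\<close>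

lemma phase_perturb:
  fixes P :: "'m \<Rightarrow> ('i \<Rightarrow> 'b) \<Rightarrow> real" and r :: "'a \<Rightarrow> ('i \<Rightarrow> 'b) \<Rightarrow> real"
  assumes "finite I" "finite N"
    and P: "\<And>m. m \<in> N \<Longrightarrow> depends_on (S m) (P m)" "disjoint_family_on S N"
    and \<rho>: "\<And>m. m \<in> N \<Longrightarrow> norm (E I (\<lambda>x. cis (P m x))) \<le> \<rho>" "0 \<le> \<rho>" "\<rho> \<le> 1"
    and r: "\<And>a. a \<in> A \<Longrightarrow> depends_on (V a) (r a)" "\<And>a. a \<in> A \<Longrightarrow> finite (V a) \<and> card (V a) \<le> d"
      "\<And>a x. a \<in> A \<Longrightarrow> \<bar>r a x\<bar> \<le> b a"
  shows "norm (E I (\<lambda>x. cis ((\<Sum>m\<in>N. P m x) + (\<Sum>a\<in>A. r a x))))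
     \<le> (\<Sum>l\<le>L. (\<Sum>a\<in>A. b a) ^ l * \<rho> ^ (card N - d * l)) + E I (\<lambda>x. \<bar>\<Sum>a\<in>A. r a x\<bar> ^ Suc L)"
proof -
  define R where "R x = (\<Sum>a\<in>A. r a x)" for x
  define C where "C x = cis (\<Sum>m\<in>N. P m x)" for x
  define T where "T y = (\<Sum>l\<le>L. (\<i> * complex_of_real y) ^ l / fact l)" for y :: real
  have "E I (\<lambda>x. cis ((\<Sum>m\<in>N. P m x) + R x)) = E I (\<lambda>x. C x * T (R x)) + E I (\<lambda>x. C x * (iexp (R x) - T (R x)))"
    unfolding pexp_add[symmetric] by (simp add: C_def cis_mult[symmetric] cis_conv_exp[of "R _"] algebra_simps del: cis_mult)
  also have "norm \<dots> \<le> norm (E I (\<lambda>x. C x * T (R x))) + norm (E I (\<lambda>x. C x * (iexp (R x) - T (R x))))"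
    by (rule norm_triangle_ineq)
  also have "norm (E I (\<lambda>x. C x * T (R x))) \<le> (\<Sum>l\<le>L. (\<Sum>a\<in>A. b a) ^ l * \<rho> ^ (card N - d * l))"
  proof -
    have "E I (\<lambda>x. C x * T (R x)) = (\<Sum>l\<le>L. (\<i> ^ l / fact l) * E I (\<lambda>x. 1 * C x * of_real (R x ^ l)))"
      unfolding pexp_mult_left[symmetric] pexp_sum[symmetric] T_def
      by (simp add: sum_distrib_left power_mult_distrib mult_ac)
    also have "norm \<dots> \<le> (\<Sum>l\<le>L. (\<Sum>a\<in>A. b a) ^ l * \<rho> ^ (card N - d * l))"
    proof (rule sum_norm_le)
      fix l
      have pp: "norm (E I (\<lambda>x. 1 * C x * of_real (R x ^ l))) \<le> 1 * (\<Sum>a\<in>A. b a) ^ l * \<rho> ^ (card N - (card ({}::'i set) + d * l))"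
        unfolding C_def R_def
        by (rule phase_power[OF assms(1,2) P \<rho> r]) (auto simp: depends_on_def)
      have "norm ((\<i> ^ l / fact l) * E I (\<lambda>x. 1 * C x * of_real (R x ^ l))) = (1 / fact l) * norm (E I (\<lambda>x. 1 * C x * of_real (R x ^ l)))"
        by (simp add: norm_mult norm_divide norm_power)
      also have "\<dots> \<le> 1 * norm (E I (\<lambda>x. 1 * C x * of_real (R x ^ l)))"
        by (rule mult_right_mono) (auto simp: fact_ge_1 divide_le_eq_1)
      finally show "norm ((\<i> ^ l / fact l) * E I (\<lambda>x. 1 * C x * of_real (R x ^ l))) \<le> (\<Sum>a\<in>A. b a) ^ l * \<rho> ^ (card N - d * l)"
        using pp by simp
    qed
    finally show ?thesis .
  qed
  also have "norm (E I (\<lambda>x. C x * (iexp (R x) - T (R x)))) \<le> E I (\<lambda>x. \<bar>R x\<bar> ^ Suc L)"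
  proof -
    have "norm (E I (\<lambda>x. C x * (iexp (R x) - T (R x)))) \<le> E I (\<lambda>x. norm (C x * (iexp (R x) - T (R x))))"
      by (rule norm_pexp_le)
    also have "\<dots> \<le> E I (\<lambda>x. \<bar>R x\<bar> ^ Suc L)"
    proof (rule pexp_mono)
      fix x
      have "norm (C x * (iexp (R x) - T (R x))) \<le> \<bar>R x\<bar> ^ Suc L / fact (Suc L)"
        using iexp_approx1[of "R x" L] by (simp add: norm_mult C_def T_def)
      also have "\<dots> \<le> \<bar>R x\<bar> ^ Suc L / 1"
        by (rule divide_left_mono) (auto simp: fact_ge_1 simp del: fact_Suc)
      finally show "norm (C x * (iexp (R x) - T (R x))) \<le> \<bar>R x\<bar> ^ Suc L" by simp
    qed
    finally show ?thesis .
  qed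
  finally show ?thesis unfolding R_def by simp
qed

end

text \<open>The additional bound keeps the difference of two copies within [-1, 1], so that the
  doubled space with \<open>\<eta>\<close> is again an instance of \<open>centred\<close>.\<close>

locale spread = centred q \<zeta> for q :: "'b::finite \<Rightarrow> real" and \<zeta> +
  assumes spread: "\<bar>\<zeta> b - \<zeta> b'\<bar> \<le> 1"
begin

definition "\<eta> z = \<zeta> (fst z) - \<zeta> (snd z)"

lemma centred_pair: "centred (pair_weight q) \<eta>"
proof -
  interpret W: weights "pair_weight q" by (rule weights_pair)
  show ?thesis
  proof
    show "(\<Sum>b\<in>UNIV. pair_weight q b * \<eta> b) = 0"
      using sum_pair_weight[of q \<zeta> "\<lambda>_. 1"] sum_pair_weight[of q "\<lambda>_. 1" \<zeta>]
      by (simp add: \<eta>_def right_diff_distrib sum_subtractf centred)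
    show "\<bar>\<eta> b\<bar> \<le> 1" for b by (simp add: \<eta>_def spread)
  qed
qed

lemma var_pair: "centred.var (pair_weight q) \<eta> = 2 * var"
proof -
  interpret W: centred "pair_weight q" \<eta> by (rule centred_pair)
  have "W.var = (\<Sum>z\<in>UNIV. pair_weight q z * ((\<zeta> (fst z))\<^sup>2 * 1)) + (\<Sum>z\<in>UNIV. pair_weight q z * (1 * (\<zeta> (snd z))\<^sup>2))
     - 2 * (\<Sum>z\<in>UNIV. pair_weight q z * (\<zeta> (fst z) * \<zeta> (snd z)))"
    unfolding W.var_def \<eta>_def sum_distrib_left sum.distrib[symmetric] sum_subtractf[symmetric]
    by (intro sum.cong refl) (simp add: power2_eq_square algebra_simps)
  also have "\<dots> = 2 * var"
    using sum_pair_weight[of q "\<lambda>b. (\<zeta> b)\<^sup>2" "\<lambda>_. 1"] sum_pair_weight[of q "\<lambda>_. 1" "\<lambda>b. (\<zeta> b)\<^sup>2"]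
      sum_pair_weight[of q \<zeta> \<zeta>]
    by (simp add: sum_1 centred var_def)
  finally show ?thesis .
qed

end

section \<open>Loss of modulus of one homogeneous phase\<close>

context centred
begin

lemma var_le_1: "var \<le> 1"
proof -
  have "var \<le> (\<Sum>b\<in>UNIV. q b * 1)"
    unfolding var_def using bounded by (intro sum_mono mult_left_mono) (auto simp: nonneg abs_square_le_1)
  then show ?thesis by (simp add: sum_1)
qed

lemma var_nonneg: "0 \<le> var"
  unfolding var_def by (intro sum_nonneg mult_nonneg_nonneg) (auto simp: nonneg)

text \<open>A second-order Taylor expansion with mean 0 and second moment V = var^g W gains V / 2.
  The smallness of \<open>W\<close> makes the fourth moment at most V by hypercontractivity, so the
  third-order error is at most V / 6.\<close>

lemma phase_homogeneous:
  assumes "finite I" and c: "\<And>F. F \<subseteq> I \<Longrightarrow> c F \<noteq> 0 \<Longrightarrow> card F = g" "g \<ge> 1"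
    and W: "W = (\<Sum>F\<in>Pow I. (c F)\<^sup>2)" and small: "4 * 4096 ^ g * W \<le> var ^ g"
  shows "norm (E I (\<lambda>x. cis (pol \<zeta> I c x))) \<le> 1 - var ^ g * W / 3"
proof -
  define Y where "Y = pol \<zeta> I c"
  define V where "V = var ^ g * W"
  have W0: "0 \<le> W" unfolding W by (intro sum_nonneg) auto
  have c0: "c {} = 0" using c(1)[of "{}"] c(2) by (metis card.empty empty_subsetI not_one_le_zero)
  have sumc: "(\<Sum>F\<in>Pow I. t ^ card F * (c F)\<^sup>2) = t ^ g * W" for t :: real
    unfolding W sum_distrib_left using c(1) by (intro sum.cong refl) (metis PowD mult_eq_0_iff power2_eq_square)
  have m1: "E I Y = 0" unfolding Y_def using assms(1) c0 by (simp add: pexp_pol)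
  have m2: "E I (\<lambda>x. (Y x)\<^sup>2) = V" unfolding Y_def using assms(1) by (simp add: pexp_pol_square sumc V_def)
  have vg: "0 \<le> var ^ g" "var ^ g \<le> 1" using var_nonneg var_le_1 by (auto intro: power_le_one)
  have V0: "0 \<le> V" using W0 vg by (simp add: V_def)
  have "1 * W \<le> 4096 ^ g * W" using W0 by (intro mult_right_mono one_le_power) auto
  then have "4 * W \<le> 1" using small vg by simp
  then have V1: "V \<le> 1" using vg W0 mult_mono[of "var ^ g" 1 W 1] by (simp add: V_def)
  have m4: "E I (\<lambda>x. Y x ^ 4) \<le> V"
  proof (cases "W = 0")
    case True
    have "E I (\<lambda>x. Y x ^ 4) \<le> E I (\<lambda>x. 0)"
    proof (rule pexp_mono)
      fix x
      have "c F = 0" if "F \<in> Pow I" for F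
        using True assms(1) that unfolding W by (subst (asm) sum_nonneg_eq_0_iff) auto
      then show "Y x ^ 4 \<le> 0" by (simp add: Y_def pol_def)
    qed
    then show ?thesis using V0 by simp
  next
    case False
    then have "0 < 64 ^ g * W" using W0 by simp
    \<comment> \<open>For k = 2 the price per variable is 4^3 = 64, and squaring gives 4096. The
      free parameter is set equal to the sum itself, which produces the factor 4 and needs W >
      0.\<close>
    then have "E I (\<lambda>x. Y x ^ (2 * 2)) \<le> (64 ^ g * W + (\<Sum>F\<in>Pow I. (4 ^ (2 + 1)) ^ card F * (c F)\<^sup>2)) ^ 2"
      unfolding Y_def by (intro hypercontractivity assms) auto
    also have "\<dots> = (4 * 4096 ^ g * W) * W"
      unfolding sumc by (simp add: power2_eq_square power_mult_distrib[symmetric])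
    also have "\<dots> \<le> V" unfolding V_def using small W0 by (intro mult_right_mono) auto
    finally show ?thesis by simp
  qed
  have "norm (E I (\<lambda>x. cis (Y x))) \<le> norm (E I (\<lambda>x. 1 + \<i> * Y x - (Y x)\<^sup>2 / 2)) + norm (E I (\<lambda>x. cis (Y x) - (1 + \<i> * Y x - (Y x)\<^sup>2 / 2)))"
    unfolding pexp_diff using norm_triangle_ineq[of "E I (\<lambda>x. 1 + \<i> * Y x - (Y x)\<^sup>2 / 2)"
      "E I (\<lambda>x. cis (Y x)) - E I (\<lambda>x. 1 + \<i> * Y x - (Y x)\<^sup>2 / 2)"] by (simp add: pexp_diff)
  also have "E I (\<lambda>x. 1 + \<i> * Y x - (Y x)\<^sup>2 / 2) = of_real (1 - V / 2)"
  proof -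
    have "E I (\<lambda>x. 1 + \<i> * Y x - (Y x)\<^sup>2 / 2) = E I (\<lambda>x. (1 + \<i> * Y x) - (1 / 2) * of_real ((Y x)\<^sup>2))"
      by simp
    also have "\<dots> = 1 + \<i> * of_real (E I Y) - (1 / 2) * of_real (E I (\<lambda>x. (Y x)\<^sup>2))"
      using assms(1) by (simp only: pexp_diff pexp_add pexp_mult_left pexp_of_real pexp_const)
    finally show ?thesis by (simp add: m1 m2)
  qed
  also have "norm (of_real (1 - V / 2) :: complex) = 1 - V / 2" using V1 by (simp only: norm_of_real)
  also have "norm (E I (\<lambda>x. cis (Y x) - (1 + \<i> * Y x - (Y x)\<^sup>2 / 2))) \<le> V / 6"
  proof -
    have "norm (E I (\<lambda>x. cis (Y x) - (1 + \<i> * Y x - (Y x)\<^sup>2 / 2))) \<le> E I (\<lambda>x. norm (cis (Y x) - (1 + \<i> * Y x - (Y x)\<^sup>2 / 2)))"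
      by (rule norm_pexp_le)
    also have "\<dots> \<le> E I (\<lambda>x. (1 / 12) * ((Y x)\<^sup>2 + Y x ^ 4))"
    proof (rule pexp_mono)
      fix x
      define y where "y = Y x"
      have "norm (cis y - (1 + \<i> * y - y\<^sup>2 / 2)) \<le> \<bar>y\<bar> ^ 3 / 6"
        using iexp_approx1[of y 2]
        by (simp add: cis_conv_exp numeral_2_eq_2 power2_eq_square fact_numeral mult_ac numeral_3_eq_3 algebra_simps)
      \<comment> \<open>Trades the odd moment for the second and the fourth, which are the ones
        under control.\<close>
      also have "\<bar>y\<bar> ^ 3 \<le> (y\<^sup>2 + y ^ 4) / 2"
      proof -
        have "0 \<le> (\<bar>y\<bar> - y\<^sup>2)\<^sup>2" by simp
        also have "\<dots> = y\<^sup>2 + y ^ 4 - 2 * \<bar>y\<bar> ^ 3"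
          by (simp add: power2_eq_square algebra_simps power4_eq_xxxx power3_eq_cube abs_mult_self_eq)
        finally show ?thesis by simp
      qed
      finally show "norm (cis (Y x) - (1 + \<i> * Y x - (Y x)\<^sup>2 / 2)) \<le> (1 / 12) * ((Y x)\<^sup>2 + Y x ^ 4)"
        unfolding y_def by simp
    qed
    also have "\<dots> = (1 / 12) * (V + E I (\<lambda>x. Y x ^ 4))" by (simp only: pexp_mult_left pexp_add m2)
    also have "\<dots> \<le> V / 6" using m4 by simp
    finally show ?thesis .
  qed
  finally show ?thesis unfolding Y_def V_def by (simp add: mult.commute)
qed

end

lemma abs_sum_pow_le:
  fixes y :: "'a \<Rightarrow> real"
  assumes "finite A" "n \<ge> 1"
  shows "\<bar>\<Sum>a\<in>A. y a\<bar> ^ n \<le> real (card A) ^ n * (\<Sum>a\<in>A. \<bar>y a\<bar> ^ n)"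
proof (cases "A = {}")
  case False
  define m where "m = Max ((\<lambda>a. \<bar>y a\<bar>) ` A)"
  have m: "\<bar>y a\<bar> \<le> m" if "a \<in> A" for a using assms that by (simp add: m_def)
  have "m \<in> (\<lambda>a. \<bar>y a\<bar>) ` A" unfolding m_def using assms False by (intro Max_in) auto
  then obtain a where a: "a \<in> A" "m = \<bar>y a\<bar>" by auto
  have "\<bar>\<Sum>a\<in>A. y a\<bar> \<le> (\<Sum>a\<in>A. \<bar>y a\<bar>)" by (rule sum_abs)
  also have "\<dots> \<le> real (card A) * m" using sum_bounded_above[of A "\<lambda>a. \<bar>y a\<bar>" m] m by simp
  finally have "\<bar>\<Sum>a\<in>A. y a\<bar> ^ n \<le> (real (card A) * m) ^ n" by (intro power_mono) auto
  also have "\<dots> = real (card A) ^ n * \<bar>y a\<bar> ^ n" by (simp add: power_mult_distrib a)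
  also have "\<dots> \<le> real (card A) ^ n * (\<Sum>a\<in>A. \<bar>y a\<bar> ^ n)"
    using assms a by (intro mult_left_mono member_le_sum) auto
  finally show ?thesis .
qed (use assms in \<open>simp add: power_0_left\<close>)

text \<open>The only monomials left after decoupling are those in \<open>main\<close> and in
  \<open>bad\<close>. The main ones are transversal to the blocks and become monomials in
  \<open>\<eta>\<close>, independent from group to group. The bad ones stay alternating sums of 2 ^
  card G evaluations and are treated as the perturbation, which explains the factors 2 ^ card G and
  8 ^ card G.\<close>

theorem (in spread) phase_bound:
  fixes c :: "'i set \<Rightarrow> real" and B :: "'g \<Rightarrow> 'i set" and main :: "'m \<Rightarrow> 'i set set"
  assumes fin: "finite I" "finite G" "G \<noteq> {}" "finite N"
    and B: "disjoint_family_on B G" "\<And>g. g \<in> G \<Longrightarrow> B g \<subseteq> I"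
    and main: "\<And>m F. m \<in> N \<Longrightarrow> F \<in> main m \<Longrightarrow> F \<subseteq> S m \<and> F \<subseteq> I \<and> (\<exists>e. F = e ` G \<and> (\<forall>g\<in>G. e g \<in> B g))"
    and S: "disjoint_family_on S N"
    and cover: "\<And>F. F \<subseteq> I \<Longrightarrow> c F \<noteq> 0 \<Longrightarrow> (\<forall>g\<in>G. F \<inter> B g \<noteq> {}) \<Longrightarrow> F \<in> bad \<or> (\<exists>m\<in>N. F \<in> main m)"
    and bad: "bad \<subseteq> Pow I" "\<And>m. m \<in> N \<Longrightarrow> bad \<inter> main m = {}" "\<And>F. F \<in> bad \<Longrightarrow> card F \<le> d"
    and \<rho>: "\<And>m. m \<in> N \<Longrightarrow> norm (pexp (pair_weight q) I (\<lambda>x. cis (\<Sum>F\<in>main m. c F * mon \<eta> F x))) \<le> \<rho>" "0 \<le> \<rho>" "\<rho> \<le> 1"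
    and k: "k \<ge> 1" "\<delta> > 0"
  shows "norm (E I (\<lambda>x. cis (pol \<zeta> I c x))) ^ (2 ^ card G) \<le>
     (\<Sum>l<2 * k. (2 ^ card G * (\<Sum>F\<in>bad. \<bar>c F\<bar>)) ^ l * \<rho> ^ (card N - d * l)) +
     (8 ^ card G * (\<delta> + (\<Sum>F\<in>bad. (4 ^ (k + 1)) ^ card F * (c F)\<^sup>2))) ^ k"
proof -
  interpret W: centred "pair_weight q" \<eta> by (rule centred_pair)
  define P where "P m x = (\<Sum>F\<in>main m. c F * mon \<eta> F x)" for m x
  \<comment> \<open>The perturbation is indexed by pairs of a cube vertex and a bad monomial, so
    that each single term depends on at most \<open>d\<close> coordinates.\<close>
  define A where "A = Pow G \<times> bad"
  define r where "r a x = (- 1) ^ card (fst a) * (c (snd a) * mon \<zeta> (snd a) (sel (\<lambda>i. i \<in> \<Union> (B ` fst a)) x))"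
    for a :: "'g set \<times> 'i set" and x :: "'i \<Rightarrow> 'b \<times> 'b"
  have finbad: "finite bad" using bad(1) fin(1) finite_subset by blast
  have finmain: "finite (main m)" if "m \<in> N" for m
    using main[OF that] fin(1) by (intro finite_subset[of "main m" "Pow I"]) auto
  have rsum: "(\<Sum>a\<in>A. r a x) = (\<Sum>F\<in>bad. c F * diffsum B G (mon \<zeta> F) x)" for x
  proof -
    have "(\<Sum>a\<in>A. r a x) = (\<Sum>s\<in>Pow G. \<Sum>F\<in>bad. r (s, F) x)"
      unfolding A_def sum.cartesian_product by (intro sum.cong) auto
    also have "\<dots> = (\<Sum>F\<in>bad. \<Sum>s\<in>Pow G. r (s, F) x)" by (rule sum.swap)
    finally show ?thesis by (simp add: r_def diffsum_def sum_distrib_left mult_ac)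
  qed
  have disjmain: "main m \<inter> main m' = {}" if "m \<in> N" "m' \<in> N" "m \<noteq> m'" for m m'
  proof (rule ccontr)
    assume "main m \<inter> main m' \<noteq> {}"
    then obtain F where F: "F \<in> main m" "F \<in> main m'" by auto
    then have "F \<subseteq> S m \<inter> S m'" using main that by blast
    then have "F = {}" using S that unfolding disjoint_family_on_def by (metis subset_empty)
    then show False using main[OF that(1) F(1)] fin(3) by auto
  qed
  have decomp: "diffsum B G (pol \<zeta> I c) x = (\<Sum>m\<in>N. P m x) + (\<Sum>a\<in>A. r a x)" for x
  proof -
    have "diffsum B G (pol \<zeta> I c) x = (\<Sum>F\<in>Pow I. c F * diffsum B G (mon \<zeta> F) x)"
      unfolding pol_def by (rule diffsum_linear)
    also have "\<dots> = (\<Sum>F\<in>(\<Union>m\<in>N. main m) \<union> bad. c F * diffsum B G (mon \<zeta> F) x)"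
    proof (rule sum.mono_neutral_right)
      show "(\<Union>m\<in>N. main m) \<union> bad \<subseteq> Pow I" using main bad(1) by blast
      show "\<forall>F\<in>Pow I - ((\<Union>m\<in>N. main m) \<union> bad). c F * diffsum B G (mon \<zeta> F) x = 0"
      proof
        fix F assume F: "F \<in> Pow I - ((\<Union>m\<in>N. main m) \<union> bad)"
        show "c F * diffsum B G (mon \<zeta> F) x = 0"
        proof (cases "c F = 0")
          case False
          then obtain g where "g \<in> G" "F \<inter> B g = {}" using cover[of F] F by auto
          then show ?thesis using diffsum_mon_dead[of G g B F \<zeta> x] fin(2) B(1) by simp
        qed simp
      qed
    qed (use fin in auto)
    also have "\<dots> = (\<Sum>F\<in>(\<Union>m\<in>N. main m). c F * diffsum B G (mon \<zeta> F) x) + (\<Sum>F\<in>bad. c F * diffsum B G (mon \<zeta> F) x)"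
      using fin finmain finbad bad(2) by (intro sum.union_disjoint) auto
    also have "(\<Sum>F\<in>(\<Union>m\<in>N. main m). c F * diffsum B G (mon \<zeta> F) x) = (\<Sum>m\<in>N. \<Sum>F\<in>main m. c F * diffsum B G (mon \<zeta> F) x)"
      using fin finmain disjmain by (intro sum.UNION_disjoint) auto
    also have "\<dots> = (\<Sum>m\<in>N. P m x)"
      unfolding P_def
    proof (intro sum.cong refl arg_cong2[where f = times])
      fix m F assume "m \<in> N" "F \<in> main m"
      then obtain e where e: "F = e ` G" "\<And>g. g \<in> G \<Longrightarrow> e g \<in> B g" using main by blast
      have "\<eta> = (\<lambda>z. \<zeta> (fst z) - \<zeta> (snd z))" by (simp add: \<eta>_def fun_eq_iff)
      then show "diffsum B G (mon \<zeta> F) x = mon \<eta> F x"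
        unfolding e(1) using diffsum_mon_transversal[where e = e, OF fin(2) B(1) e(2)] by simp
    qed
    finally show ?thesis by (simp add: rsum)
  qed
  have "norm (E I (\<lambda>x. cis (pol \<zeta> I c x))) ^ (2 ^ card G)
     \<le> norm (pexp (pair_weight q) I (\<lambda>x. cis ((\<Sum>m\<in>N. P m x) + (\<Sum>a\<in>A. r a x))))"
    unfolding decomp[symmetric] by (rule decoupling[OF fin(1,2) B depends_on_pol])
  also have "\<dots> \<le> (\<Sum>l\<le>2 * k - 1. (\<Sum>a\<in>A. \<bar>c (snd a)\<bar>) ^ l * \<rho> ^ (card N - d * l))
     + pexp (pair_weight q) I (\<lambda>x. \<bar>\<Sum>a\<in>A. r a x\<bar> ^ Suc (2 * k - 1))"
  proof (rule W.phase_perturb[where S = S and V = snd])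
    fix m assume m: "m \<in> N"
    show "depends_on (S m) (P m)" unfolding P_def
      by (intro depends_on_sum depends_on_comp[where h = "\<lambda>y. c _ * y"] depends_on_mono[OF depends_on_mon])
         (use main m in blast)
    show "norm (pexp (pair_weight q) I (\<lambda>x. cis (P m x))) \<le> \<rho>" unfolding P_def by (rule \<rho>) fact
  next
    fix a assume a: "a \<in> A"
    show "depends_on (snd a) (r a)"
    proof (rule depends_onI)
      fix x y :: "'i \<Rightarrow> 'b \<times> 'b" assume "\<And>i. i \<in> snd a \<Longrightarrow> x i = y i"
      then have "mon \<zeta> (snd a) (sel (\<lambda>i. i \<in> \<Union> (B ` fst a)) x) = mon \<zeta> (snd a) (sel (\<lambda>i. i \<in> \<Union> (B ` fst a)) y)"
        unfolding mon_def by (intro prod.cong) (auto simp: sel_def)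
      then show "r a x = r a y" by (simp add: r_def)
    qed
    show "finite (snd a) \<and> card (snd a) \<le> d"
    proof -
      have "snd a \<in> bad" using a unfolding A_def by auto
      then show ?thesis using bad(1,3) fin(1) finite_subset by blast
    qed
    show "\<bar>r a x\<bar> \<le> \<bar>c (snd a)\<bar>" for x
      using abs_mon_le[of \<zeta> "snd a"] bounded by (auto simp: r_def abs_mult power_abs intro!: mult_left_le)
  qed (use fin S \<rho> in auto)
  also have "(\<Sum>a\<in>A. \<bar>c (snd a)\<bar>) = 2 ^ card G * (\<Sum>F\<in>bad. \<bar>c F\<bar>)"
  proof -
    have "(\<Sum>a\<in>A. \<bar>c (snd a)\<bar>) = (\<Sum>s\<in>Pow G. \<Sum>F\<in>bad. \<bar>c F\<bar>)"
      unfolding A_def sum.cartesian_product by (intro sum.cong) auto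
    then show ?thesis using fin by (simp add: card_Pow)
  qed
  also have "{..2 * k - 1} = {..<2 * k}" using k by auto
  also have "Suc (2 * k - 1) = 2 * k" using k by simp
  also have "pexp (pair_weight q) I (\<lambda>x. \<bar>\<Sum>a\<in>A. r a x\<bar> ^ (2 * k)) \<le>
     (8 ^ card G * (\<delta> + (\<Sum>F\<in>bad. (4 ^ (k + 1)) ^ card F * (c F)\<^sup>2))) ^ k"
  proof -
    define c' where "c' F = (if F \<in> bad then c F else 0)" for F
    define X where "X = \<delta> + (\<Sum>F\<in>bad. (4 ^ (k + 1)) ^ card F * (c F)\<^sup>2)"
    have pol': "pol \<zeta> I c' x = (\<Sum>F\<in>bad. c F * mon \<zeta> F x)" for x
      unfolding pol_def using fin(1) bad(1)
      by (intro sum.mono_neutral_cong_right) (auto simp: c'_def)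
    have rs: "(\<Sum>a\<in>A. r a x) = (\<Sum>s\<in>Pow G. (- 1) ^ card s * pol \<zeta> I c' (sel (\<lambda>i. i \<in> \<Union> (B ` s)) x))" for x
    proof -
      have "(\<Sum>a\<in>A. r a x) = (\<Sum>s\<in>Pow G. \<Sum>F\<in>bad. r (s, F) x)"
        unfolding A_def sum.cartesian_product by (intro sum.cong) auto
      then show ?thesis by (simp add: r_def pol' sum_distrib_left)
    qed
    have X: "0 \<le> X" unfolding X_def using k by (intro add_nonneg_nonneg sum_nonneg) auto
    have XX: "E I (\<lambda>x. pol \<zeta> I c' x ^ (2 * k)) \<le> X ^ k"
    proof -
      have "(\<Sum>F\<in>Pow I. (4 ^ (k + 1)) ^ card F * (c' F)\<^sup>2) = (\<Sum>F\<in>bad. (4 ^ (k + 1)) ^ card F * (c F)\<^sup>2)"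
        using fin(1) bad(1) by (intro sum.mono_neutral_cong_right) (auto simp: c'_def)
      then show ?thesis using hypercontractivity[OF fin(1) k(1) k(2), of c'] by (simp add: X_def)
    qed
    have "pexp (pair_weight q) I (\<lambda>x. \<bar>\<Sum>a\<in>A. r a x\<bar> ^ (2 * k)) \<le>
      pexp (pair_weight q) I (\<lambda>x. (2 ^ card G) ^ (2 * k) * (\<Sum>s\<in>Pow G. pol \<zeta> I c' (sel (\<lambda>i. i \<in> \<Union> (B ` s)) x) ^ (2 * k)))"
    proof (rule W.pexp_mono)
      fix x
      have "\<bar>\<Sum>a\<in>A. r a x\<bar> ^ (2 * k) \<le> real (card (Pow G)) ^ (2 * k) *
        (\<Sum>s\<in>Pow G. \<bar>(- 1) ^ card s * pol \<zeta> I c' (sel (\<lambda>i. i \<in> \<Union> (B ` s)) x)\<bar> ^ (2 * k))"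
        unfolding rs using fin k by (intro abs_sum_pow_le) auto
      then show "\<bar>\<Sum>a\<in>A. r a x\<bar> ^ (2 * k) \<le> (2 ^ card G) ^ (2 * k) * (\<Sum>s\<in>Pow G. pol \<zeta> I c' (sel (\<lambda>i. i \<in> \<Union> (B ` s)) x) ^ (2 * k))"
        using fin by (simp add: card_Pow abs_mult power_abs power_even_abs)
    qed
    also have "\<dots> = (2 ^ card G) ^ (2 * k) * (\<Sum>s\<in>Pow G. E I (\<lambda>x. pol \<zeta> I c' x ^ (2 * k)))"
    proof -
      have "pexp (pair_weight q) I (\<lambda>x. pol \<zeta> I c' (sel h x) ^ (2 * k)) = E I (\<lambda>x. pol \<zeta> I c' x ^ (2 * k))" for h
        by (rule pexp_sel[OF fin(1) depends_on_comp[OF depends_on_pol]])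
      then show ?thesis by (simp add: pexp_mult_left pexp_sum)
    qed
    also have "\<dots> \<le> (2 ^ card G) ^ (2 * k) * (2 ^ card G * X ^ k)"
      using fin XX by (simp add: card_Pow)
    \<comment> \<open>The number of evaluations is weakened to its k-th power, so that all three
      factors 2 ^ card G can be gathered under one exponent.\<close>
    also have "\<dots> \<le> (2 ^ card G) ^ (2 * k) * ((2 ^ card G) ^ k * X ^ k)"
      using X k by (intro mult_left_mono mult_right_mono self_le_power) auto
    also have "\<dots> = (8 ^ card G * X) ^ k"
    proof -
      have "(8::real) ^ card G = (2 ^ card G) ^ 3" by (simp add: power_mult[symmetric] mult.commute[of _ 3]) (simp add: power_mult)
      then show ?thesis by (simp add: power_mult_distrib power_mult[symmetric] power_add[symmetric] mult.assoc[symmetric])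
    qed
    finally show ?thesis unfolding X_def .
  qed
  finally show ?thesis by simp
qed

section \<open>Bernoulli weights and subgraph counts\<close>

definition bern :: "real \<Rightarrow> bool \<Rightarrow> real" where "bern p b = (if b then p else 1 - p)"

definition cbern :: "real \<Rightarrow> bool \<Rightarrow> real" where "cbern p b = (if b then 1 - p else - p)"

lemma spread_bern:
  assumes "0 \<le> p" "p \<le> 1" shows "spread (bern p) (cbern p)"
proof
  show "0 \<le> bern p b" for b using assms by (simp add: bern_def)
  show "(\<Sum>b\<in>UNIV. bern p b) = 1" by (simp add: UNIV_bool bern_def)
  show "(\<Sum>b\<in>UNIV. bern p b * cbern p b) = 0" by (simp add: UNIV_bool bern_def cbern_def)
  show "\<bar>cbern p b\<bar> \<le> 1" for b using assms by (auto simp: cbern_def)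
  show "\<bar>cbern p b - cbern p b'\<bar> \<le> 1" for b b' by (auto simp: cbern_def)
qed

lemma var_bern:
  assumes "0 \<le> p" "p \<le> 1" shows "centred.var (bern p) (cbern p) = p * (1 - p)"
proof -
  interpret spread "bern p" "cbern p" by (rule spread_bern) fact+
  show ?thesis by (simp add: var_def UNIV_bool bern_def cbern_def power2_eq_square algebra_simps)
qed

lemma finite_all_edges [simp]: "finite (all_edges n)"
  unfolding all_edges_def by (rule finite_subset[of _ "Pow {..<n}"]) auto

lemma expectation_gnp:
  fixes g :: "nat set set \<Rightarrow> real"
  assumes "0 \<le> p" "p \<le> 1"
  shows "measure_pmf.expectation (gnp n p) g = pexp (bern p) (all_edges n) (\<lambda>x. g {e \<in> all_edges n. x e})"
proof -
  let ?E = "all_edges n"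
  let ?P = "Pi_pmf ?E undefined (\<lambda>_. bernoulli_pmf p)"
  \<comment> \<open>The random graph is built with default \<open>False\<close> off the edges, the
    product space with \<open>undefined\<close>. After the swap the support consists of extensional
    functions.\<close>
  have "Pi_pmf ?E False (\<lambda>_. bernoulli_pmf p) = map_pmf (\<lambda>f x. if x \<in> ?E then f x else False) ?P"
    by (rule Pi_pmf_default_swap[symmetric]) simp
  then have "gnp n p = map_pmf (\<lambda>x. {e \<in> ?E. x e}) ?P"
    unfolding gnp_def by (simp add: map_pmf_comp cong: conj_cong)
  then have "measure_pmf.expectation (gnp n p) g = measure_pmf.expectation ?P (\<lambda>x. g {e \<in> ?E. x e})"
    by simp
  also have "\<dots> = (\<Sum>x\<in>PiE ?E (\<lambda>_. UNIV). pmf ?P x *\<^sub>R g {e \<in> ?E. x e})"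
  proof (rule integral_measure_pmf)
    show "finite (PiE ?E (\<lambda>_. UNIV :: bool set))" by (intro finite_PiE) auto
    fix x assume "x \<in> set_pmf ?P"
    then show "x \<in> PiE ?E (\<lambda>_. UNIV)"
      using set_Pi_pmf_subset[of ?E undefined "\<lambda>_. bernoulli_pmf p"] by (auto simp: PiE_def extensional_def)
  qed
  also have "\<dots> = pexp (bern p) ?E (\<lambda>x. g {e \<in> ?E. x e})"
    unfolding pexp_def
  proof (intro sum.cong refl)
    fix x assume x: "x \<in> PiE ?E (\<lambda>_. UNIV :: bool set)"
    have "pmf ?P x = (\<Prod>e\<in>?E. pmf (bernoulli_pmf p) (x e))"
      using x by (subst pmf_Pi) (auto simp: PiE_def extensional_def)
    also have "\<dots> = (\<Prod>e\<in>?E. bern p (x e))"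
      using assms by (intro prod.cong refl) (auto simp: bern_def)
    finally show "pmf ?P x *\<^sub>R g {e \<in> ?E. x e} = (\<Prod>e\<in>?E. bern p (x e)) *\<^sub>R g {e \<in> ?E. x e}" by simp
  qed
  finally show ?thesis .
qed

lemma card_supersets_le:
  assumes "finite X" "finite U"
  shows "card {A. A \<subseteq> X \<and> card A = v \<and> U \<subseteq> A} \<le> card X ^ (v - card U)"
proof -
  have "card {A. A \<subseteq> X \<and> card A = v \<and> U \<subseteq> A} \<le> card {B. B \<subseteq> X \<and> card B = v - card U}"
  proof (rule card_inj_on_le)
    show "inj_on (\<lambda>A. A - U) {A. A \<subseteq> X \<and> card A = v \<and> U \<subseteq> A}" by (auto simp: inj_on_def)
    show "(\<lambda>A. A - U) ` {A. A \<subseteq> X \<and> card A = v \<and> U \<subseteq> A} \<subseteq> {B. B \<subseteq> X \<and> card B = v - card U}"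
      using assms by (auto simp: card_Diff_subset)
  qed (use assms in auto)
  also have "\<dots> = card X choose (v - card U)" using assms by (simp add: n_subsets)
  also have "\<dots> \<le> card X ^ (v - card U)"
    by (cases "v - card U \<le> card X") (simp_all add: binomial_le_pow binomial_eq_0)
  finally show ?thesis .
qed

section \<open>Coefficients of the subgraph count\<close>

locale connected_pattern =
  fixes VH :: "'a set" and EH :: "'a set set"
  assumes simple: "simple_graph VH EH" and conn: "connected_graph VH EH" and card_ge_2: "card VH \<ge> 2"
begin

definition "v = card VH"
definition "d = card EH"
text \<open>Images of the edge set under injections, collected into a set: injections that differ by
  an automorphism of the pattern give one element.\<close>

definition "KK n = {K. \<exists>f. inj_on f VH \<and> f ` VH \<subseteq> {..<n::nat} \<and> K = (\<lambda>e. f ` e) ` EH}"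
definition "deg n F = card {K \<in> KK n. F \<subseteq> K}"
definition "coef n p F = real (deg n F) * p ^ (d - card F)"

lemma finite_VH: "finite VH" using simple by (simp add: simple_graph_def)
lemma edge: "e \<in> EH \<Longrightarrow> card e = 2 \<and> e \<subseteq> VH" using simple by (simp add: simple_graph_def)
lemma finite_EH: "finite EH" using edge finite_VH by (intro finite_subset[of EH "Pow VH"]) auto

text \<open>Along a walk from a vertex of \<open>P\<close> to one outside some step leaves
  \<open>P\<close>. This is the main form in which connectedness is used.\<close>

lemma crossing_edge:
  assumes "connected_graph V E" "P \<subseteq> V" "P \<noteq> {}" "P \<noteq> V"
  shows "\<exists>a b. a \<in> P \<and> b \<notin> P \<and> {a, b} \<in> E"
proof -
  obtain x y where xy: "x \<in> P" "y \<in> V" "y \<notin> P" using assms by auto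
  then have "(\<lambda>x y. {x, y} \<in> E)\<^sup>*\<^sup>* x y" using assms(1,2) by (auto simp: connected_graph_def)
  then have "y \<notin> P \<longrightarrow> ?thesis"
  proof (induction rule: rtranclp_induct)
    case base
    then show ?case using xy by simp
  next
    case (step y z)
    then show ?case by (cases "y \<in> P") auto
  qed
  then show ?thesis using xy by simp
qed

lemma Union_edges:
  assumes "connected_graph V E" "card V \<ge> 2" "\<And>e. e \<in> E \<Longrightarrow> e \<subseteq> V"
  shows "\<Union>E = V"
proof
  show "V \<subseteq> \<Union>E"
  proof
    fix x assume x: "x \<in> V"
    have "{x} \<noteq> V" using assms(2) by auto
    then obtain b where "{x, b} \<in> E" using crossing_edge[OF assms(1), of "{x}"] x by auto
    then show "x \<in> \<Union>E" by auto
  qed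
qed (use assms in auto)

lemma Union_EH: "\<Union>EH = VH" using Union_edges[OF conn card_ge_2] edge by blast

lemma EH_nonempty: "EH \<noteq> {}" using Union_EH card_ge_2 by auto

lemma d_pos: "d \<ge> 1" using EH_nonempty finite_EH by (simp add: d_def Suc_le_eq card_gt_0_iff)

lemma KK_props:
  assumes "K \<in> KK n"
  shows "K \<subseteq> all_edges n" "card K = d" "card (\<Union>K) = v" "\<Union>K \<subseteq> {..<n}"
proof -
  obtain f where f: "inj_on f VH" "f ` VH \<subseteq> {..<n}" "K = (\<lambda>e. f ` e) ` EH" using assms by (auto simp: KK_def)
  show "K \<subseteq> all_edges n"
  proof
    fix e assume "e \<in> K"
    then obtain e0 where e0: "e0 \<in> EH" "e = f ` e0" using f by auto
    have "card e = 2" using e0 edge[OF e0(1)] f(1) by (metis card_image inj_on_subset)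
    then show "e \<in> all_edges n" using e0 edge[OF e0(1)] f(2) by (auto simp: all_edges_def)
  qed
  have "inj_on (\<lambda>e. f ` e) EH"
    using f(1) edge by (intro inj_onI) (metis inj_on_image_eq_iff)
  then show "card K = d" using f(3) by (simp add: card_image d_def)
  have "\<Union>K = f ` VH" using f(3) Union_EH by auto
  then show "card (\<Union>K) = v" "\<Union>K \<subseteq> {..<n}" using f by (simp_all add: card_image v_def)
qed

lemma finite_KK_member: "K \<in> KK n \<Longrightarrow> finite K"
  using finite_subset[OF KK_props(1) finite_all_edges] .

lemma finite_KK [simp]: "finite (KK n)"
  using KK_props(1) by (intro finite_subset[of "KK n" "Pow (all_edges n)"]) auto

lemma copies_eq: "copies VH EH n A = card {K \<in> KK n. K \<subseteq> A}"
proof -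
  have "bij_betw snd {(V', E'). V' \<subseteq> {..<n} \<and> E' \<subseteq> A \<and>
      (\<exists>f. bij_betw f VH V' \<and> E' = (\<lambda>e. f ` e) ` EH)} {K \<in> KK n. K \<subseteq> A}"
  proof (rule bij_betwI')
    fix x y
    assume "x \<in> {(V', E'). V' \<subseteq> {..<n} \<and> E' \<subseteq> A \<and> (\<exists>f. bij_betw f VH V' \<and> E' = (\<lambda>e. f ` e) ` EH)}"
      "y \<in> {(V', E'). V' \<subseteq> {..<n} \<and> E' \<subseteq> A \<and> (\<exists>f. bij_betw f VH V' \<and> E' = (\<lambda>e. f ` e) ` EH)}"
    moreover have "fst z = \<Union>(snd z)"
      if z: "z \<in> {(V', E'). V' \<subseteq> {..<n} \<and> E' \<subseteq> A \<and> (\<exists>f. bij_betw f VH V' \<and> E' = (\<lambda>e. f ` e) ` EH)}" for z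
    proof -
      obtain f where f: "bij_betw f VH (fst z)" "snd z = (\<lambda>e. f ` e) ` EH" using z by (cases z) auto
      have "\<Union>(snd z) = f ` \<Union>EH" unfolding f(2) by auto
      then show ?thesis using f(1) Union_EH by (simp add: bij_betw_def)
    qed
    ultimately have "fst x = \<Union>(snd x)" "fst y = \<Union>(snd y)" by (simp_all only:)
    then show "(snd x = snd y) = (x = y)" by (metis prod.expand)
  next
    fix x
    assume "x \<in> {(V', E'). V' \<subseteq> {..<n} \<and> E' \<subseteq> A \<and> (\<exists>f. bij_betw f VH V' \<and> E' = (\<lambda>e. f ` e) ` EH)}"
    then show "snd x \<in> {K \<in> KK n. K \<subseteq> A}" by (auto simp: KK_def bij_betw_def)
  next
    fix K assume "K \<in> {K \<in> KK n. K \<subseteq> A}"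
    then obtain f where "inj_on f VH" "f ` VH \<subseteq> {..<n}" "K = (\<lambda>e. f ` e) ` EH" "K \<subseteq> A" by (auto simp: KK_def)
    then show "\<exists>x\<in>{(V', E'). V' \<subseteq> {..<n} \<and> E' \<subseteq> A \<and> (\<exists>f. bij_betw f VH V' \<and> E' = (\<lambda>e. f ` e) ` EH)}. K = snd x"
      by (intro bexI[of _ "(f ` VH, K)"]) (auto simp: bij_betw_def)
  qed
  then show ?thesis unfolding copies_def by (rule bij_betw_same_card)
qed

text \<open>The indicator of an edge is \<open>cbern p\<close> plus p. The product over the edges of
  each copy is expanded, and the sums over copies and over edge sets are exchanged.\<close>

lemma copies_pol: "real (copies VH EH n {e \<in> all_edges n. x e}) = pol (cbern p) (all_edges n) (coef n p) x"
proof -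
  let ?E = "all_edges n"
  have "real (copies VH EH n {e \<in> ?E. x e}) = (\<Sum>K\<in>{K \<in> KK n. K \<subseteq> {e \<in> ?E. x e}}. 1)"
    by (simp add: copies_eq)
  also have "\<dots> = (\<Sum>K\<in>KK n. \<Prod>e\<in>K. cbern p (x e) + p)"
  proof (rule sum.mono_neutral_cong_left)
    show "\<forall>K\<in>KK n - {K \<in> KK n. K \<subseteq> {e \<in> ?E. x e}}. (\<Prod>e\<in>K. cbern p (x e) + p) = 0"
    proof
      fix K assume K: "K \<in> KK n - {K \<in> KK n. K \<subseteq> {e \<in> ?E. x e}}"
      then obtain e where "e \<in> K" "\<not> x e" using KK_props(1)[of K n] by auto
      moreover have "finite K" using K finite_KK_member[of K n] by auto
      ultimately show "(\<Prod>e\<in>K. cbern p (x e) + p) = 0" by (intro prod_zero) (auto simp: cbern_def)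
    qed
  qed (auto simp: cbern_def subset_iff)
  also have "\<dots> = (\<Sum>K\<in>KK n. \<Sum>F\<in>{F\<in>Pow ?E. F \<subseteq> K}. mon (cbern p) F x * p ^ (d - card F))"
  proof (intro sum.cong refl)
    fix K assume K: "K \<in> KK n"
    have fK: "finite K" by (rule finite_KK_member) fact
    have P: "Pow K = {F\<in>Pow ?E. F \<subseteq> K}" using KK_props(1)[OF K] by auto
    have "(\<Prod>e\<in>K. cbern p (x e) + p) = (\<Sum>F\<in>Pow K. (\<Prod>e\<in>F. cbern p (x e)) * (\<Prod>e\<in>K - F. p))"
      by (rule prod_add) fact
    also have "\<dots> = (\<Sum>F\<in>Pow K. mon (cbern p) F x * p ^ (d - card F))"
    proof (intro sum.cong refl)
      fix F assume "F \<in> Pow K"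
      then have "card (K - F) = d - card F"
        using KK_props(2)[OF K] fK by (metis PowD card_Diff_subset finite_subset)
      then show "(\<Prod>e\<in>F. cbern p (x e)) * (\<Prod>e\<in>K - F. p) = mon (cbern p) F x * p ^ (d - card F)"
        by (simp add: mon_def)
    qed
    finally show "(\<Prod>e\<in>K. cbern p (x e) + p) = (\<Sum>F\<in>{F\<in>Pow ?E. F \<subseteq> K}. mon (cbern p) F x * p ^ (d - card F))"
      unfolding P .
  qed
  also have "\<dots> = (\<Sum>F\<in>Pow ?E. \<Sum>K\<in>{K\<in>KK n. F \<subseteq> K}. mon (cbern p) F x * p ^ (d - card F))"
    by (rule sum.swap_restrict) auto
  also have "\<dots> = pol (cbern p) ?E (coef n p) x"
    by (simp add: pol_def coef_def deg_def mult_ac)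
  finally show ?thesis .
qed

text \<open>A copy containing \<open>F\<close> has one of at most n^(v - card (\<Union>F)) vertex
  sets, and on a given vertex set there are at most 2^(2^v) edge sets. This crude count is the
  origin of the constant that recurs below.\<close>

lemma deg_le: "real (deg n F) \<le> 2 ^ (2 ^ v) * real n ^ (v - card (\<Union>F))"
proof (cases "deg n F = 0")
  case False
  let ?S = "{A. A \<subseteq> {..<n} \<and> card A = v \<and> \<Union>F \<subseteq> A}"
  obtain K where K: "K \<in> KK n" "F \<subseteq> K" using False unfolding deg_def by (metis (mono_tags, lifting) card.empty Collect_empty_eq)
  have fU: "finite (\<Union>F)" using KK_props(4)[OF K(1)] K(2) by (meson Union_mono finite_lessThan finite_subset)
  have "{K \<in> KK n. F \<subseteq> K} \<subseteq> (\<Union>A\<in>?S. Pow (Pow A))"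
  proof
    fix K assume "K \<in> {K \<in> KK n. F \<subseteq> K}"
    then have "\<Union>K \<in> ?S" using KK_props[of K n] by auto
    moreover have "K \<in> Pow (Pow (\<Union>K))" by auto
    ultimately show "K \<in> (\<Union>A\<in>?S. Pow (Pow A))" by blast
  qed
  then have "deg n F \<le> card (\<Union>A\<in>?S. Pow (Pow A))"
    unfolding deg_def by (intro card_mono) (auto intro: finite_subset)
  also have "\<dots> \<le> (\<Sum>A\<in>?S. card (Pow (Pow A)))" by (rule card_UN_le) (auto intro: finite_subset[of _ "Pow {..<n}"])
  also have "\<dots> = (\<Sum>A\<in>?S. 2 ^ (2 ^ v))"
  proof (intro sum.cong refl)
    fix A assume "A \<in> ?S"
    then have "finite A" "card A = v" using finite_subset by auto
    then show "card (Pow (Pow A)) = 2 ^ (2 ^ v)" by (simp add: card_Pow)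
  qed
  also have "\<dots> = card ?S * 2 ^ (2 ^ v)" by simp
  also have "\<dots> \<le> n ^ (v - card (\<Union>F)) * 2 ^ (2 ^ v)"
    using card_supersets_le[of "{..<n}" "\<Union>F" v] fU by (intro mult_right_mono) auto
  finally have "real (deg n F) \<le> real (n ^ (v - card (\<Union>F)) * 2 ^ (2 ^ v))" by (simp only: of_nat_le_iff)
  then show ?thesis by (simp add: mult.commute)
qed simp

text \<open>The partial embedding is extended by sending \<open>VH - U\<close> onto an arbitrary set
  \<open>B\<close> of fresh vertices. Every such copy contains \<open>F\<close>, and the union of
  its edges recovers \<open>B\<close>, so different choices of \<open>B\<close> give different
  copies.\<close>

lemma deg_ge:
  assumes U: "U \<subseteq> VH" and f: "inj_on f U" "f ` U \<subseteq> {..<n}" and n: "n \<ge> 2 * v"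
    and F: "F = (\<lambda>e. f ` e) ` {e \<in> EH. e \<subseteq> U}"
  shows "(real n / (2 * real v)) ^ (v - card U) \<le> real (deg n F)"
proof -
  define w where "w = card U"
  have fU: "finite U" using U finite_VH finite_subset by auto
  have wv: "w \<le> v" unfolding w_def v_def using U finite_VH by (rule card_mono[rotated])
  have cfU: "card (f ` U) = w" using f by (simp add: card_image w_def)
  let ?R = "{..<n} - f ` U"
  let ?S = "{B. B \<subseteq> ?R \<and> card B = v - w}"
  have cR: "card ?R = n - w" using cfU f fU by (simp add: card_Diff_subset)
  have "\<exists>g. bij_betw g (VH - U) B" if "B \<in> ?S" for B
  proof (rule finite_same_card_bij)
    show "finite B" using that finite_subset by auto
    show "card (VH - U) = card B" using that U fU by (simp add: card_Diff_subset v_def w_def)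
  qed (use finite_VH in auto)
  then obtain g where g: "\<And>B. B \<in> ?S \<Longrightarrow> bij_betw (g B) (VH - U) B" by metis
  define h where "h B x = (if x \<in> U then f x else g B x)" for B x
  define K where "K B = (\<lambda>e. h B ` e) ` EH" for B
  have hU: "h B ` U = f ` U" for B by (auto simp: h_def)
  have hV: "h B ` VH = f ` U \<union> B" "inj_on (h B) VH" if B: "B \<in> ?S" for B
  proof -
    have "h B ` (VH - U) = B" using g[OF B] by (auto simp: h_def bij_betw_def)
    moreover have "VH = U \<union> (VH - U)" using U by auto
    ultimately show "h B ` VH = f ` U \<union> B" using hU by (metis image_Un)
    have "inj_on (h B) U" using f(1) by (auto simp: inj_on_def h_def)
    moreover have "inj_on (h B) (VH - U)" using g[OF B] by (auto simp: inj_on_def h_def bij_betw_def)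
    moreover have "h B ` U \<inter> h B ` (VH - U) = {}"
      using \<open>h B ` (VH - U) = B\<close> hU B by auto
    ultimately have "inj_on (h B) (U \<union> (VH - U))" by (subst inj_on_Un) blast
    then show "inj_on (h B) VH" using U by (simp add: Un_absorb1)
  qed
  have "card ?S \<le> deg n F"
    unfolding deg_def
  proof (rule card_inj_on_le)
    show "inj_on K ?S"
    proof (rule inj_onI)
      fix B B' assume B: "B \<in> ?S" "B' \<in> ?S" "K B = K B'"
      have "\<Union>(K B) = f ` U \<union> B" "\<Union>(K B') = f ` U \<union> B'"
        using hV[OF B(1)] hV[OF B(2)] Union_EH unfolding K_def by (metis image_Union)+
      then have "f ` U \<union> B = f ` U \<union> B'" using B(3) by simp
      moreover have "B \<inter> f ` U = {}" "B' \<inter> f ` U = {}" using B by auto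
      ultimately show "B = B'" by blast
    qed
    show "K ` ?S \<subseteq> {K \<in> KK n. F \<subseteq> K}"
    proof
      fix k assume "k \<in> K ` ?S"
      then obtain B where B: "B \<in> ?S" "k = K B" by auto
      have "h B ` VH \<subseteq> {..<n}" using hV[OF B(1)] B(1) f by auto
      then have "k \<in> KK n" unfolding KK_def B(2) K_def using hV(2)[OF B(1)] by blast
      moreover have "F \<subseteq> K B"
      proof
        fix e' assume "e' \<in> F"
        then obtain e where e: "e \<in> EH" "e \<subseteq> U" "e' = f ` e" unfolding F by blast
        have "h B ` e = f ` e" using e(2) by (intro image_cong) (auto simp: h_def)
        then show "e' \<in> K B" unfolding K_def using e by (intro image_eqI[where x = e]) auto
      qed
      ultimately show "k \<in> {K \<in> KK n. F \<subseteq> K}" using B by simp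
    qed
  qed simp
  moreover have "card ?S = (n - w) choose (v - w)"
    using cR by (simp add: n_subsets)
  moreover have "(real n / (2 * real v)) ^ (v - w) \<le> real ((n - w) choose (v - w))"
  proof -
    have v2: "v \<ge> 2" using card_ge_2 by (simp add: v_def)
    have "(real n / (2 * real v)) ^ (v - w) \<le> (real (n - w) / real (v - w)) ^ (v - w)"
    proof (cases "v = w")
      case False
      have "real n / (2 * real v) \<le> real (n - w) / real (v - w)"
      proof (rule order_trans)
        \<comment> \<open>Here \<open>n \<ge> 2 * v\<close> makes \<open>n - w\<close> at least half
          of n.\<close>
        show "real n / (2 * real v) \<le> real (n - w) / real v"
          using n wv v2 by (simp add: field_simps of_nat_diff)
        show "real (n - w) / real v \<le> real (n - w) / real (v - w)"
          using wv False v2 by (intro divide_left_mono) auto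
      qed
      then show ?thesis by (intro power_mono) auto
    qed simp
    also have "\<dots> \<le> real ((n - w) choose (v - w))"
      using n wv by (intro binomial_ge_n_over_k_pow_k) auto
    finally show ?thesis .
  qed
  ultimately show ?thesis unfolding w_def by linarith
qed

lemma coef_nonneg: "0 \<le> p \<Longrightarrow> 0 \<le> coef n p F" by (simp add: coef_def)

lemma coef_le:
  assumes "0 \<le> p" "p \<le> 1"
  shows "coef n p F \<le> 2 ^ (2 ^ v) * real n ^ (v - card (\<Union>F))"
proof -
  have "coef n p F \<le> real (deg n F) * 1"
    unfolding coef_def using assms by (intro mult_left_mono power_le_one) auto
  then show ?thesis using deg_le[of n F] by linarith
qed

lemma coef_nonzeroD:
  assumes "coef n p F \<noteq> 0"
  obtains K where "K \<in> KK n" "F \<subseteq> K"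
proof -
  have "{K \<in> KK n. F \<subseteq> K} \<noteq> {}" using assms by (metis card.empty coef_def deg_def mult_zero_left of_nat_0)
  then show ?thesis using that by auto
qed

lemma coef_nonzero_card: "coef n p F \<noteq> 0 \<Longrightarrow> card F \<le> d \<and> card (\<Union>F) \<le> v \<and> F \<subseteq> all_edges n \<and> \<Union>F \<subseteq> {..<n}"
proof -
  assume "coef n p F \<noteq> 0"
  then obtain K where K: "K \<in> KK n" "F \<subseteq> K" by (rule coef_nonzeroD)
  have "finite K" using finite_KK_member[OF K(1)] .
  moreover have "finite (\<Union>K)" using KK_props(4)[OF K(1)] finite_subset by auto
  ultimately have "card F \<le> d" "card (\<Union>F) \<le> v"
    using KK_props[OF K(1)] K(2) by (metis card_mono, metis Union_mono card_mono)
  then show ?thesis using KK_props[OF K(1)] K(2) by blast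
qed

text \<open>Double counting: each copy contributes once for each of its 2^d subsets of
  edges.\<close>

lemma sum_coef_le:
  assumes "0 \<le> p" "p \<le> 1"
  shows "(\<Sum>F\<in>Pow (all_edges n). \<bar>coef n p F\<bar>) \<le> 2 ^ d * 2 ^ (2 ^ v) * real n ^ v"
proof -
  have "(\<Sum>F\<in>Pow (all_edges n). \<bar>coef n p F\<bar>) \<le> (\<Sum>F\<in>Pow (all_edges n). \<Sum>K\<in>{K\<in>KK n. F \<subseteq> K}. 1)"
  proof (rule sum_mono)
    fix F
    have "coef n p F \<le> real (deg n F) * 1"
      unfolding coef_def using assms by (intro mult_left_mono power_le_one) auto
    then show "\<bar>coef n p F\<bar> \<le> (\<Sum>K\<in>{K\<in>KK n. F \<subseteq> K}. 1)"
      using coef_nonneg[OF assms(1), of n F] by (simp add: deg_def)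
  qed
  also have "\<dots> = (\<Sum>K\<in>KK n. \<Sum>F\<in>{F\<in>Pow (all_edges n). F \<subseteq> K}. 1)"
    by (rule sum.swap_restrict) auto
  also have "\<dots> = (\<Sum>K\<in>KK n. 2 ^ d)"
  proof (intro sum.cong refl)
    fix K assume K: "K \<in> KK n"
    have "{F\<in>Pow (all_edges n). F \<subseteq> K} = Pow K" using KK_props(1)[OF K] by auto
    moreover have "finite K" using finite_KK_member[OF K] .
    ultimately show "(\<Sum>F\<in>{F\<in>Pow (all_edges n). F \<subseteq> K}. 1) = (2 ^ d :: real)"
      using KK_props(2)[OF K] by (simp add: card_Pow)
  qed
  also have "\<dots> = 2 ^ d * real (deg n {})" by (simp add: deg_def)
  also have "\<dots> \<le> 2 ^ d * (2 ^ (2 ^ v) * real n ^ v)"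
    using deg_le[of n "{}"] by (intro mult_left_mono) auto
  finally show ?thesis by (simp add: mult.assoc)
qed

end

section \<open>Planted blow-ups of a connected subpattern\<close>

context connected_pattern
begin

definition induced :: "'a set \<Rightarrow> 'a set set" where "induced U = {e \<in> EH. e \<subseteq> U}"

lemma connected_grow:
  assumes "connected_graph U (induced U)" "a \<in> U" "{a, b} \<in> EH"
  shows "connected_graph (insert b U) (induced (insert b U))"
proof -
  let ?R = "\<lambda>x y. {x, y} \<in> induced (insert b U)"
  have mono: "?R\<^sup>*\<^sup>* x y" if "x \<in> U" "y \<in> U" for x y
  proof -
    have "(\<lambda>x y. {x, y} \<in> induced U)\<^sup>*\<^sup>* x y" using assms(1) that by (auto simp: connected_graph_def)
    then show ?thesis by (rule rtranclp_mono[THEN predicate2D, rotated]) (auto simp: induced_def)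
  qed
  have ab: "?R a b" "?R b a" using assms(2,3) by (auto simp: induced_def insert_commute)
  have to_a: "?R\<^sup>*\<^sup>* x a" if "x \<in> insert b U" for x
  proof (cases "x = b")
    case True
    then show ?thesis using ab by (simp add: r_into_rtranclp)
  next
    case False
    then show ?thesis using that mono[of x a] assms(2) by simp
  qed
  have from_a: "?R\<^sup>*\<^sup>* a x" if "x \<in> insert b U" for x
  proof (cases "x = b")
    case True
    then show ?thesis using ab by (simp add: r_into_rtranclp)
  next
    case False
    then show ?thesis using that mono[of a x] assms(2) by simp
  qed
  show ?thesis unfolding connected_graph_def
    by (intro ballI) (rule rtranclp_trans[OF to_a from_a])
qed

text \<open>Grown one vertex at a time along edges leaving the current set; it makes the maximum
  over connected subsets of a given size well defined.\<close>

lemma connected_subset_exists: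
  assumes "1 \<le> w" "w \<le> v"
  shows "\<exists>U\<subseteq>VH. card U = w \<and> connected_graph U (induced U)"
  using assms
proof (induction w rule: nat_induct_at_least)
  case base
  obtain x where "x \<in> VH" using card_ge_2 by fastforce
  then show ?case by (intro exI[of _ "{x}"]) (auto simp: connected_graph_def)
next
  case (Suc w)
  then obtain U where U: "U \<subseteq> VH" "card U = w" "connected_graph U (induced U)" by auto
  have "U \<noteq> {}" using U(2) Suc by auto
  moreover have "U \<noteq> VH" using U(2) Suc by (auto simp: v_def)
  ultimately obtain a b where ab: "a \<in> U" "b \<notin> U" "{a, b} \<in> EH"
    using crossing_edge[OF conn U(1)] by auto
  have "finite U" using U(1) finite_VH finite_subset by auto
  then show ?case using ab U connected_grow[OF U(3) ab(1,3)] edge[OF ab(3)]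
    by (intro exI[of _ "insert b U"]) auto
qed

lemma densest_subset_exists:
  assumes "1 \<le> w" "w \<le> v"
  obtains U where "U \<subseteq> VH" "card U = w" "connected_graph U (induced U)"
    "\<And>U'. U' \<subseteq> VH \<Longrightarrow> card U' = w \<Longrightarrow> connected_graph U' (induced U') \<Longrightarrow> card (induced U') \<le> card (induced U)"
proof -
  let ?S = "{U. U \<subseteq> VH \<and> card U = w \<and> connected_graph U (induced U)}"
  have "finite ?S" using finite_VH by (intro finite_subset[of ?S "Pow VH"]) auto
  moreover have "?S \<noteq> {}" using connected_subset_exists[OF assms] by auto
  ultimately have "Max ((\<lambda>U. card (induced U)) ` ?S) \<in> (\<lambda>U. card (induced U)) ` ?S" by (intro Max_in) auto
  then obtain U where U: "U \<in> ?S" "Max ((\<lambda>U. card (induced U)) ` ?S) = card (induced U)" by auto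
  have "card (induced U') \<le> card (induced U)" if "U' \<in> ?S" for U'
    unfolding U(2)[symmetric] using \<open>finite ?S\<close> that by (intro Max_ge) auto
  then show ?thesis using that U(1) by auto
qed

end

text \<open>\<open>D\<close> is the planted vertex set; \<open>gr\<close> gives the group of a
  planted vertex and \<open>pr\<close> the pattern vertex whose part it belongs to. Maximality is
  required among connected subsets of the same size only, since the competitors that arise are
  connected.\<close>

locale blow_up = connected_pattern VH EH for VH :: "'a set" and EH +
  fixes n M m :: nat and U :: "'a set" and D :: "nat set" and gr :: "nat \<Rightarrow> nat" and pr :: "nat \<Rightarrow> 'a"
  assumes U: "U \<subseteq> VH" "card U \<ge> 2" "connected_graph U (induced U)"
    and densest: "\<And>U'. U' \<subseteq> VH \<Longrightarrow> card U' = card U \<Longrightarrow> connected_graph U' (induced U') \<Longrightarrow> card (induced U') \<le> card (induced U)"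
    and D: "D \<subseteq> {..<n}" "\<And>x. x \<in> D \<Longrightarrow> gr x < M \<and> pr x \<in> U"
    and fibre: "\<And>i h. i < M \<Longrightarrow> h \<in> U \<Longrightarrow> card {x\<in>D. gr x = i \<and> pr x = h} = m"
begin

definition "w = card U"
definition "EJ = induced U"
text \<open>Edges between different groups belong to no class. A class edge therefore leads from one
  part to another inside its group, which ties a small survivor to one group.\<close>

definition "block g = {e. e \<subseteq> D \<and> card e = 2 \<and> pr ` e = g \<and> (\<exists>i. gr ` e = {i})}"
definition "grp i = {e. e \<subseteq> D \<and> card e = 2 \<and> gr ` e = {i::nat}}"
text \<open>A section picks one vertex from every part of group \<open>i\<close>; mapping the
  pattern edges along it gives a canonical copy of the pattern.\<close>

definition "sections i = {u \<in> PiE U (\<lambda>h. {x\<in>D. gr x = i \<and> pr x = h}). True}"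
definition "main i = (\<lambda>u. (\<lambda>e. u ` e) ` EJ) ` sections i"
definition "meets F \<longleftrightarrow> (\<forall>g\<in>EJ. F \<inter> block g \<noteq> {})"
text \<open>Survival is expressed by the number of copies instead of the coefficient, which keeps
  the set independent of p.\<close>

definition "bad = {F. F \<subseteq> all_edges n \<and> deg n F \<noteq> 0 \<and> meets F} - (\<Union>i<M. main i)"

lemma finite_D: "finite D" using D(1) finite_subset by auto
lemma finite_U: "finite U" using U(1) finite_VH finite_subset by auto
lemma w_ge_2: "2 \<le> w" using U(2) by (simp add: w_def)
lemma w_le_v: "w \<le> v" using U(1) finite_VH by (simp add: w_def v_def card_mono)
lemma EJ_edge: "g \<in> EJ \<Longrightarrow> g \<in> EH \<and> card g = 2 \<and> g \<subseteq> U" using edge by (auto simp: EJ_def induced_def)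
lemma finite_EJ: "finite EJ" using finite_EH by (simp add: EJ_def induced_def)
lemma Union_EJ: "\<Union>EJ = U"
  unfolding EJ_def by (rule Union_edges) (use U in \<open>auto simp: induced_def\<close>)
lemma EJ_nonempty: "EJ \<noteq> {}" using Union_EJ U(2) by auto
lemma card_EJ_le: "card EJ \<le> d" unfolding EJ_def induced_def d_def using finite_EH by (intro card_mono) auto

lemma disjoint_block: "disjoint_family_on block EJ"
  by (auto simp: disjoint_family_on_def block_def)
lemma disjoint_grp: "disjoint_family_on grp A"
  by (auto simp: disjoint_family_on_def grp_def)
lemma block_subset: "block g \<subseteq> all_edges n"
  using D(1) by (auto simp: block_def all_edges_def)
lemma grp_subset: "grp i \<subseteq> all_edges n"
  using D(1) by (auto simp: grp_def all_edges_def)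

lemma section_props:
  assumes "u \<in> sections i"
  shows "h \<in> U \<Longrightarrow> u h \<in> D \<and> gr (u h) = i \<and> pr (u h) = h" "inj_on u U"
proof -
  show *: "u h \<in> D \<and> gr (u h) = i \<and> pr (u h) = h" if "h \<in> U" for h
    using assms that by (auto simp: sections_def)
  show "inj_on u U" by (rule inj_onI) (metis *)
qed

lemma section_edge:
  assumes u: "u \<in> sections i" and g: "g \<in> EJ"
  shows "u ` g \<in> block g" "u ` g \<in> grp i"
proof -
  have gU: "g \<subseteq> U" "card g = 2" using EJ_edge[OF g] by auto
  then have gne: "g \<noteq> {}" by auto
  have "card (u ` g) = 2" using section_props(2)[OF u] gU by (metis card_image inj_on_subset)
  moreover have "pr ` (u ` g) = g" unfolding image_image
    using section_props(1)[OF u] gU(1) by (metis (no_types, lifting) image_cong image_ident subsetD)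
  moreover have "gr ` (u ` g) = {i}" unfolding image_image
    using section_props(1)[OF u] gU(1) gne by (auto simp: subset_iff image_iff)
  moreover have "u ` g \<subseteq> D" using section_props(1)[OF u] gU by auto
  ultimately show "u ` g \<in> block g" "u ` g \<in> grp i" by (auto simp: block_def grp_def)
qed

lemma main_props:
  assumes "F \<in> main i"
  shows "F \<subseteq> grp i" "F \<subseteq> all_edges n" "\<exists>e. F = e ` EJ \<and> (\<forall>g\<in>EJ. e g \<in> block g)" "card F = card EJ"
proof -
  obtain u where u: "u \<in> sections i" "F = (\<lambda>e. u ` e) ` EJ" using assms by (auto simp: main_def)
  show 1: "F \<subseteq> grp i" using section_edge[OF u(1)] u(2) by auto
  then show "F \<subseteq> all_edges n" using grp_subset by auto
  show "\<exists>e. F = e ` EJ \<and> (\<forall>g\<in>EJ. e g \<in> block g)" using section_edge[OF u(1)] u(2) by blast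
  have "inj_on (\<lambda>e. u ` e) EJ"
    using section_props(2)[OF u(1)] EJ_edge by (intro inj_onI) (metis inj_on_image_eq_iff)
  then show "card F = card EJ" using u(2) by (simp add: card_image)
qed

lemma card_main:
  assumes "i < M" shows "card (main i) = m ^ w"
proof -
  have "inj_on (\<lambda>u. (\<lambda>e. u ` e) ` EJ) (sections i)"
  proof (rule inj_onI)
    fix u u' assume u: "u \<in> sections i" and u': "u' \<in> sections i" and eq: "(\<lambda>e. u ` e) ` EJ = (\<lambda>e. u' ` e) ` EJ"
    have "\<Union>((\<lambda>e. u ` e) ` EJ) = u ` U" "\<Union>((\<lambda>e. u' ` e) ` EJ) = u' ` U" using Union_EJ by (metis image_Union)+
    then have im: "u ` U = u' ` U" using eq by simp
    show "u = u'"
    proof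
      fix h show "u h = u' h"
      proof (cases "h \<in> U")
        case True
        then obtain h' where h': "h' \<in> U" "u h = u' h'" using im by blast
        then have "h = h'" using section_props(1)[OF u True] section_props(1)[OF u' h'(1)] by metis
        then show ?thesis using h' by simp
      next
        case False
        then show ?thesis using u u' by (auto simp: sections_def PiE_def extensional_def)
      qed
    qed
  qed
  then have "card (main i) = card (sections i)" unfolding main_def by (rule card_image)
  also have "\<dots> = (\<Prod>h\<in>U. card {x\<in>D. gr x = i \<and> pr x = h})"
    unfolding sections_def by (simp add: card_PiE finite_U)
  also have "\<dots> = (\<Prod>h\<in>U. m)" using fibre assms by (intro prod.cong) auto
  finally show ?thesis by (simp add: w_def)
qed

lemma deg_main_ge:
  assumes "i < M" "F \<in> main i" "n \<ge> 2 * v"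
  shows "(real n / (2 * real v)) ^ (v - w) \<le> real (deg n F)"
proof -
  obtain u where u: "u \<in> sections i" "F = (\<lambda>e. u ` e) ` EJ" using assms by (auto simp: main_def)
  show ?thesis unfolding w_def
  proof (rule deg_ge[OF U(1) section_props(2)[OF u(1)] _ assms(3)])
    show "u ` U \<subseteq> {..<n}" using section_props(1)[OF u(1)] D(1) by auto
    show "F = (\<lambda>e. u ` e) ` {e \<in> EH. e \<subseteq> U}" unfolding u(2) EJ_def induced_def ..
  qed
qed

lemma card_Union_main:
  assumes "F \<in> main i" shows "card (\<Union>F) = w"
proof -
  obtain u where u: "u \<in> sections i" "F = (\<lambda>e. u ` e) ` EJ" using assms by (auto simp: main_def)
  then have "\<Union>F = u ` U" using Union_EJ by (metis image_Union)
  then show ?thesis using section_props(2)[OF u(1)] by (simp add: card_image w_def)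
qed

text \<open>Vertex sets meeting all blocks are enumerated along a growing connected set of parts: reaching a
  new part costs a factor \<open>m\<close> from a vertex already present in the same group, or \<open>n * m\<close>
  if one extra vertex is used.\<close>

lemma skeletons:
  assumes "1 \<le> j" "j \<le> w"
  shows "\<exists>P \<A>. P \<subseteq> U \<and> card P = j \<and>
    (\<forall>k. finite (\<A> k) \<and> real (card (\<A> k)) \<le> real ((2 * w + 1) ^ j * M * m ^ j * n ^ k)) \<and>
    (\<forall>k. \<forall>Y\<in>\<A> k. finite Y \<and> card Y \<le> 2 * j \<and> Y \<subseteq> D) \<and>
    (\<forall>Y\<in>\<A> 0. \<exists>i. gr ` Y = {i}) \<and>
    (\<forall>F. meets F \<longrightarrow> (\<exists>k\<le>j. \<exists>Y\<in>\<A> k. Y \<subseteq> \<Union>F \<and> card Y = j + k \<and> pr ` Y = P))"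
  using assms
proof (induction j rule: nat_induct_at_least)
  case base
  obtain h where h: "h \<in> U" using U(2) by fastforce
  define \<A> where "\<A> k = (if k = 0 then (\<lambda>x. {x}) ` {x\<in>D. pr x = h} else {})" for k :: nat
  have "{x\<in>D. pr x = h} = (\<Union>i<M. {x\<in>D. gr x = i \<and> pr x = h})" using D(2) by auto
  then have "card {x\<in>D. pr x = h} \<le> (\<Sum>i<M. card {x\<in>D. gr x = i \<and> pr x = h})"
    using card_UN_le[of "{..<M}" "\<lambda>i. {x\<in>D. gr x = i \<and> pr x = h}"] by simp
  also have "\<dots> = M * m" using fibre h by simp
  finally have c: "card {x\<in>D. pr x = h} \<le> M * m" .
  have "card (\<A> 0) \<le> card {x\<in>D. pr x = h}" unfolding \<A>_def using finite_D by (auto intro: card_image_le)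
  with c have cA: "card (\<A> 0) \<le> M * m" by simp
  have "card (\<A> k) \<le> (2 * w + 1) ^ 1 * M * m ^ 1 * n ^ k" for k
  proof (cases "k = 0")
    case True
    have "1 * (M * m) \<le> (2 * w + 1) * (M * m)" by (intro mult_right_mono) auto
    then have "card (\<A> 0) \<le> (2 * w + 1) * (M * m)" using cA by linarith
    then show ?thesis using True by (simp only: power_one_right power_0 mult_1_right mult.assoc)
  qed (simp add: \<A>_def)
  then have 1: "finite (\<A> k) \<and> real (card (\<A> k)) \<le> real ((2 * w + 1) ^ 1 * M * m ^ 1 * n ^ k)" for k
    using finite_D by (simp only: of_nat_le_iff) (simp add: \<A>_def)
  have 2: "\<exists>k\<le>1. \<exists>Y\<in>\<A> k. Y \<subseteq> \<Union>F \<and> card Y = 1 + k \<and> pr ` Y = {h}" if mF: "meets F" for F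
  proof -
    obtain g where g: "g \<in> EJ" "h \<in> g" using h Union_EJ by auto
    then obtain e where e: "e \<in> F" "e \<in> block g" using mF unfolding meets_def by blast
    then obtain x where "x \<in> e" "pr x = h" using g(2) by (auto simp: block_def)
    then show ?thesis using e by (intro exI[of _ 0]) (auto simp: \<A>_def block_def)
  qed
  have 3: "{h} \<subseteq> U" "card {h} = 1" using h by auto
  have 4: "\<forall>k. \<forall>Y\<in>\<A> k. finite Y \<and> card Y \<le> 2 * 1 \<and> Y \<subseteq> D" "\<forall>Y\<in>\<A> 0. \<exists>i. gr ` Y = {i}"
    by (auto simp: \<A>_def)
  show ?case
    by (rule exI[of _ "{h}"], rule exI[of _ \<A>], intro conjI 3 4 allI 1 impI 2)
next
  case (Suc j)
  have "j \<le> w" using Suc.prems by simp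
  note sk = Suc.IH[OF this]
  from sk obtain P \<A> where P: "P \<subseteq> U" "card P = j"
    and A0: "\<forall>k. finite (\<A> k) \<and> real (card (\<A> k)) \<le> real ((2 * w + 1) ^ j * M * m ^ j * n ^ k)"
    "\<forall>k. \<forall>Y\<in>\<A> k. finite Y \<and> card Y \<le> 2 * j \<and> Y \<subseteq> D"
    "\<forall>Y\<in>\<A> 0. \<exists>i. gr ` Y = {i}"
    "\<forall>F. meets F \<longrightarrow> (\<exists>k\<le>j. \<exists>Y\<in>\<A> k. Y \<subseteq> \<Union>F \<and> card Y = j + k \<and> pr ` Y = P)"
    by (elim exE conjE) (rule that; assumption)
  have A: "\<And>k. finite (\<A> k)" "\<And>k. real (card (\<A> k)) \<le> real ((2 * w + 1) ^ j * M * m ^ j * n ^ k)"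
    "\<And>k Y. Y \<in> \<A> k \<Longrightarrow> finite Y \<and> card Y \<le> 2 * j \<and> Y \<subseteq> D"
    "\<And>Y. Y \<in> \<A> 0 \<Longrightarrow> \<exists>i. gr ` Y = {i}"
    "\<And>F. meets F \<Longrightarrow> \<exists>k\<le>j. \<exists>Y\<in>\<A> k. Y \<subseteq> \<Union>F \<and> card Y = j + k \<and> pr ` Y = P"
    using A0 by simp_all
  have "P \<noteq> {}" using P(2) Suc by auto
  moreover have "P \<noteq> U" using P(2) Suc by (auto simp: w_def)
  ultimately obtain a b where ab: "a \<in> P" "b \<notin> P" "{a, b} \<in> induced U"
    using crossing_edge[OF U(3) P(1)] by auto
  have g: "{a, b} \<in> EJ" "b \<in> U" using ab by (auto simp: EJ_def induced_def)
  define fib where "fib y = {x\<in>D. gr x = gr y \<and> pr x = b}" for y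
  have fib: "finite (fib y)" "y \<in> D \<Longrightarrow> card (fib y) = m" for y
    using finite_D fibre[of "gr y" b] D(2)[of y] g(2) by (auto simp: fib_def)
  \<comment> \<open>\<open>A1\<close> uses a class edge whose end over \<open>a\<close> already lies
    in \<open>Y\<close>; \<open>A2\<close> uses one whose end over \<open>a\<close> is new and is
    added as well. The set of parts grows by one in both cases, the number of vertices by one or
    two. For k = 0 only \<open>A1\<close> has been used, so the group never changes.\<close>
  define A1 where "A1 k = (\<lambda>(Y, x). insert x Y) ` (SIGMA Y:\<A> k. \<Union>y\<in>Y. fib y)" for k
  define A2 where "A2 k = (\<lambda>(Y, y, x). insert x (insert y Y)) ` (SIGMA Y:\<A> k. SIGMA y:D. fib y)" for k
  define \<A>' where "\<A>' k = A1 k \<union> (if k = 0 then {} else A2 (k - 1))" for k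
  have fin12: "finite (A1 k)" "finite (A2 k)" for k
  proof -
    have "finite (\<Union>y\<in>Y. fib y)" if "Y \<in> \<A> k" for Y using A(3)[OF that] fib(1) by blast
    then show "finite (A1 k)" unfolding A1_def using A(1) by (intro finite_imageI finite_SigmaI)
    show "finite (A2 k)" unfolding A2_def using A(1) fib(1) finite_D by (intro finite_imageI finite_SigmaI)
  qed
  have cA1: "card (A1 k) \<le> card (\<A> k) * (2 * j * m)" for k
  proof -
    have "card (A1 k) \<le> card (SIGMA Y:\<A> k. \<Union>y\<in>Y. fib y)"
      unfolding A1_def using A(1,3) fib(1) by (intro card_image_le finite_SigmaI finite_UN_I) simp_all
    also have "\<dots> = (\<Sum>Y\<in>\<A> k. card (\<Union>y\<in>Y. fib y))" using A(1,3) fib(1) by (intro card_SigmaI ballI finite_UN_I) simp_all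
    also have "\<dots> \<le> (\<Sum>Y\<in>\<A> k. 2 * j * m)"
    proof (rule sum_mono)
      fix Y assume Y: "Y \<in> \<A> k"
      have "card (\<Union>y\<in>Y. fib y) \<le> (\<Sum>y\<in>Y. card (fib y))" using A(3)[OF Y] by (intro card_UN_le) auto
      also have "\<dots> = (\<Sum>y\<in>Y. m)" using A(3)[OF Y] fib(2) by (intro sum.cong) auto
      also have "\<dots> \<le> 2 * j * m" using A(3)[OF Y] by simp
      finally show "card (\<Union>y\<in>Y. fib y) \<le> 2 * j * m" .
    qed
    finally show ?thesis by simp
  qed
  have cA2: "card (A2 k) \<le> card (\<A> k) * (n * m)" for k
  proof -
    have "card (A2 k) \<le> card (SIGMA Y:\<A> k. SIGMA y:D. fib y)"
      unfolding A2_def using A(1) fib(1) finite_D by (intro card_image_le finite_SigmaI) simp_all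
    also have "\<dots> = (\<Sum>Y\<in>\<A> k. card (SIGMA y:D. fib y))" using A(1) fib(1) finite_D by (intro card_SigmaI ballI finite_SigmaI) simp_all
    also have "card (SIGMA y:D. fib y) = (\<Sum>y\<in>D. card (fib y))" using fib(1) finite_D by (intro card_SigmaI) auto
    also have "\<dots> = card D * m" using fib(2) by simp
    also have "(\<Sum>Y\<in>\<A> k. card D * m) \<le> card (\<A> k) * (n * m)"
      using card_mono[OF _ D(1)] by simp
    finally show ?thesis .
  qed
  have jw: "j < w" using Suc by simp
  \<comment> \<open>In 2 w + 1 the summand 2 w bounds the number of vertices of \<open>Y\<close> to
    start from, and 1 accounts for \<open>A2\<close>, where the choice of the starting vertex costs
    the factor n.\<close>
  have count: "real (card (\<A>' k)) \<le> real ((2 * w + 1) ^ Suc j * M * m ^ Suc j * n ^ k)" for k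
  proof -
    define X where "X = real ((2 * w + 1) ^ j * M * m ^ j * n ^ k)"
    have X0: "0 \<le> X * real m" by (simp add: X_def)
    have "real (card (A1 k)) \<le> real (card (\<A> k)) * real (2 * j * m)" using cA1[of k] by (metis of_nat_le_iff of_nat_mult)
    also have "\<dots> \<le> X * real (2 * j * m)" unfolding X_def by (intro mult_right_mono A(2)) auto
    also have "\<dots> = (X * real m) * real (2 * j)" by simp
    also have "\<dots> \<le> (X * real m) * real (2 * w)" using jw X0 by (intro mult_left_mono) auto
    finally have 1: "real (card (A1 k)) \<le> (X * real m) * real (2 * w)" .
    have 2: "real (card (if k = 0 then {} else A2 (k - 1))) \<le> X * real m"
    proof (cases k)
      case 0
      then show ?thesis using X0 by simp
    next
      case (Suc k')
      have "real (card (A2 k')) \<le> real (card (\<A> k')) * real (n * m)" using cA2[of k'] by (metis of_nat_le_iff of_nat_mult)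
      also have "\<dots> \<le> real ((2 * w + 1) ^ j * M * m ^ j * n ^ k') * real (n * m)" by (intro mult_right_mono A(2)) auto
      also have "\<dots> = X * real m" by (simp add: X_def Suc)
      finally show ?thesis using Suc by simp
    qed
    have "real (card (\<A>' k)) \<le> real (card (A1 k)) + real (card (if k = 0 then {} else A2 (k - 1)))"
      unfolding \<A>'_def using card_Un_le by (metis of_nat_add of_nat_le_iff)
    also have "\<dots> \<le> (X * real m) * real (2 * w + 1)" using 1 2 by (simp add: algebra_simps)
    also have "\<dots> = real ((2 * w + 1) ^ Suc j * M * m ^ Suc j * n ^ k)" by (simp add: X_def algebra_simps)
    finally show ?thesis .
  qed
  have props: "finite Y' \<and> card Y' \<le> 2 * Suc j \<and> Y' \<subseteq> D" if "Y' \<in> \<A>' k" for Y' k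
  proof -
    have "Y' \<in> A1 k \<or> Y' \<in> A2 (k - 1)" using that by (auto simp: \<A>'_def split: if_splits)
    moreover have "\<exists>k Y x. Y \<in> \<A> k \<and> x \<in> D \<and> Y' = insert x Y" if "Y' \<in> A1 k" for k
      using that unfolding A1_def fib_def by blast
    moreover have "\<exists>k Y x y. Y \<in> \<A> k \<and> x \<in> D \<and> y \<in> D \<and> Y' = insert x (insert y Y)" if "Y' \<in> A2 k" for k
      using that unfolding A2_def fib_def by blast
    ultimately have "(\<exists>k Y x. Y \<in> \<A> k \<and> x \<in> D \<and> Y' = insert x Y) \<or> (\<exists>k Y x y. Y \<in> \<A> k \<and> x \<in> D \<and> y \<in> D \<and> Y' = insert x (insert y Y))"
      by blast
    then show ?thesis
    proof (elim disjE exE conjE)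
      fix k Y x assume Y: "Y \<in> \<A> k" "x \<in> D" "Y' = insert x Y"
      have "card (insert x Y) \<le> Suc (card Y)" using A(3)[OF Y(1)] by (simp add: card_insert_if)
      then show ?thesis using A(3)[OF Y(1)] Y by auto
    next
      fix k Y x y assume Y: "Y \<in> \<A> k" "x \<in> D" "y \<in> D" "Y' = insert x (insert y Y)"
      have "card (insert x (insert y Y)) \<le> Suc (Suc (card Y))" using A(3)[OF Y(1)] by (simp add: card_insert_if)
      then show ?thesis using A(3)[OF Y(1)] Y by auto
    qed
  qed
  have zero: "\<exists>i. gr ` Y' = {i}" if Y'0: "Y' \<in> \<A>' 0" for Y'
  proof -
    obtain Y y x where Y: "Y \<in> \<A> 0" "y \<in> Y" "x \<in> fib y" "Y' = insert x Y"
      using Y'0 by (auto simp: \<A>'_def A1_def)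
    obtain i where "gr ` Y = {i}" using A(4)[OF Y(1)] by auto
    moreover from this have "gr x = i" using Y by (auto simp: fib_def)
    ultimately show ?thesis using Y by auto
  qed
  have main: "\<exists>k\<le>Suc j. \<exists>Y\<in>\<A>' k. Y \<subseteq> \<Union>F \<and> card Y = Suc j + k \<and> pr ` Y = insert b P" if F: "meets F" for F
  proof -
    obtain k Y where Y: "k \<le> j" "Y \<in> \<A> k" "Y \<subseteq> \<Union>F" "card Y = j + k" "pr ` Y = P" using A(5)[OF F] by blast
    obtain e where e: "e \<in> F" "e \<in> block {a, b}" using F g(1) unfolding meets_def by blast
    obtain i where i: "e \<subseteq> D" "pr ` e = {a, b}" "gr ` e = {i}" using e(2) by (auto simp: block_def)
    have "a \<in> pr ` e" "b \<in> pr ` e" using i(2) by auto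
    then obtain y x where yx: "y \<in> e" "pr y = a" "x \<in> e" "pr x = b" by auto
    have "gr y \<in> gr ` e" "gr x \<in> gr ` e" using yx by auto
    then have xf: "x \<in> fib y" using i yx by (auto simp: fib_def)
    have xY: "x \<notin> Y" "x \<noteq> y" using Y(5) ab yx by auto
    have fY: "finite Y" using A(3)[OF Y(2)] by auto
    show ?thesis
    proof (cases "y \<in> Y")
      case True
      have "insert x Y \<in> A1 k" unfolding A1_def
        using Y(2) True xf by (intro image_eqI[where x = "(Y, x)"]) auto
      then have "insert x Y \<in> \<A>' k" by (simp add: \<A>'_def)
      moreover have "insert x Y \<subseteq> \<Union>F" using Y(3) yx e(1) by auto
      ultimately show ?thesis using Y xY fY yx(4) by (intro exI[of _ k] conjI bexI[of _ "insert x Y"]) auto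
    next
      case False
      have "insert x (insert y Y) \<in> A2 k" unfolding A2_def
        using Y(2) xf yx i(1) by (intro image_eqI[where x = "(Y, y, x)"]) auto
      then have "insert x (insert y Y) \<in> \<A>' (Suc k)" by (simp add: \<A>'_def)
      moreover have "insert x (insert y Y) \<subseteq> \<Union>F" using Y(3) yx e(1) by auto
      moreover have "pr ` insert x (insert y Y) = insert b P" using Y(5) yx ab(1) by auto
      ultimately show ?thesis using Y xY fY yx False by (intro exI[of _ "Suc k"] conjI bexI[of _ "insert x (insert y Y)"]) auto
    qed
  qed
  have "finite P" using P(1) finite_U by (rule finite_subset)
  then have card: "insert b P \<subseteq> U" "card (insert b P) = Suc j" using P ab(2) g(2) by auto
  have fin: "finite (\<A>' k)" for k using fin12 by (simp add: \<A>'_def)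
  show ?case
    by (rule exI[of _ "insert b P"], rule exI[of _ \<A>'], intro conjI card allI ballI fin count props[THEN conjunct1]
      props[THEN conjunct2, THEN conjunct1] props[THEN conjunct2, THEN conjunct2] zero impI main)
qed

text \<open>Here \<open>pr\<close> is a bijection from \<open>Y\<close> onto \<open>U\<close>, so
  \<open>F\<close> contains a canonical copy. On the other hand \<open>F\<close> lies in a copy of
  the whole graph; pulling \<open>Y\<close> back along that copy gives a connected subset of the
  same size which spans at least \<open>card F\<close> edges. By \<open>densest\<close> there is no
  room for edges beyond the canonical copy.\<close>

lemma meets_minimal:
  assumes F: "meets F" "deg n F \<noteq> 0" and Y: "Y = \<Union>F" "card Y = w" "pr ` Y = U" "gr ` Y = {i}" "Y \<subseteq> D"
  shows "F \<in> main i \<and> i < M"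
proof -
  have finY: "finite Y" using Y(2) w_ge_2 by (metis card.infinite not_numeral_le_zero)
  have inj: "inj_on pr Y" using Y(2,3) finY by (metis eq_card_imp_inj_on w_def)
  define u where "u = (\<lambda>h\<in>U. inv_into Y pr h)"
  have u: "u h \<in> Y" "pr (u h) = h" if "h \<in> U" for h
    using that Y(3) by (auto simp: u_def inv_into_into f_inv_into_f)
  have "gr (u h) = i" if "h \<in> U" for h using u(1)[OF that] Y(4) by auto
  then have us: "u \<in> sections i" using u Y(5) by (auto simp: sections_def u_def)
  have upr: "u (pr x) = x" if "x \<in> Y" for x
    using that inj Y(3) by (auto simp: u_def inv_into_f_f)
  let ?T = "(\<lambda>e. u ` e) ` EJ"
  have TF: "?T \<subseteq> F"
  proof
    fix t assume "t \<in> ?T"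
    then obtain g where g: "g \<in> EJ" "t = u ` g" by auto
    obtain e where e: "e \<in> F" "e \<in> block g" using F(1) g(1) by (auto simp: meets_def)
    have "u ` g = u ` (pr ` e)" using e(2) by (simp add: block_def)
    also have "\<dots> = (\<lambda>x. x) ` e" unfolding image_image using upr e(1) Y(1) by (intro image_cong) auto
    also have "\<dots> = e" by simp
    finally show "t \<in> F" using g e by simp
  qed
  obtain K where K: "K \<in> KK n" "F \<subseteq> K"
    using F(2) unfolding deg_def by (metis (mono_tags, lifting) card.empty Collect_empty_eq)
  then obtain f where f: "inj_on f VH" "K = (\<lambda>e. f ` e) ` EH" by (auto simp: KK_def)
  define U1 where "U1 = {h\<in>VH. f h \<in> Y}"
  have "Y \<subseteq> \<Union>K" using Y(1) K(2) by auto
  also have "\<Union>K = f ` VH" using f(2) Union_EH by auto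
  finally have fU1: "f ` U1 = Y" by (auto simp: U1_def)
  have injU1: "inj_on f U1" using f(1) by (auto simp: U1_def inj_on_def)
  have cU1: "card U1 = card U" using fU1 injU1 Y(2) by (metis card_image w_def)
  have FU1: "F \<subseteq> (\<lambda>e. f ` e) ` induced U1"
  proof
    fix e assume e: "e \<in> F"
    then obtain e0 where e0: "e0 \<in> EH" "e = f ` e0" using K(2) f(2) by auto
    have "e0 \<subseteq> U1" using e e0 edge[OF e0(1)] Y(1) by (auto simp: U1_def)
    then show "e \<in> (\<lambda>e. f ` e) ` induced U1" using e0 by (auto simp: induced_def)
  qed
  \<comment> \<open>The map \<psi> carries \<open>U\<close> onto \<open>U1\<close> and edges to
    edges, and thus transports connectedness.\<close>
  define \<psi> where "\<psi> h = inv_into U1 f (u h)" for h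
  have \<psi>: "\<psi> h \<in> U1" "f (\<psi> h) = u h" if "h \<in> U" for h
    using u(1)[OF that] fU1 by (auto simp: \<psi>_def inv_into_into f_inv_into_f)
  have \<psi>U: "\<psi> ` U = U1"
  proof
    show "U1 \<subseteq> \<psi> ` U"
    proof
      fix x assume x: "x \<in> U1"
      then have fx: "f x \<in> Y" using fU1 by auto
      then have h: "pr (f x) \<in> U" using Y(3) by auto
      have "f (\<psi> (pr (f x))) = f x" using \<psi>(2)[OF h] upr[OF fx] by simp
      then have "\<psi> (pr (f x)) = x" using injU1 \<psi>(1)[OF h] x by (meson inj_onD)
      then show "x \<in> \<psi> ` U" using h by force
    qed
  qed (use \<psi> in auto)
  have step: "{\<psi> x, \<psi> y} \<in> induced U1" if "{x, y} \<in> induced U" for x y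
  proof -
    have xy: "x \<in> U" "y \<in> U" "{x, y} \<in> EJ" using that by (auto simp: induced_def EJ_def)
    have "u ` {x, y} \<in> F" using TF xy(3) by blast
    then obtain e0 where e0: "e0 \<in> induced U1" "u ` {x, y} = f ` e0" using FU1 by blast
    have "f ` {\<psi> x, \<psi> y} = f ` e0" using e0(2) \<psi>(2) xy by simp
    moreover have "{\<psi> x, \<psi> y} \<subseteq> U1" "e0 \<subseteq> U1" using \<psi>(1) xy e0 by (auto simp: induced_def)
    ultimately have "{\<psi> x, \<psi> y} = e0" using injU1 by (metis inj_on_image_eq_iff)
    then show ?thesis using e0 by simp
  qed
  have "connected_graph U1 (induced U1)"
    unfolding connected_graph_def
  proof (intro ballI)
    fix x' y' assume "x' \<in> U1" "y' \<in> U1"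
    then obtain x y where xy: "x \<in> U" "y \<in> U" "x' = \<psi> x" "y' = \<psi> y" using \<psi>U by blast
    have "(\<lambda>x y. {x, y} \<in> induced U)\<^sup>*\<^sup>* x y" using U(3) xy by (auto simp: connected_graph_def)
    then show "(\<lambda>x y. {x, y} \<in> induced U1)\<^sup>*\<^sup>* x' y'"
      unfolding xy(3,4)
    proof (induction rule: rtranclp_induct)
      case (step y z)
      then show ?case using \<open>\<And>x y. {x, y} \<in> induced U \<Longrightarrow> {\<psi> x, \<psi> y} \<in> induced U1\<close> by (meson rtranclp.rtrancl_into_rtrancl)
    qed simp
  qed
  then have "card (induced U1) \<le> card EJ"
    unfolding EJ_def by (intro densest) (auto simp: U1_def cU1[unfolded U1_def])
  moreover have finI: "finite (induced U1)" using finite_EH by (simp add: induced_def)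
  then have "card F \<le> card (induced U1)" using FU1 by (meson card_image_le card_mono finite_imageI order_trans)
  moreover have TM: "?T \<in> main i" using us by (auto simp: main_def)
  then have "card ?T = card EJ" by (rule main_props)
  moreover have "finite F" using FU1 finI finite_subset by blast
  ultimately have "F = ?T" using TF by (metis card_seteq order_trans)
  moreover have "i < M"
  proof -
    obtain x where "x \<in> Y" using Y(4) by auto
    moreover from this have "gr x = i" using Y(4) by blast
    ultimately show ?thesis using Y(5) D(2)[of x] by auto
  qed
  ultimately show ?thesis using TM by simp
qed

text \<open>A skeleton with w + k vertices is one of about M m^w n^k and has at most n^(t-w-k)
  completions to t vertices, so k cancels. A survivor on only w vertices coincides with its
  skeleton, for which k = 0; it lies in one group and is a canonical copy by
  \<open>meets_minimal\<close>.\<close>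

lemma card_meets_le:
  assumes "t \<le> v"
  shows "real (card {F. F \<subseteq> all_edges n \<and> meets F \<and> card (\<Union>F) = t})
     \<le> real ((w + 1) * 2 ^ (2 ^ v) * (2 * w + 1) ^ w * M * m ^ w * n ^ (t - w))"
    and "F \<subseteq> all_edges n \<Longrightarrow> meets F \<Longrightarrow> deg n F \<noteq> 0 \<Longrightarrow> F \<notin> (\<Union>i<M. main i) \<Longrightarrow> card (\<Union>F) \<ge> w + 1"
proof -
  note sk = skeletons[OF order_trans[OF one_le_numeral w_ge_2] order_refl]
  from sk obtain P \<A> where P: "P \<subseteq> U" "card P = w"
    and A0: "\<forall>k. finite (\<A> k) \<and> real (card (\<A> k)) \<le> real ((2 * w + 1) ^ w * M * m ^ w * n ^ k)"
    "\<forall>k. \<forall>Y\<in>\<A> k. finite Y \<and> card Y \<le> 2 * w \<and> Y \<subseteq> D"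
    "\<forall>Y\<in>\<A> 0. \<exists>i. gr ` Y = {i}"
    "\<forall>F. meets F \<longrightarrow> (\<exists>k\<le>w. \<exists>Y\<in>\<A> k. Y \<subseteq> \<Union>F \<and> card Y = w + k \<and> pr ` Y = P)"
    by (elim exE conjE) (rule that; assumption)
  have A: "\<And>k. finite (\<A> k)" "\<And>k. real (card (\<A> k)) \<le> real ((2 * w + 1) ^ w * M * m ^ w * n ^ k)"
    "\<And>k Y. Y \<in> \<A> k \<Longrightarrow> finite Y \<and> card Y \<le> 2 * w \<and> Y \<subseteq> D"
    "\<And>Y. Y \<in> \<A> 0 \<Longrightarrow> \<exists>i. gr ` Y = {i}"
    "\<And>F. meets F \<Longrightarrow> \<exists>k\<le>w. \<exists>Y\<in>\<A> k. Y \<subseteq> \<Union>F \<and> card Y = w + k \<and> pr ` Y = P"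
    using A0 by simp_all
  have PU: "P = U" using P finite_U by (metis card_subset_eq w_def)
  have UF: "\<Union>F \<subseteq> {..<n}" if "F \<subseteq> all_edges n" for F using that by (auto simp: all_edges_def)
  {
    assume F: "F \<subseteq> all_edges n" "meets F" "deg n F \<noteq> 0" "F \<notin> (\<Union>i<M. main i)"
    obtain k Y where Y: "Y \<in> \<A> k" "Y \<subseteq> \<Union>F" "card Y = w + k" "pr ` Y = P" using A(5)[OF F(2)] by blast
    have fin: "finite (\<Union>F)" using UF[OF F(1)] finite_subset by auto
    have le: "w + k \<le> card (\<Union>F)" using card_mono[OF fin Y(2)] Y(3) by simp
    show "card (\<Union>F) \<ge> w + 1"
    proof (rule ccontr)
      assume "\<not> card (\<Union>F) \<ge> w + 1"
      then have k: "k = 0" "card (\<Union>F) = w" using le by auto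
      then have YF: "Y = \<Union>F" using Y fin by (metis add.right_neutral card_subset_eq)
      obtain i where i: "gr ` Y = {i}" using A(4)[of Y] Y(1) k(1) by blast
      have "F \<in> main i \<and> i < M"
        using meets_minimal[OF F(2,3) YF _ _ i] Y A(3)[OF Y(1)] k PU by simp
      then show False using F(4) by auto
    qed
  }
  define S where "S = {A. A \<subseteq> {..<n} \<and> card A = t \<and> (\<exists>k\<le>w. \<exists>Y\<in>\<A> k. card Y = w + k \<and> Y \<subseteq> A)}"
  have finS: "finite S" by (rule finite_subset[of _ "Pow {..<n}"]) (auto simp: S_def)
  have "real (card S) \<le> (\<Sum>k\<le>w. real ((2 * w + 1) ^ w * M * m ^ w * n ^ (t - w)))"
  proof -
    define Sk where "Sk k = (\<Union>Y\<in>{Y\<in>\<A> k. card Y = w + k}. {A. A \<subseteq> {..<n} \<and> card A = t \<and> Y \<subseteq> A})" for k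
    have finSk: "finite (Sk k)" for k by (rule finite_subset[of _ "Pow {..<n}"]) (auto simp: Sk_def)
    have "S \<subseteq> (\<Union>k\<in>{..w}. Sk k)" by (auto simp: S_def Sk_def)
    then have "card S \<le> card (\<Union>k\<in>{..w}. Sk k)" using finSk by (intro card_mono) auto
    also have "\<dots> \<le> (\<Sum>k\<le>w. card (Sk k))" by (rule card_UN_le) simp
    finally have "real (card S) \<le> (\<Sum>k\<le>w. real (card (Sk k)))" by (metis of_nat_le_iff of_nat_sum)
    also have "\<dots> \<le> (\<Sum>k\<le>w. real ((2 * w + 1) ^ w * M * m ^ w * n ^ (t - w)))"
    proof (rule sum_mono)
      fix k
      show "real (card (Sk k)) \<le> real ((2 * w + 1) ^ w * M * m ^ w * n ^ (t - w))"
      proof (cases "w + k \<le> t")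
        case True
        have "card (Sk k) \<le> (\<Sum>Y\<in>{Y\<in>\<A> k. card Y = w + k}. card {A. A \<subseteq> {..<n} \<and> card A = t \<and> Y \<subseteq> A})"
          unfolding Sk_def using A(1) by (intro card_UN_le) auto
        also have "\<dots> \<le> (\<Sum>Y\<in>{Y\<in>\<A> k. card Y = w + k}. n ^ (t - (w + k)))"
        proof (rule sum_mono)
          fix Y assume "Y \<in> {Y\<in>\<A> k. card Y = w + k}"
          then show "card {A. A \<subseteq> {..<n} \<and> card A = t \<and> Y \<subseteq> A} \<le> n ^ (t - (w + k))"
            using card_supersets_le[of "{..<n}" Y t] A(3)[of Y k] by auto
        qed
        also have "\<dots> \<le> card (\<A> k) * n ^ (t - (w + k))"
          using A(1) by (auto intro!: mult_right_mono card_mono)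
        finally have "real (card (Sk k)) \<le> real (card (\<A> k)) * real (n ^ (t - (w + k)))" by (metis of_nat_le_iff of_nat_mult)
        also have "\<dots> \<le> real ((2 * w + 1) ^ w * M * m ^ w * n ^ k) * real (n ^ (t - (w + k)))"
          by (intro mult_right_mono A(2)) auto
        also have "\<dots> = real ((2 * w + 1) ^ w * M * m ^ w * (n ^ k * n ^ (t - (w + k))))" by (simp only: of_nat_mult mult.assoc)
        also have "n ^ k * n ^ (t - (w + k)) = n ^ (t - w)" using True by (simp add: power_add[symmetric])
        finally show ?thesis .
      next
        case False
        have "Sk k = {}"
        proof (rule ccontr)
          assume "Sk k \<noteq> {}"
          then obtain A Y where AY: "A \<subseteq> {..<n}" "card A = t" "card Y = w + k" "Y \<subseteq> A" by (auto simp: Sk_def)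
          have "finite A" using AY(1) finite_subset by auto
          then show False using AY card_mono[of A Y] False by auto
        qed
        then show ?thesis by simp
      qed
    qed
    finally show ?thesis .
  qed
  then have cS: "real (card S) \<le> real ((w + 1) * ((2 * w + 1) ^ w * M * m ^ w * n ^ (t - w)))"
    by (simp add: algebra_simps)
  have "{F. F \<subseteq> all_edges n \<and> meets F \<and> card (\<Union>F) = t} \<subseteq> (\<Union>A\<in>S. Pow (Pow A))"
  proof
    fix F assume F: "F \<in> {F. F \<subseteq> all_edges n \<and> meets F \<and> card (\<Union>F) = t}"
    then obtain k Y where "k \<le> w" "Y \<in> \<A> k" "Y \<subseteq> \<Union>F" "card Y = w + k" using A(5)[of F] by blast
    then have "\<Union>F \<in> S" using F UF[of F] unfolding S_def by blast
    then show "F \<in> (\<Union>A\<in>S. Pow (Pow A))" by blast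
  qed
  moreover have "finite (Pow (Pow A))" if "A \<in> S" for A using that finite_subset[of A "{..<n}"] by (auto simp: S_def)
  then have "finite (\<Union>A\<in>S. Pow (Pow A))" using finS by blast
  ultimately have "card {F. F \<subseteq> all_edges n \<and> meets F \<and> card (\<Union>F) = t} \<le> card (\<Union>A\<in>S. Pow (Pow A))" by (rule card_mono[rotated])
  also have "\<dots> \<le> (\<Sum>A\<in>S. card (Pow (Pow A)))" by (rule card_UN_le) (rule finS)
  also have "\<dots> \<le> (\<Sum>A\<in>S. 2 ^ (2 ^ v))"
  proof (rule sum_mono)
    fix A assume "A \<in> S"
    then have "finite A" "card A = t" using finite_subset by (auto simp: S_def)
    then show "card (Pow (Pow A)) \<le> 2 ^ (2 ^ v)" using assms by (simp add: card_Pow power_increasing)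
  qed
  also have "\<dots> = card S * 2 ^ (2 ^ v)" by simp
  finally have "real (card {F. F \<subseteq> all_edges n \<and> meets F \<and> card (\<Union>F) = t}) \<le> real (card S) * real (2 ^ (2 ^ v))"
    by (simp only: of_nat_mult[symmetric] of_nat_le_iff)
  also have "\<dots> \<le> real ((w + 1) * ((2 * w + 1) ^ w * M * m ^ w * n ^ (t - w))) * real (2 ^ (2 ^ v))"
    by (intro mult_right_mono cS) auto
  finally show "real (card {F. F \<subseteq> all_edges n \<and> meets F \<and> card (\<Union>F) = t})
     \<le> real ((w + 1) * 2 ^ (2 ^ v) * (2 * w + 1) ^ w * M * m ^ w * n ^ (t - w))"
    by (simp only: of_nat_mult mult_ac)
qed

end

section \<open>Decay of the characteristic function\<close>

lemma (in weights) pexp_single: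
  fixes f :: "'b \<Rightarrow> 'c::real_normed_vector"
  assumes "finite I" "i \<in> I"
  shows "E I (\<lambda>x. f (x i)) = (\<Sum>b\<in>UNIV. q b *\<^sub>R f b)"
proof -
  have "I = insert i (I - {i})" using assms by auto
  then have "E I (\<lambda>x. f (x i)) = E (insert i (I - {i})) (\<lambda>x. f (x i))" by simp
  also have "\<dots> = (\<Sum>b\<in>UNIV. q b *\<^sub>R f b)"
    using assms by (subst pexp_insert) auto
  finally show ?thesis .
qed

lemma (in weights) pexp_pattern:
  assumes "finite I" "T \<subseteq> I"
  shows "E I (\<lambda>x. \<Prod>e\<in>T. if x e = b then 1 else 0 :: real) = q b ^ card T"
proof -
  have fT: "finite T" using assms finite_subset by auto
  have "E I (\<lambda>x. \<Prod>e\<in>T. if x e = b then 1 else 0 :: real) = (\<Prod>e\<in>T. E I (\<lambda>x. if x e = b then 1 else 0))"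
    by (rule pexp_prod_indep[where A = "\<lambda>e. {e}"]) (use assms fT in \<open>auto simp: depends_on_def disjoint_family_on_def\<close>)
  also have "\<dots> = (\<Prod>e\<in>T. q b)"
  proof (intro prod.cong refl)
    fix e assume "e \<in> T"
    then have "E I (\<lambda>x. if x e = b then 1 else 0 :: real) = (\<Sum>b'\<in>UNIV. q b' *\<^sub>R (if b' = b then 1 else 0))"
      using assms by (intro pexp_single[where f = "\<lambda>b'. if b' = b then 1 else 0"]) auto
    also have "\<dots> = q b" by (simp add: if_distrib cong: if_cong)
    finally show "E I (\<lambda>x. if x e = b then 1 else 0 :: real) = q b" .
  qed
  finally show ?thesis by simp
qed

text \<open>The monomial equals 0 if all its variables are \<open>b0\<close> and 1 if all are
  \<open>b1\<close>; both events have probability at least (lam^2)^card T. The phases 1 and cis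
  \<theta> cannot align when |\<theta>| lies between t0 and pi.\<close>

lemma phase_two_atoms:
  assumes p: "0 < lam" "lam < p" "p < 1 - lam" and T: "finite I" "T \<subseteq> I" "T \<noteq> {}" and t: "0 \<le> t0" "t0 \<le> \<bar>\<theta>\<bar>" "\<bar>\<theta>\<bar> \<le> pi"
  shows "norm (pexp (pair_weight (bern p)) I (\<lambda>x. cis (\<theta> * mon (spread.\<eta> (cbern p)) T x)))
    \<le> 1 - (lam\<^sup>2) ^ card T * (2 - sqrt (2 + 2 * cos t0))"
proof -
  interpret spread "bern p" "cbern p" by (rule spread_bern) (use p in auto)
  interpret W: centred "pair_weight (bern p)" \<eta> by (rule centred_pair)
  have fT: "finite T" using T finite_subset by auto
  define ind where "ind b x = (\<Prod>e\<in>T. if x e = b then 1 else 0 :: real)" for b and x :: "'a \<Rightarrow> bool \<times> bool"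
  define s where "s = (lam\<^sup>2) ^ card T"
  define b0 b1 where "b0 = (False, False)" and "b1 = (True, False)"
  have ind01: "ind b x = (if \<forall>e\<in>T. x e = b then 1 else 0)" for b x
  proof (cases "\<forall>e\<in>T. x e = b")
    case False
    then show ?thesis unfolding ind_def using fT by (auto intro!: prod_zero)
  qed (simp add: ind_def)
  have q0: "pair_weight (bern p) b0 \<ge> lam\<^sup>2" "pair_weight (bern p) b1 \<ge> lam\<^sup>2"
    using p mult_mono[of lam "1 - p" lam "1 - p"] mult_mono[of lam p lam "1 - p"]
    by (auto simp: pair_weight_def bern_def b0_def b1_def power2_eq_square)
  define a b where "a = W.E I (ind b0)" and "b = W.E I (ind b1)"
  have ab: "a \<ge> s" "b \<ge> s"
    unfolding a_def b_def s_def ind_def W.pexp_pattern[OF T(1,2)] by (auto intro!: power_mono q0)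
  have s0: "0 \<le> s" by (simp add: s_def)
  have mon0: "mon \<eta> T x = 0" if "\<forall>e\<in>T. x e = b0" for x
    unfolding mon_def using that T(3) fT by (intro prod_zero) (auto simp: \<eta>_def b0_def)
  have mon1: "mon \<eta> T x = 1" if "\<forall>e\<in>T. x e = b1" for x
    unfolding mon_def using that by (intro prod.neutral) (auto simp: \<eta>_def b1_def cbern_def)
  have "b0 \<noteq> b1" by (simp add: b0_def b1_def)
  then have excl: "\<not> ((\<forall>e\<in>T. x e = b0) \<and> (\<forall>e\<in>T. x e = b1))" for x using T(3) by auto
  let ?C = "\<lambda>x. cis (\<theta> * mon \<eta> T x)"
  have dec: "?C x = ?C x * of_real (1 - ind b0 x - ind b1 x) + (of_real (ind b0 x) + cis \<theta> * of_real (ind b1 x))" for x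
    using excl[of x] by (auto simp: ind01 mon0 mon1)
  have "W.E I ?C = W.E I (\<lambda>x. ?C x * of_real (1 - ind b0 x - ind b1 x)) + (of_real a + cis \<theta> * of_real b)"
    by (subst dec) (simp only: pexp_add pexp_mult_left pexp_of_real a_def b_def)
  also have "norm \<dots> \<le> norm (W.E I (\<lambda>x. ?C x * of_real (1 - ind b0 x - ind b1 x))) + norm (of_real a + cis \<theta> * of_real b)"
    by (rule norm_triangle_ineq)
  also have "norm (W.E I (\<lambda>x. ?C x * of_real (1 - ind b0 x - ind b1 x))) \<le> 1 - a - b"
  proof -
    have "norm (W.E I (\<lambda>x. ?C x * of_real (1 - ind b0 x - ind b1 x))) \<le> W.E I (\<lambda>x. norm (?C x * of_real (1 - ind b0 x - ind b1 x)))"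
      by (rule W.norm_pexp_le)
    also have "\<dots> = W.E I (\<lambda>x. 1 - ind b0 x - ind b1 x)"
    proof (rule pexp_cong)
      fix x
      show "norm (?C x * of_real (1 - ind b0 x - ind b1 x)) = 1 - ind b0 x - ind b1 x"
        unfolding norm_mult norm_of_real using excl[of x] by (auto simp: ind01)
    qed
    also have "\<dots> = 1 - a - b" using T by (simp add: pexp_diff a_def b_def)
    finally show ?thesis .
  qed
  \<comment> \<open>Only the common mass \<open>s\<close> of the two atoms is averaged; the excess
    is estimated trivially.\<close>
  also have "norm (of_real a + cis \<theta> * of_real b) \<le> (a - s) + (b - s) + s * norm (1 + cis \<theta>)"
  proof -
    have "of_real a + cis \<theta> * of_real b = of_real (a - s) + cis \<theta> * of_real (b - s) + of_real s * (1 + cis \<theta>)"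
      by (simp add: algebra_simps)
    also have "norm \<dots> \<le> norm (of_real (a - s) :: complex) + norm (cis \<theta> * of_real (b - s)) + norm (of_real s * (1 + cis \<theta>))"
      using norm_triangle_ineq norm_triangle_le by (metis (no_types, lifting) add_mono_thms_linordered_semiring(3))
    also have "\<dots> = (a - s) + (b - s) + s * norm (1 + cis \<theta>)"
      using ab s0 unfolding norm_mult norm_of_real by simp
    finally show ?thesis .
  qed
  also have "norm (1 + cis \<theta>) \<le> sqrt (2 + 2 * cos t0)"
  proof -
    have "(norm (1 + cis \<theta>))\<^sup>2 = (1 + cos \<theta>)\<^sup>2 + (sin \<theta>)\<^sup>2" by (simp add: cmod_power2)
    also have "\<dots> = 1 + 2 * cos \<theta> + ((sin \<theta>)\<^sup>2 + (cos \<theta>)\<^sup>2)" by (simp add: power2_eq_square algebra_simps)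
    also have "\<dots> = 2 + 2 * cos \<theta>" by (simp only: sin_cos_squared_add)
    also have "cos \<theta> = cos \<bar>\<theta>\<bar>" by simp
    also have "\<dots> \<le> cos t0" using t by (intro cos_monotone_0_pi_le) auto
    finally have "(norm (1 + cis \<theta>))\<^sup>2 \<le> 2 + 2 * cos t0" by simp
    then show ?thesis by (rule real_le_rsqrt)
  qed
  finally have "norm (W.E I ?C) \<le> 1 - a - b + ((a - s) + (b - s) + s * sqrt (2 + 2 * cos t0))"
    using s0 by (simp add: mult_left_mono)
  then show ?thesis unfolding s_def[symmetric] by (simp add: algebra_simps)
qed

section \<open>The characteristic function seen through one blow-up\<close>

context connected_pattern
begin

definition "charf n p \<theta> = pexp (bern p) (all_edges n) (\<lambda>x. cis (\<theta> * real (copies VH EH n {e \<in> all_edges n. x e})))"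
definition "bad_const = real v * (real v + 1) * 2 ^ (2 ^ v) * (2 * real v + 1) ^ v * (2 ^ (2 ^ v))\<^sup>2"

lemma v_ge_2: "2 \<le> v" using card_ge_2 by (simp add: v_def)

lemma charf_pol: "charf n p \<theta> = pexp (bern p) (all_edges n) (\<lambda>x. cis (pol (cbern p) (all_edges n) (\<lambda>F. \<theta> * coef n p F) x))"
  unfolding charf_def copies_pol[of n _ p] by (simp add: pol_def sum_distrib_left mult.assoc)

lemma norm_charf_le_1: "0 \<le> p \<Longrightarrow> p \<le> 1 \<Longrightarrow> norm (charf n p \<theta>) \<le> 1"
proof -
  assume "0 \<le> p" "p \<le> 1"
  then interpret spread "bern p" "cbern p" by (rule spread_bern)
  show ?thesis unfolding charf_def by (rule norm_pexp_bound) auto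
qed

end

context blow_up
begin

text \<open>On t vertices there are about M m^w n^(t-w) survivors with squared coefficients of order
  n^(2(v-t)). Since bad sets have t > w, the total is below the order of the main terms by a factor
  n, which is kept on the left side.\<close>

lemma sum_bad_le:
  assumes p: "0 \<le> p" "p \<le> 1"
  shows "real n * (\<Sum>F\<in>bad. (coef n p F)\<^sup>2) \<le> bad_const * (real M * real m ^ w * real n ^ (2 * (v - w)))"
proof -
  define A0 where "A0 = (2 ^ (2 ^ v) :: real)"
  define C0 where "C0 = (real v + 1) * A0 * (2 * real v + 1) ^ v"
  have A0: "A0 \<ge> 0" "C0 \<ge> 0" by (auto simp: A0_def C0_def)
  have finbad: "finite bad" by (rule finite_subset[of _ "Pow (all_edges n)"]) (auto simp: bad_def)
  have card_bad: "card (\<Union>F) \<in> {w + 1..v}" if F: "F \<in> bad" for F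
  proof -
    have "F \<subseteq> all_edges n" "deg n F \<noteq> 0" "meets F" "F \<notin> (\<Union>i<M. main i)" using F by (auto simp: bad_def)
    then have "card (\<Union>F) \<ge> w + 1" by (intro card_meets_le(2)[OF order_refl])
    moreover have "coef n 1 F \<noteq> 0" using \<open>deg n F \<noteq> 0\<close> by (simp add: coef_def)
    then have "card (\<Union>F) \<le> v" using coef_nonzero_card by blast
    ultimately show ?thesis by simp
  qed
  have "real n * (\<Sum>F\<in>bad. (coef n p F)\<^sup>2) = (\<Sum>t\<in>{w + 1..v}. \<Sum>F\<in>{F\<in>bad. card (\<Union>F) = t}. real n * (coef n p F)\<^sup>2)"
    unfolding sum_distrib_left using finbad card_bad by (intro sum.group[symmetric]) auto
  also have "\<dots> \<le> (\<Sum>t\<in>{w + 1..v}. C0 * A0\<^sup>2 * (real M * real m ^ w * real n ^ (2 * (v - w))))"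
  proof (rule sum_mono)
    fix t assume t: "t \<in> {w + 1..v}"
    let ?B = "{F\<in>bad. card (\<Union>F) = t}"
    have "(\<Sum>F\<in>?B. real n * (coef n p F)\<^sup>2) \<le> (\<Sum>F\<in>?B. real n * (A0 * real n ^ (v - t))\<^sup>2)"
    proof (rule sum_mono)
      fix F assume "F \<in> ?B"
      then have "coef n p F \<le> A0 * real n ^ (v - t)" using coef_le[OF p, of n F] by (simp add: A0_def)
      then show "real n * (coef n p F)\<^sup>2 \<le> real n * (A0 * real n ^ (v - t))\<^sup>2"
        using coef_nonneg[OF p(1), of n F] by (intro mult_left_mono power_mono) auto
    qed
    also have "\<dots> = real (card ?B) * (real n * (A0 * real n ^ (v - t))\<^sup>2)" by simp
    also have "\<dots> \<le> (C0 * real M * real m ^ w * real n ^ (t - w)) * (real n * (A0 * real n ^ (v - t))\<^sup>2)"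
    proof (intro mult_right_mono)
      have "real (card ?B) \<le> real (card {F. F \<subseteq> all_edges n \<and> meets F \<and> card (\<Union>F) = t})"
      proof (rule of_nat_mono, rule card_mono)
        show "finite {F. F \<subseteq> all_edges n \<and> meets F \<and> card (\<Union>F) = t}"
          by (rule finite_subset[of _ "Pow (all_edges n)"]) auto
        show "?B \<subseteq> {F. F \<subseteq> all_edges n \<and> meets F \<and> card (\<Union>F) = t}" unfolding bad_def by blast
      qed
      also have "\<dots> \<le> real ((w + 1) * 2 ^ (2 ^ v) * (2 * w + 1) ^ w * M * m ^ w * n ^ (t - w))"
        using t by (intro card_meets_le) auto
      also have "\<dots> = ((real w + 1) * A0 * (2 * real w + 1) ^ w) * (real M * real m ^ w * real n ^ (t - w))"
        by (simp add: A0_def algebra_simps)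
      also have "\<dots> \<le> C0 * (real M * real m ^ w * real n ^ (t - w))"
      proof (intro mult_right_mono)
        have "(2 * real w + 1) ^ w \<le> (2 * real v + 1) ^ w" using w_le_v by (intro power_mono) auto
        also have "\<dots> \<le> (2 * real v + 1) ^ v" using w_le_v by (intro power_increasing) auto
        finally have "(2 * real w + 1) ^ w \<le> (2 * real v + 1) ^ v" .
        then show "(real w + 1) * A0 * (2 * real w + 1) ^ w \<le> C0"
          unfolding C0_def using w_le_v A0 by (intro mult_mono) auto
      qed auto
      finally show "real (card ?B) \<le> C0 * real M * real m ^ w * real n ^ (t - w)" by (simp add: mult.assoc)
    qed auto
    also have "\<dots> = C0 * A0\<^sup>2 * (real M * real m ^ w * (real n ^ (t - w) * (real n * (real n ^ (v - t))\<^sup>2)))"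
      by (simp add: power_mult_distrib mult_ac)
    also have "\<dots> \<le> C0 * A0\<^sup>2 * (real M * real m ^ w * real n ^ (2 * (v - w)))"
    proof (intro mult_left_mono)
      have eq: "real n ^ (t - w) * (real n * (real n ^ (v - t))\<^sup>2) = real n ^ ((t - w) + 1 + 2 * (v - t))"
        by (simp add: power_add power_mult[symmetric] mult.commute)
      show "real n ^ (t - w) * (real n * (real n ^ (v - t))\<^sup>2) \<le> real n ^ (2 * (v - w))"
      proof (cases "n = 0")
        case False
        have "(t - w) + 1 + 2 * (v - t) \<le> 2 * (v - w)" using t by auto
        then show ?thesis unfolding eq using False by (intro power_increasing) auto
      qed (use t in auto)
    qed (use A0 in auto)
    finally show "(\<Sum>F\<in>?B. real n * (coef n p F)\<^sup>2) \<le> C0 * A0\<^sup>2 * (real M * real m ^ w * real n ^ (2 * (v - w)))" .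
  qed
  also have "\<dots> = real (card {w + 1..v}) * (C0 * A0\<^sup>2 * (real M * real m ^ w * real n ^ (2 * (v - w))))" by simp
  also have "\<dots> \<le> real v * (C0 * A0\<^sup>2 * (real M * real m ^ w * real n ^ (2 * (v - w))))"
    using A0 by (intro mult_right_mono) auto
  also have "\<dots> = bad_const * (real M * real m ^ w * real n ^ (2 * (v - w)))"
    by (simp add: bad_const_def C0_def A0_def mult_ac)
  finally show ?thesis .
qed

text \<open>The condition on \<theta> and m bounds the order of the phase variance of one group, so
  by \<open>sum_bad_le\<close> the bad part has squared norm of order M / n. The bound 16 = 4^2
  admits w = v and m = 1 for all |\<theta>| up to pi.\<close>

lemma decay_step:
  assumes p: "0 < lam" "lam < p" "p < 1 - lam" and n: "n \<ge> 1" "M \<ge> 1" and \<theta>: "\<bar>\<theta>\<bar> \<le> 4"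
    and \<tau>: "(\<bar>\<theta>\<bar> * real n ^ (v - w))\<^sup>2 * real m ^ w \<le> 16" and k: "k \<ge> 1"
    and \<rho>: "\<And>i. i < M \<Longrightarrow> norm (pexp (pair_weight (bern p)) (all_edges n) (\<lambda>x. cis (\<Sum>F\<in>main i. (\<theta> * coef n p F) * mon (spread.\<eta> (cbern p)) F x))) \<le> \<rho>"
      "0 \<le> \<rho>" "\<rho> \<le> 1"
  shows "norm (charf n p \<theta>) ^ (2 ^ d) \<le> (\<Sum>l<2 * k. (2 ^ d * (4 * (2 ^ d * 2 ^ (2 ^ v) * real n ^ v))) ^ l * \<rho> ^ (M - d * l)) +
     (8 ^ d * (1 + (4 ^ (k + 1)) ^ d * (16 * bad_const)) * (real M / real n)) ^ k"
proof -
  interpret spread "bern p" "cbern p" by (rule spread_bern) (use p in auto)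
  have p01: "0 \<le> p" "p \<le> 1" using p by auto
  let ?I = "all_edges n"
  let ?c = "\<lambda>F. \<theta> * coef n p F"
  define X where "X = norm (charf n p \<theta>)"
  have X: "0 \<le> X" "X \<le> 1" using norm_charf_le_1[OF p01] by (auto simp: X_def)
  have badcard: "card F \<le> d" if "F \<in> bad" for F
  proof -
    have "coef n 1 F \<noteq> 0" using that by (simp add: coef_def bad_def)
    then show ?thesis using coef_nonzero_card by blast
  qed
  have "X ^ (2 ^ card EJ) \<le> (\<Sum>l<2 * k. (2 ^ card EJ * (\<Sum>F\<in>bad. \<bar>?c F\<bar>)) ^ l * \<rho> ^ (card {..<M} - d * l)) +
     (8 ^ card EJ * (real M / real n + (\<Sum>F\<in>bad. (4 ^ (k + 1)) ^ card F * (?c F)\<^sup>2))) ^ k"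
    unfolding X_def charf_pol
  proof (rule phase_bound[where B = block and S = grp and main = main])
    show "disjoint_family_on block EJ" by (rule disjoint_block)
    show "disjoint_family_on grp {..<M}" by (rule disjoint_grp)
    show "F \<subseteq> grp i \<and> F \<subseteq> ?I \<and> (\<exists>e. F = e ` EJ \<and> (\<forall>g\<in>EJ. e g \<in> block g))" if "F \<in> main i" for i F
      using main_props[OF that] by blast
    show "F \<in> bad \<or> (\<exists>i\<in>{..<M}. F \<in> main i)"
      if "F \<subseteq> ?I" "?c F \<noteq> 0" "\<forall>g\<in>EJ. F \<inter> block g \<noteq> {}" for F
      using that by (auto simp: bad_def meets_def coef_def)
    show "bad \<inter> main i = {}" if "i \<in> {..<M}" for i using that by (auto simp: bad_def)
    show "bad \<subseteq> Pow ?I" by (auto simp: bad_def)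
    \<comment> \<open>The free parameter of hypercontractivity is given the order of the bad squared
      norm.\<close>
    show "0 < real M / real n" using n by simp
  qed (use finite_EJ EJ_nonempty block_subset badcard \<rho> k in auto)
  also have "(\<Sum>l<2 * k. (2 ^ card EJ * (\<Sum>F\<in>bad. \<bar>?c F\<bar>)) ^ l * \<rho> ^ (card {..<M} - d * l)) \<le>
     (\<Sum>l<2 * k. (2 ^ d * (4 * (2 ^ d * 2 ^ (2 ^ v) * real n ^ v))) ^ l * \<rho> ^ (M - d * l))"
  proof (intro sum_mono mult_mono power_mono)
    show "(2::real) ^ card EJ \<le> 2 ^ d" using card_EJ_le by (intro power_increasing) auto
    have "(\<Sum>F\<in>bad. \<bar>?c F\<bar>) \<le> (\<Sum>F\<in>Pow ?I. \<bar>?c F\<bar>)" by (intro sum_mono2) (auto simp: bad_def)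
    also have "\<dots> = \<bar>\<theta>\<bar> * (\<Sum>F\<in>Pow ?I. \<bar>coef n p F\<bar>)" by (simp add: abs_mult sum_distrib_left)
    also have "\<dots> \<le> 4 * (2 ^ d * 2 ^ (2 ^ v) * real n ^ v)"
      using sum_coef_le[OF p01, of n] \<theta> by (intro mult_mono) (auto intro: sum_nonneg)
    finally show "(\<Sum>F\<in>bad. \<bar>?c F\<bar>) \<le> 4 * (2 ^ d * 2 ^ (2 ^ v) * real n ^ v)" .
  qed (use \<rho> in \<open>auto intro!: mult_nonneg_nonneg sum_nonneg zero_le_power\<close>)
  also have "(8 ^ card EJ * (real M / real n + (\<Sum>F\<in>bad. (4 ^ (k + 1)) ^ card F * (?c F)\<^sup>2))) ^ k
     \<le> (8 ^ d * (1 + (4 ^ (k + 1)) ^ d * (16 * bad_const)) * (real M / real n)) ^ k"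
  proof (intro power_mono)
    have bc: "0 \<le> bad_const" by (simp add: bad_const_def)
    have "(\<Sum>F\<in>bad. (4 ^ (k + 1)) ^ card F * (?c F)\<^sup>2) \<le> (\<Sum>F\<in>bad. (4 ^ (k + 1)) ^ d * (?c F)\<^sup>2)"
      using badcard by (intro sum_mono mult_right_mono power_increasing one_le_power) auto
    also have "\<dots> = (4 ^ (k + 1)) ^ d * (\<theta>\<^sup>2 * (\<Sum>F\<in>bad. (coef n p F)\<^sup>2))"
      by (simp add: sum_distrib_left power_mult_distrib)
    also have "\<theta>\<^sup>2 * (\<Sum>F\<in>bad. (coef n p F)\<^sup>2) \<le> 16 * bad_const * (real M / real n)"
    proof -
      have "real n * (\<theta>\<^sup>2 * (\<Sum>F\<in>bad. (coef n p F)\<^sup>2)) \<le> \<theta>\<^sup>2 * (bad_const * (real M * real m ^ w * real n ^ (2 * (v - w))))"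
        using mult_left_mono[OF sum_bad_le[OF p01], of "\<theta>\<^sup>2"] by (simp add: mult_ac)
      also have "\<dots> = ((\<bar>\<theta>\<bar> * real n ^ (v - w))\<^sup>2 * real m ^ w) * (bad_const * real M)"
        by (simp add: power_mult_distrib power_mult[symmetric] mult_ac)
      also have "\<dots> \<le> 16 * (bad_const * real M)" using \<tau> bc by (intro mult_right_mono) auto
      finally show ?thesis using n by (simp add: field_simps)
    qed
    finally have "(\<Sum>F\<in>bad. (4 ^ (k + 1)) ^ card F * (?c F)\<^sup>2) \<le> (4 ^ (k + 1)) ^ d * (16 * bad_const * (real M / real n))" by simp
    then have "real M / real n + (\<Sum>F\<in>bad. (4 ^ (k + 1)) ^ card F * (?c F)\<^sup>2) \<le> (1 + (4 ^ (k + 1)) ^ d * (16 * bad_const)) * (real M / real n)"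
      by (simp add: algebra_simps)
    moreover have "(8::real) ^ card EJ \<le> 8 ^ d" using card_EJ_le by (intro power_increasing) auto
    ultimately show "8 ^ card EJ * (real M / real n + (\<Sum>F\<in>bad. (4 ^ (k + 1)) ^ card F * (?c F)\<^sup>2))
       \<le> 8 ^ d * (1 + (4 ^ (k + 1)) ^ d * (16 * bad_const)) * (real M / real n)"
      unfolding mult.assoc[of "8 ^ d"] by (intro mult_mono) (auto intro!: add_nonneg_nonneg sum_nonneg)
    show "0 \<le> 8 ^ card EJ * (real M / real n + (\<Sum>F\<in>bad. (4 ^ (k + 1)) ^ card F * (?c F)\<^sup>2))"
      by (auto intro!: mult_nonneg_nonneg add_nonneg_nonneg sum_nonneg)
  qed
  finally have "X ^ (2 ^ card EJ) \<le> (\<Sum>l<2 * k. (2 ^ d * (4 * (2 ^ d * 2 ^ (2 ^ v) * real n ^ v))) ^ l * \<rho> ^ (M - d * l)) +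
     (8 ^ d * (1 + (4 ^ (k + 1)) ^ d * (16 * bad_const)) * (real M / real n)) ^ k" by simp
  \<comment> \<open>As the modulus is at most 1, the exponent may be raised to one that does not
    depend on the chosen subpattern.\<close>
  moreover have "X ^ (2 ^ d) \<le> X ^ (2 ^ card EJ)"
    using X card_EJ_le by (intro power_decreasing power_increasing) auto
  ultimately show ?thesis unfolding X_def by linarith
qed

text \<open>The phase of a group is homogeneous with m^w coefficients of order \<theta> n^(v-w), so
  its squared norm is comparable to (\<theta> n^(v-w))^2 m^w. The value of \<kappa> is what the
  smallness condition of \<open>phase_homogeneous\<close> allows, given the upper bound 2^(2^v)
  n^(v-w) for the coefficients.\<close>

lemma group_factor_small:
  assumes p: "0 < lam" "lam < p" "p < 1 - lam" and n: "n \<ge> 2 * v" and i: "i < M"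
    and \<kappa>: "\<kappa> = lam ^ d / (4 * 4096 ^ d * (2 ^ (2 ^ v))\<^sup>2)"
    and \<tau>: "(\<bar>\<theta>\<bar> * real n ^ (v - w))\<^sup>2 * real m ^ w \<le> \<kappa>" "\<kappa> / 2 ^ v \<le> (\<bar>\<theta>\<bar> * real n ^ (v - w))\<^sup>2 * real m ^ w"
  shows "norm (pexp (pair_weight (bern p)) (all_edges n) (\<lambda>x. cis (\<Sum>F\<in>main i. (\<theta> * coef n p F) * mon (spread.\<eta> (cbern p)) F x)))
    \<le> 1 - lam ^ d * (((lam ^ d * (1 / (2 * real v)) ^ v)\<^sup>2) * (\<kappa> / 2 ^ v)) / 3"
proof -
  interpret spread "bern p" "cbern p" by (rule spread_bern) (use p in auto)
  interpret W: centred "pair_weight (bern p)" \<eta> by (rule centred_pair)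
  have p01: "0 \<le> p" "p \<le> 1" using p by auto
  have v2: "v \<ge> 2" by (rule v_ge_2)
  have lam1: "lam < 1" using p by simp
  let ?I = "all_edges n"
  define a where "a = lam ^ d * (1 / (2 * real v)) ^ v"
  define A0 where "A0 = (2 ^ (2 ^ v) :: real)"
  define c where "c F = (if F \<in> main i then \<theta> * coef n p F else 0)" for F
  define t where "t = (\<bar>\<theta>\<bar> * real n ^ (v - w))\<^sup>2 * real m ^ w"
  define Wt where "Wt = (\<Sum>F\<in>Pow ?I. (c F)\<^sup>2)"
  have sub: "main i \<subseteq> Pow ?I" using main_props(2) by blast
  have c_eq: "(\<Sum>F\<in>main i. (\<theta> * coef n p F) * mon \<eta> F x) = pol \<eta> ?I c x" for x
    unfolding pol_def using sub by (intro sum.mono_neutral_cong_left) (auto simp: c_def)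
  have Wt_eq: "Wt = (\<Sum>F\<in>main i. \<theta>\<^sup>2 * (coef n p F)\<^sup>2)"
    unfolding Wt_def using sub by (intro sum.mono_neutral_cong_right) (auto simp: c_def power_mult_distrib)
  have co: "a * real n ^ (v - w) \<le> coef n p F" "coef n p F \<le> A0 * real n ^ (v - w)" if F: "F \<in> main i" for F
  proof -
    show "coef n p F \<le> A0 * real n ^ (v - w)" using coef_le[OF p01, of n F] card_Union_main[OF F] by (simp add: A0_def)
    have "a * real n ^ (v - w) \<le> lam ^ d * (1 / (2 * real v)) ^ (v - w) * real n ^ (v - w)"
      unfolding a_def using v2 p by (intro mult_right_mono mult_left_mono power_decreasing) auto
    also have "\<dots> = (real n / (2 * real v)) ^ (v - w) * lam ^ d" by (simp add: power_divide power_one_over)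
    also have "\<dots> \<le> real (deg n F) * p ^ (d - card F)"
    proof (intro mult_mono deg_main_ge[OF i F n])
      have "lam ^ d \<le> lam ^ (d - card F)" using p lam1 by (intro power_decreasing) auto
      also have "\<dots> \<le> p ^ (d - card F)" using p by (intro power_mono) auto
      finally show "lam ^ d \<le> p ^ (d - card F)" .
    qed (use p in auto)
    finally show "a * real n ^ (v - w) \<le> coef n p F" by (simp add: coef_def)
  qed
  have a0: "0 \<le> a" "0 < A0" using p by (auto simp: a_def A0_def)
  have "Wt \<le> (\<Sum>F\<in>main i. \<theta>\<^sup>2 * (A0 * real n ^ (v - w))\<^sup>2)"
    unfolding Wt_eq using co coef_nonneg[OF p01(1)] by (intro sum_mono mult_left_mono power_mono) auto
  also have "\<dots> = A0\<^sup>2 * t" using card_main[OF i] by (simp add: t_def power_mult_distrib mult_ac)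
  finally have Wt_le: "Wt \<le> A0\<^sup>2 * t" .
  have "(\<Sum>F\<in>main i. \<theta>\<^sup>2 * (a * real n ^ (v - w))\<^sup>2) \<le> Wt"
    unfolding Wt_eq using co a0 by (intro sum_mono mult_left_mono power_mono) auto
  moreover have "(\<Sum>F\<in>main i. \<theta>\<^sup>2 * (a * real n ^ (v - w))\<^sup>2) = a\<^sup>2 * t" using card_main[OF i] by (simp add: t_def power_mult_distrib mult_ac)
  ultimately have Wt_ge: "a\<^sup>2 * t \<le> Wt" by simp
  \<comment> \<open>Taking differences doubles the variance to 2 p (1 - p), which is at least 2 lam
    (1 - lam) and hence at least lam.\<close>
  have var: "lam \<le> W.var" "W.var \<le> 1"
  proof -
    have "var = p * (1 - p)" by (rule var_bern[OF p01])
    then have "W.var = 2 * (p * (1 - p))" using var_pair by simp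
    moreover have "lam * (1 - lam) \<le> p * (1 - p)"
    proof -
      have "0 \<le> (p - lam) * (1 - lam - p)" using p by (intro mult_nonneg_nonneg) auto
      then show ?thesis by (simp add: algebra_simps)
    qed
    moreover have "lam * (1 / 2) \<le> lam * (1 - lam)" using p by (intro mult_left_mono) auto
    ultimately show "lam \<le> W.var" by linarith
    show "W.var \<le> 1" by (rule W.var_le_1)
  qed
  define g where "g = card EJ"
  have g: "1 \<le> g" "g \<le> d" using EJ_nonempty finite_EJ card_EJ_le by (auto simp: g_def Suc_le_eq card_gt_0_iff)
  have varg: "lam ^ d \<le> W.var ^ g"
  proof -
    have "lam ^ d \<le> lam ^ g" using g p lam1 by (intro power_decreasing) auto
    also have "\<dots> \<le> W.var ^ g" using var p by (intro power_mono) auto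
    finally show ?thesis .
  qed
  have "norm (W.E ?I (\<lambda>x. cis (pol \<eta> ?I c x))) \<le> 1 - W.var ^ g * Wt / 3"
  proof (rule W.phase_homogeneous)
    show "card F = g" if "F \<subseteq> ?I" "c F \<noteq> 0" for F
      using that main_props(4) by (auto simp: c_def g_def split: if_splits)
    show "4 * 4096 ^ g * Wt \<le> W.var ^ g"
    proof -
      have "4 * 4096 ^ g * Wt \<le> 4 * 4096 ^ d * (A0\<^sup>2 * t)"
        using Wt_le g a0 by (intro mult_mono power_increasing) (auto simp: Wt_eq intro!: sum_nonneg)
      also have "\<dots> \<le> 4 * 4096 ^ d * (A0\<^sup>2 * \<kappa>)" using \<tau>(1) a0 by (intro mult_left_mono) (auto simp: t_def)
      also have "\<dots> = lam ^ d" using a0 unfolding \<kappa> by (simp add: A0_def)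
      finally show ?thesis using varg by linarith
    qed
  qed (use g in \<open>auto simp: Wt_def\<close>)
  moreover have "lam ^ d * (a\<^sup>2 * (\<kappa> / 2 ^ v)) \<le> W.var ^ g * Wt"
  proof (intro mult_mono varg)
    have "a\<^sup>2 * (\<kappa> / 2 ^ v) \<le> a\<^sup>2 * t" using \<tau>(2) by (intro mult_left_mono) (auto simp: t_def)
    then show "a\<^sup>2 * (\<kappa> / 2 ^ v) \<le> Wt" using Wt_ge by linarith
    have "0 \<le> \<kappa>" unfolding \<kappa> using p by simp
    then show "0 \<le> a\<^sup>2 * (\<kappa> / 2 ^ v)" by simp
  qed (use var p in auto)
  moreover define Z where "Z = lam ^ d * (a\<^sup>2 * (\<kappa> / 2 ^ v))"
  ultimately have "norm (W.E ?I (\<lambda>x. cis (pol \<eta> ?I c x))) \<le> 1 - Z / 3" by linarith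
  then show ?thesis unfolding c_eq Z_def a_def .
qed

text \<open>For w = v and m = 1 a group carries one copy of the whole graph. Only this copy contains
  all its d edges, so its coefficient is exactly 1 and the phase is \<theta> times one monomial;
  \<theta> need not be small.\<close>

lemma group_factor_large:
  assumes p: "0 < lam" "lam < p" "p < 1 - lam" and n: "n \<ge> 2 * v" and i: "i < M" and w: "w = v" "m = 1"
    and t: "0 \<le> t0" "t0 \<le> \<bar>\<theta>\<bar>" "\<bar>\<theta>\<bar> \<le> pi"
  shows "norm (pexp (pair_weight (bern p)) (all_edges n) (\<lambda>x. cis (\<Sum>F\<in>main i. (\<theta> * coef n p F) * mon (spread.\<eta> (cbern p)) F x)))
    \<le> 1 - (lam\<^sup>2) ^ d * (2 - sqrt (2 + 2 * cos t0))"
proof -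
  have "U = VH" using U(1) finite_VH w(1) by (intro card_subset_eq) (auto simp: w_def v_def)
  then have "{e \<in> EH. e \<subseteq> U} = EH" using edge by auto
  then have EJ: "EJ = EH" by (simp add: EJ_def induced_def)
  have "card (main i) = 1" using card_main[OF i] w by simp
  then obtain T where T: "main i = {T}" by (auto simp: card_1_singleton_iff)
  have Tm: "T \<in> main i" using T by simp
  have cT: "card T = d" using main_props(4)[OF Tm] EJ by (simp add: d_def)
  have "deg n T \<le> 1"
  proof -
    have "{K \<in> KK n. T \<subseteq> K} \<subseteq> {T}"
    proof
      fix K assume K: "K \<in> {K \<in> KK n. T \<subseteq> K}"
      then have "T = K" using cT KK_props(2)[of K n] finite_KK_member[of K n] by (intro card_subset_eq) auto
      then show "K \<in> {T}" by simp
    qed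
    then show ?thesis unfolding deg_def using card_mono[of "{T}"] by simp
  qed
  moreover have "1 \<le> real (deg n T)" using deg_main_ge[OF i Tm n] w by simp
  ultimately have "deg n T = 1" by simp
  then have "coef n p T = 1" using cT by (simp add: coef_def)
  then have eq: "(\<Sum>F\<in>main i. (\<theta> * coef n p F) * mon (spread.\<eta> (cbern p)) F x) = \<theta> * mon (spread.\<eta> (cbern p)) T x" for x
    by (simp add: T)
  show ?thesis unfolding eq cT[symmetric]
    by (rule phase_two_atoms[OF p _ _ _ t]) (use main_props(2)[OF Tm] cT d_pos in auto)
qed

end

section \<open>Matching the blow-up to the frequency\<close>

context connected_pattern
begin

text \<open>The triples of group, part and index are injected into the n vertices; \<open>gr\<close>
  and \<open>pr\<close> read off the first two entries.\<close>

lemma blow_up_exists: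
  assumes "2 \<le> w" "w \<le> v" "M * (w * m) \<le> n"
  obtains U D gr pr where "blow_up VH EH n M m U D gr pr" "card U = w"
proof -
  obtain U where U: "U \<subseteq> VH" "card U = w" "connected_graph U (induced U)"
    "\<And>U'. U' \<subseteq> VH \<Longrightarrow> card U' = w \<Longrightarrow> connected_graph U' (induced U') \<Longrightarrow> card (induced U') \<le> card (induced U)"
    using densest_subset_exists[of w] assms by auto
  have fU: "finite U" using U(1) finite_VH finite_subset by auto
  let ?S = "{..<M} \<times> (U \<times> {..<m})"
  have "card ?S \<le> card {..<n}" using assms(3) U(2) by (simp add: card_cartesian_product)
  then obtain \<iota> where \<iota>: "\<iota> ` ?S \<subseteq> {..<n}" "inj_on \<iota> ?S"
    using card_le_inj[of ?S "{..<n}"] fU by blast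
  define gr where "gr x = fst (inv_into ?S \<iota> x)" for x
  define pr where "pr x = fst (snd (inv_into ?S \<iota> x))" for x
  have inv: "inv_into ?S \<iota> (\<iota> s) = s" if "s \<in> ?S" for s using \<iota>(2) that by (rule inv_into_f_f)
  have fib: "{x \<in> \<iota> ` ?S. gr x = i \<and> pr x = h} = \<iota> ` ({i} \<times> ({h} \<times> {..<m}))" if "i < M" "h \<in> U" for i h
  proof
    show "{x \<in> \<iota> ` ?S. gr x = i \<and> pr x = h} \<subseteq> \<iota> ` ({i} \<times> ({h} \<times> {..<m}))"
    proof
      fix x assume "x \<in> {x \<in> \<iota> ` ?S. gr x = i \<and> pr x = h}"
      then obtain s where s: "s \<in> ?S" "x = \<iota> s" "gr x = i" "pr x = h" by blast
      then have "fst s = i" "fst (snd s) = h" using inv[OF s(1)] by (simp_all add: gr_def pr_def)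
      then have "s \<in> {i} \<times> ({h} \<times> {..<m})" using s(1) by (cases s) auto
      then show "x \<in> \<iota> ` ({i} \<times> ({h} \<times> {..<m}))" using s(2) by blast
    qed
    show "\<iota> ` ({i} \<times> ({h} \<times> {..<m})) \<subseteq> {x \<in> \<iota> ` ?S. gr x = i \<and> pr x = h}"
    proof
      fix x assume "x \<in> \<iota> ` ({i} \<times> ({h} \<times> {..<m}))"
      then obtain r where r: "r < m" "x = \<iota> (i, h, r)" by blast
      then have s: "(i, h, r) \<in> ?S" using that by auto
      then show "x \<in> {x \<in> \<iota> ` ?S. gr x = i \<and> pr x = h}" using inv[OF s] r by (simp add: gr_def pr_def)
    qed
  qed
  have "blow_up VH EH n M m U (\<iota> ` ?S) gr pr"
  proof (intro blow_up.intro connected_pattern_axioms blow_up_axioms.intro)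
    show "U \<subseteq> VH" "2 \<le> card U" "connected_graph U (induced U)" using U assms by auto
    show "\<iota> ` ?S \<subseteq> {..<n}" by (rule \<iota>)
    show "card (induced U') \<le> card (induced U)" if "U' \<subseteq> VH" "card U' = card U" "connected_graph U' (induced U')" for U'
      using U(2,4) that by simp
    show "gr x < M \<and> pr x \<in> U" if xS: "x \<in> \<iota> ` ?S" for x
    proof -
      obtain s where s: "s \<in> ?S" "x = \<iota> s" using xS by blast
      then show ?thesis using inv[OF s(1)] by (cases s) (simp add: gr_def pr_def)
    qed
    show "card {x \<in> \<iota> ` ?S. gr x = i \<and> pr x = h} = m" if "i < M" "h \<in> U" for i h
    proof -
      have "inj_on \<iota> ({i} \<times> ({h} \<times> {..<m}))" by (rule inj_on_subset[OF \<iota>(2)]) (use that in auto)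
      then show ?thesis unfolding fib[OF that] by (simp add: card_image card_cartesian_product)
    qed
  qed
  then show ?thesis using that U(2) by blast
qed

text \<open>If |\<theta>| exceeds t0, single copies of the whole graph are used. Otherwise w is the
  least value for which |\<theta>| n^(v-w) is at most t0; minimality keeps this number from being
  too small, and so keeps the required part size m within the n available vertices.\<close>

lemma charf_decay_single:
  assumes p: "0 < lam" "lam < p" "p < 1 - lam" and n: "n \<ge> 2 * v" "M \<ge> 1" and k: "k \<ge> 1"
    and \<kappa>: "\<kappa> = lam ^ d / (4 * 4096 ^ d * (2 ^ (2 ^ v))\<^sup>2)"
    and \<rho>: "1 - lam ^ d * (((lam ^ d * (1 / (2 * real v)) ^ v)\<^sup>2) * (\<kappa> / 2 ^ v)) / 3 \<le> \<rho>"
      "1 - (lam\<^sup>2) ^ d * (2 - sqrt (2 + 2 * cos (sqrt \<kappa>))) \<le> \<rho>" "0 \<le> \<rho>" "\<rho> \<le> 1"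
    and M: "real M \<le> real n powr \<gamma>" "real v \<le> real n powr \<gamma>" "0 < \<gamma>" "2 * \<gamma> \<le> \<epsilon>" "2 * \<gamma> \<le> 1 / 3"
    and \<theta>: "real n powr (\<epsilon> - (real v - 1)) \<le> \<bar>\<theta>\<bar>" "\<bar>\<theta>\<bar> \<le> pi"
  shows "norm (charf n p \<theta>) ^ (2 ^ d) \<le> (\<Sum>l<2 * k. (2 ^ d * (4 * (2 ^ d * 2 ^ (2 ^ v) * real n ^ v))) ^ l * \<rho> ^ (M - d * l)) +
     (8 ^ d * (1 + (4 ^ (k + 1)) ^ d * (16 * bad_const)) * (real M / real n)) ^ k"
proof -
  define t0 where "t0 = sqrt \<kappa>"
  define \<tau> where "\<tau> w = \<bar>\<theta>\<bar> * real n ^ (v - w)" for w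
  have v2: "2 \<le> v" by (rule v_ge_2)
  have n1: "1 \<le> real n" "0 < real n" using n v2 by auto
  have lam1: "lam < 1" using p by simp
  have \<kappa>0: "0 < \<kappa>" "\<kappa> \<le> 1"
  proof -
    show "0 < \<kappa>" unfolding \<kappa> using p by simp
    have "lam ^ d \<le> 1" using p lam1 by (intro power_le_one) auto
    moreover have "1 * 1 \<le> 4 * 4096 ^ d * ((2 ^ (2 ^ v))\<^sup>2 :: real)"
      by (intro mult_mono one_le_power) (auto simp: one_le_power intro!: order_trans[OF _ mult_mono[of 1 4 1]])
    ultimately show "\<kappa> \<le> 1" unfolding \<kappa> by (simp add: divide_le_eq_1)
  qed
  have t0: "0 < t0" "t0 \<le> 1" "t0\<^sup>2 = \<kappa>" using \<kappa>0 by (auto simp: t0_def)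
  have \<theta>4: "\<bar>\<theta>\<bar> \<le> 4" using \<theta>(2) pi_less_4 by simp
  have M1: "1 \<le> M" by (rule n)
  have \<theta>pos: "0 < \<bar>\<theta>\<bar>" using \<theta>(1) n1 by (smt (verit) powr_gt_zero)
  have bound: "norm (charf n p \<theta>) ^ (2 ^ d) \<le> (\<Sum>l<2 * k. (2 ^ d * (4 * (2 ^ d * 2 ^ (2 ^ v) * real n ^ v))) ^ l * \<rho> ^ (M - d * l)) +
     (8 ^ d * (1 + (4 ^ (k + 1)) ^ d * (16 * bad_const)) * (real M / real n)) ^ k"
    if w: "2 \<le> w" "w \<le> v" and r: "real m \<le> real n powr (1 - 2 * \<gamma>)" and \<tau>16: "(\<tau> w)\<^sup>2 * real m ^ w \<le> 16"
      and alt: "(\<tau> w)\<^sup>2 * real m ^ w \<le> \<kappa> \<and> \<kappa> / 2 ^ v \<le> (\<tau> w)\<^sup>2 * real m ^ w \<or> w = v \<and> m = 1 \<and> t0 \<le> \<bar>\<theta>\<bar>"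
    for w m
  proof -
    \<comment> \<open>M and w take at most n^\<gamma> each, which leaves n^(1 - 2\<gamma>) for the
      part size.\<close>
    have "real (M * (w * m)) \<le> real n powr \<gamma> * (real n powr \<gamma> * real n powr (1 - 2 * \<gamma>))"
      unfolding of_nat_mult using M r w by (intro mult_mono) auto
    also have "\<dots> = real n" using n1 by (simp add: powr_add[symmetric])
    finally have "M * (w * m) \<le> n" by (simp only: of_nat_le_iff)
    then obtain U D gr pr where "blow_up VH EH n M m U D gr pr" "card U = w"
      using blow_up_exists[OF w] by blast
    then interpret B: blow_up VH EH n M m U D gr pr by simp
    have Bw: "B.w = w" unfolding B.w_def by fact
    show ?thesis
    proof (rule B.decay_step[OF p _ M1 \<theta>4 _ k])
      show "1 \<le> n" using n v2 by simp
      show "(\<bar>\<theta>\<bar> * real n ^ (v - B.w))\<^sup>2 * real m ^ B.w \<le> 16" using \<tau>16 by (simp add: Bw \<tau>_def)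
      show "norm (pexp (pair_weight (bern p)) (all_edges n) (\<lambda>x. cis (\<Sum>F\<in>B.main i. (\<theta> * coef n p F) * mon (spread.\<eta> (cbern p)) F x))) \<le> \<rho>"
        if i: "i < M" for i
        using alt
      proof
        assume a: "(\<tau> w)\<^sup>2 * real m ^ w \<le> \<kappa> \<and> \<kappa> / 2 ^ v \<le> (\<tau> w)\<^sup>2 * real m ^ w"
        show ?thesis
          by (rule order_trans[OF B.group_factor_small[OF p n(1) i \<kappa>] \<rho>(1)]) (use a in \<open>simp_all add: Bw \<tau>_def\<close>)
      next
        assume a: "w = v \<and> m = 1 \<and> t0 \<le> \<bar>\<theta>\<bar>"
        show ?thesis
          by (rule order_trans[OF B.group_factor_large[OF p n(1) i, where ?t0.0 = t0] \<rho>(2)[folded t0_def]])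
            (use a t0 \<theta> in \<open>simp_all add: Bw\<close>)
      qed
    qed (use \<rho> in auto)
  qed
  show ?thesis
  proof (cases "t0 < \<bar>\<theta>\<bar>")
    case True
    have "(\<tau> v)\<^sup>2 \<le> 4\<^sup>2" using \<theta>4 by (intro power_mono) (auto simp: \<tau>_def)
    moreover have "real n powr 0 \<le> real n powr (1 - 2 * \<gamma>)" using n1 M by (intro powr_mono) auto
    ultimately show ?thesis using True n1 v2 by (intro bound[of v 1]) auto
  next
    case False
    define w where "w = (LEAST w. 2 \<le> w \<and> \<tau> w \<le> t0)"
    have "2 \<le> v \<and> \<tau> v \<le> t0" using False v2 by (simp add: \<tau>_def)
    then have w: "2 \<le> w" "\<tau> w \<le> t0" "w \<le> v"
      unfolding w_def by (metis (mono_tags, lifting) LeastI, metis (mono_tags, lifting) LeastI, rule Least_le)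
    have \<tau>pos: "0 < \<tau> w" using \<theta>pos n1 by (simp add: \<tau>_def)
    \<comment> \<open>\<open>r\<close> solves (\<tau> w)^2 r^w = \<kappa>. As r is at least 1,
      rounding down loses at most a factor 2 per part, hence the lower bound \<kappa> / 2^v.\<close>
    define r where "r = (\<kappa> / (\<tau> w)\<^sup>2) powr (1 / real w)"
    define m where "m = nat \<lfloor>r\<rfloor>"
    have q1: "1 \<le> \<kappa> / (\<tau> w)\<^sup>2"
      using power_mono[OF w(2), of 2] \<tau>pos t0(3) by (simp add: le_divide_eq)
    have r1: "1 \<le> r" unfolding r_def using q1 by (intro ge_one_powr_ge_zero) auto
    have rw: "r ^ w = \<kappa> / (\<tau> w)\<^sup>2"
      unfolding r_def using q1 w \<kappa>0 by (subst powr_realpow[symmetric]) (auto simp: powr_powr)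
    have m: "real m \<le> r" "r \<le> 2 * real m"
    proof -
      have "1 \<le> \<lfloor>r\<rfloor>" using r1 by simp
      then have "real m = of_int \<lfloor>r\<rfloor>" "(1::real) \<le> of_int \<lfloor>r\<rfloor>" by (simp_all add: m_def)
      then show "real m \<le> r" "r \<le> 2 * real m" using of_int_floor_le[of r] real_of_int_floor_add_one_gt[of r] by linarith+
    qed
    \<comment> \<open>For w = 2 the lower bound on |\<theta>| gives r \<le> n^(1-\<epsilon>). For
      larger w minimality gives \<kappa> / (\<tau> w)^2 \<le> n^2, so r \<le> n^(2/w) \<le> n^(2/3).
      These are the origins of the two upper bounds on \<gamma>.\<close>
    have rn: "r \<le> real n powr (1 - 2 * \<gamma>)"
    proof (cases "w = 2")
      case True
      have "real n powr (\<epsilon> - 1) = real n powr (\<epsilon> - (real v - 1)) * real n ^ (v - 2)"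
        using n1 v2 by (simp add: powr_realpow[symmetric] powr_add[symmetric] of_nat_diff)
      also have "\<dots> \<le> \<tau> w" unfolding \<tau>_def True using \<theta>(1) by (intro mult_right_mono) auto
      finally have "(real n powr (\<epsilon> - 1))\<^sup>2 \<le> (\<tau> w)\<^sup>2" by (intro power_mono) auto
      moreover have "r\<^sup>2 * (\<tau> w)\<^sup>2 \<le> 1" using rw True \<tau>pos \<kappa>0 by (simp add: field_simps)
      ultimately have "r\<^sup>2 * (real n powr (\<epsilon> - 1))\<^sup>2 \<le> 1"
        by (meson mult_left_mono order_trans zero_le_power2)
      then have "(r * real n powr (\<epsilon> - 1))\<^sup>2 \<le> 1" by (simp add: power_mult_distrib)
      then have "\<bar>r * real n powr (\<epsilon> - 1)\<bar> \<le> 1" by (simp only: abs_square_le_1)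
      then have "r * real n powr (\<epsilon> - 1) \<le> 1" by (rule order_trans[OF abs_ge_self])
      then have "r \<le> 1 / real n powr (\<epsilon> - 1)" using n1 by (simp add: le_divide_eq)
      also have "\<dots> = real n powr (1 - \<epsilon>)" using n1 by (simp add: powr_minus_divide[symmetric])
      also have "\<dots> \<le> real n powr (1 - 2 * \<gamma>)" using n1 M by (intro powr_mono) auto
      finally show ?thesis .
    next
      case False
      then have w3: "3 \<le> w" using w by simp
      have "\<not> (2 \<le> w - 1 \<and> \<tau> (w - 1) \<le> t0)" unfolding w_def by (rule not_less_Least) (use w3 w_def in linarith)
      moreover have "2 \<le> w - 1" using w3 by linarith
      ultimately have "t0 < \<tau> (w - 1)" by (meson not_le)
      also have "\<tau> (w - 1) = \<tau> w * real n"
      proof -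
        have "v - (w - 1) = Suc (v - w)" using w w3 by simp
        then show ?thesis by (simp add: \<tau>_def)
      qed
      finally have "t0\<^sup>2 \<le> (\<tau> w * real n)\<^sup>2" using t0 by (intro power_mono) auto
      then have "\<kappa> / (\<tau> w)\<^sup>2 \<le> (real n)\<^sup>2" using \<tau>pos t0(3) by (simp add: power_mult_distrib field_simps)
      then have "r \<le> ((real n)\<^sup>2) powr (1 / real w)" unfolding r_def using q1 by (intro powr_mono2) auto
      also have "(real n)\<^sup>2 = real n powr 2" using powr_realpow[of "real n" 2] n1 by simp
      also have "(real n powr 2) powr (1 / real w) = real n powr (2 / real w)"
        by (simp only: powr_powr mult_1_right times_divide_eq_right)
      also have "\<dots> \<le> real n powr (1 - 2 * \<gamma>)"
      proof (intro powr_mono)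
        have "2 / real w \<le> 2 / 3" using w3 by (intro divide_left_mono) auto
        then show "2 / real w \<le> 1 - 2 * \<gamma>" using M by simp
      qed (use n1 in auto)
      finally show ?thesis .
    qed
    have up: "(\<tau> w)\<^sup>2 * real m ^ w \<le> \<kappa>"
    proof -
      have "(\<tau> w)\<^sup>2 * real m ^ w \<le> (\<tau> w)\<^sup>2 * r ^ w" using m by (intro mult_left_mono power_mono) auto
      then show ?thesis using rw \<tau>pos by simp
    qed
    have low: "\<kappa> / 2 ^ v \<le> (\<tau> w)\<^sup>2 * real m ^ w"
    proof -
      have "\<kappa> / 2 ^ v \<le> \<kappa> / 2 ^ w" using w \<kappa>0 by (intro divide_left_mono power_increasing) auto
      also have "\<dots> = (\<tau> w)\<^sup>2 * (r / 2) ^ w" using rw \<tau>pos by (simp add: power_divide)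
      also have "\<dots> \<le> (\<tau> w)\<^sup>2 * real m ^ w" using m r1 by (intro mult_left_mono power_mono) auto
      finally show ?thesis .
    qed
    show ?thesis using w up low rn m \<kappa>0 by (intro bound[of w m]) auto
  qed
qed

theorem charf_decay:
  assumes lam: "0 < lam" "lam < 1 / 2" and \<epsilon>: "0 < \<epsilon>" and A: "0 \<le> A"
  shows "\<exists>n0. \<forall>n\<ge>n0. \<forall>p \<theta>. lam < p \<longrightarrow> p < 1 - lam \<longrightarrow> real n powr (\<epsilon> - (real v - 1)) \<le> \<bar>\<theta>\<bar> \<longrightarrow> \<bar>\<theta>\<bar> \<le> pi \<longrightarrow>
    norm (charf n p \<theta>) \<le> real n powr (- A)"
proof -
  define \<kappa> where "\<kappa> = lam ^ d / (4 * 4096 ^ d * (2 ^ (2 ^ v))\<^sup>2)"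
  define \<rho>1 where "\<rho>1 = 1 - lam ^ d * (((lam ^ d * (1 / (2 * real v)) ^ v)\<^sup>2) * (\<kappa> / 2 ^ v)) / 3"
  define \<rho>2 where "\<rho>2 = 1 - (lam\<^sup>2) ^ d * (2 - sqrt (2 + 2 * cos (sqrt \<kappa>)))"
  \<comment> \<open>The entry 1/2 keeps \<rho> positive, so that its logarithm is
    meaningful.\<close>
  define \<rho> where "\<rho> = max (1 / 2) (max \<rho>1 \<rho>2)"
  define \<gamma> where "\<gamma> = min \<epsilon> (1 / 3) / 2"
  \<comment> \<open>Decoupling bounds the power 2^d of the modulus, so decay of order A needs order
    A 2^d there.\<close>
  define Q where "Q = A * 2 ^ d"
  obtain k0 :: nat where k0: "2 * (Q + 1) \<le> real k0" using real_arch_simple by blast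
  \<comment> \<open>As M / n is at most n^(-1/2), a moment with k \<ge> 2 (Q + 1) leaves n^(-1-Q);
    the spare factor 1 / n absorbs the constant.\<close>
  define k where "k = Suc k0"
  define B where "B = (2 ^ d * (4 * (2 ^ d * 2 ^ (2 ^ v))) :: real)"
  define D0 where "D0 = 8 ^ d * (1 + (4 ^ (k + 1)) ^ d * (16 * bad_const))"
  define c where "c = - ln \<rho>"
  have v2: "2 \<le> v" by (rule v_ge_2)
  have \<gamma>: "0 < \<gamma>" "2 * \<gamma> \<le> \<epsilon>" "2 * \<gamma> \<le> 1 / 3" using \<epsilon> by (auto simp: \<gamma>_def)
  have \<kappa>0: "0 < \<kappa>" unfolding \<kappa>_def using lam by simp
  have "\<rho>1 < 1" unfolding \<rho>1_def using lam \<kappa>0 v2 by simp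
  moreover have "\<rho>2 < 1"
  proof -
    have "\<kappa> < 2\<^sup>2"
    proof -
      have "lam ^ d \<le> 1" using lam by (intro power_le_one) auto
      moreover have "1 * 1 \<le> 4 * 4096 ^ d * ((2 ^ (2 ^ v))\<^sup>2 :: real)"
        by (intro mult_mono one_le_power) (auto simp: one_le_power intro!: order_trans[OF _ mult_mono[of 1 4 1]])
      ultimately have "\<kappa> \<le> 1" unfolding \<kappa>_def by (simp add: divide_le_eq_1)
      then show ?thesis by simp
    qed
    then have "sqrt \<kappa> < 2" using real_less_lsqrt by (simp add: real_sqrt_less_iff[of \<kappa> 4, simplified])
    then have "cos (sqrt \<kappa>) < cos 0" using \<kappa>0 pi_gt3 by (intro cos_monotone_0_pi) auto
    then have "sqrt (2 + 2 * cos (sqrt \<kappa>)) < sqrt 4" by (intro real_sqrt_less_mono) auto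
    then have "0 < 2 - sqrt (2 + 2 * cos (sqrt \<kappa>))" by simp
    then show ?thesis unfolding \<rho>2_def using lam by simp
  qed
  ultimately have \<rho>: "\<rho>1 \<le> \<rho>" "\<rho>2 \<le> \<rho>" "1 / 2 \<le> \<rho>" "\<rho> < 1" by (auto simp: \<rho>_def)
  have c: "0 < c" using \<rho> by (simp add: c_def)
  have bc: "0 \<le> bad_const" by (simp add: bad_const_def)
  have D0: "0 \<le> D0" using bc by (simp add: D0_def)
  have B1: "1 \<le> B"
  proof -
    have "B = 4 * 2 ^ (d + d + 2 ^ v)" by (simp add: B_def power_add)
    moreover have "1 \<le> (2::real) ^ (d + d + 2 ^ v)" by (rule one_le_power) simp
    ultimately show ?thesis by linarith
  qed
  define KK where "KK = real (2 * k) * B ^ (2 * k)"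
  \<comment> \<open>Rounding of M loses at most 1, and the expansion up to order 2k loses at most
    2dk groups.\<close>
  define s where "s = 1 + 2 * real d * real k"
  have KK: "0 \<le> KK" using B1 by (simp add: KK_def)
  have ev1: "eventually (\<lambda>n::nat. KK * real n powr (2 * real v * real k) * exp (- c * (real n powr \<gamma> - s)) \<le> real n powr (- Q) / 2) sequentially"
  proof -
    have "((\<lambda>n::nat. KK * real n powr (2 * real v * real k) * exp (- c * (real n powr \<gamma> - s)) * real n powr Q) \<longlongrightarrow> 0) sequentially"
      using c \<gamma>(1) by real_asymp
    then have "eventually (\<lambda>n::nat. KK * real n powr (2 * real v * real k) * exp (- c * (real n powr \<gamma> - s)) * real n powr Q < 1 / 2) sequentially"
      by (rule order_tendstoD) simp
    then show ?thesis using eventually_gt_at_top[of 0]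
    proof eventually_elim
      case (elim n)
      then have "0 < real n powr Q" by simp
      then show ?case using elim by (simp add: powr_minus field_simps)
    qed
  qed
  have ev2: "eventually (\<lambda>n::nat. D0 ^ k * real n powr (- 1) \<le> 1 / 2) sequentially"
  proof -
    have "((\<lambda>n::nat. D0 ^ k * real n powr (- 1)) \<longlongrightarrow> 0) sequentially" by real_asymp
    then have "eventually (\<lambda>n::nat. D0 ^ k * real n powr (- 1) < 1 / 2) sequentially" by (rule order_tendstoD) simp
    then show ?thesis by eventually_elim simp
  qed
  have ev3: "eventually (\<lambda>n::nat. real v + 1 \<le> real n powr \<gamma>) sequentially"
  proof -
    have "filterlim (\<lambda>n::nat. real n powr \<gamma>) at_top sequentially" using \<gamma>(1) by real_asymp
    then show ?thesis by (simp add: filterlim_at_top)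
  qed
  have "eventually (\<lambda>n. \<forall>p \<theta>. lam < p \<longrightarrow> p < 1 - lam \<longrightarrow> real n powr (\<epsilon> - (real v - 1)) \<le> \<bar>\<theta>\<bar> \<longrightarrow> \<bar>\<theta>\<bar> \<le> pi \<longrightarrow>
    norm (charf n p \<theta>) \<le> real n powr (- A)) sequentially"
    using ev1 ev2 ev3 eventually_ge_at_top[of "2 * v"]
  proof eventually_elim
    case (elim n)
    define M where "M = nat \<lfloor>real n powr \<gamma>\<rfloor>"
    have n1: "1 \<le> real n" using elim(4) v2 by simp
    have M: "real M \<le> real n powr \<gamma>" "real n powr \<gamma> - 1 \<le> real M" "1 \<le> M"
    proof -
      have "1 \<le> \<lfloor>real n powr \<gamma>\<rfloor>" using elim(3) v2 by simp
      then have "real M = of_int \<lfloor>real n powr \<gamma>\<rfloor>" "(1::real) \<le> of_int \<lfloor>real n powr \<gamma>\<rfloor>" by (simp_all add: M_def)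
      then show "real M \<le> real n powr \<gamma>" "real n powr \<gamma> - 1 \<le> real M" "1 \<le> M"
        using of_int_floor_le[of "real n powr \<gamma>"] real_of_int_floor_add_one_gt[of "real n powr \<gamma>"] by linarith+
    qed
    show ?case
    proof (intro allI impI)
      fix p \<theta> assume p: "lam < p" "p < 1 - lam" and \<theta>: "real n powr (\<epsilon> - (real v - 1)) \<le> \<bar>\<theta>\<bar>" "\<bar>\<theta>\<bar> \<le> pi"
      have "norm (charf n p \<theta>) ^ (2 ^ d) \<le> (\<Sum>l<2 * k. (2 ^ d * (4 * (2 ^ d * 2 ^ (2 ^ v) * real n ^ v))) ^ l * \<rho> ^ (M - d * l)) +
        (8 ^ d * (1 + (4 ^ (k + 1)) ^ d * (16 * bad_const)) * (real M / real n)) ^ k"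
        by (rule charf_decay_single[OF lam(1) p elim(4) M(3) _ \<kappa>_def _ _ _ _ M(1) _ \<gamma> \<theta>])
          (use \<rho> elim(3) in \<open>auto simp: k_def \<rho>1_def \<rho>2_def\<close>)
      also have "(\<Sum>l<2 * k. (2 ^ d * (4 * (2 ^ d * 2 ^ (2 ^ v) * real n ^ v))) ^ l * \<rho> ^ (M - d * l)) \<le> real n powr (- Q) / 2"
      proof -
        have "(\<Sum>l<2 * k. (2 ^ d * (4 * (2 ^ d * 2 ^ (2 ^ v) * real n ^ v))) ^ l * \<rho> ^ (M - d * l))
           \<le> (\<Sum>l<2 * k. (B * real n ^ v) ^ (2 * k) * exp (- c * (real n powr \<gamma> - s)))"
        proof (intro sum_mono mult_mono)
          fix l assume l: "l \<in> {..<2 * k}"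
          have Bn: "1 \<le> B * real n ^ v" using mult_mono[OF B1 one_le_power[OF n1, of v]] B1 by simp
          have Beq: "(2 ^ d * (4 * (2 ^ d * 2 ^ (2 ^ v) * real n ^ v))) = B * real n ^ v" by (simp add: B_def)
          show "(2 ^ d * (4 * (2 ^ d * 2 ^ (2 ^ v) * real n ^ v))) ^ l \<le> (B * real n ^ v) ^ (2 * k)"
            unfolding Beq using l Bn by (intro power_increasing) auto
          have "real (d * l) \<le> real (d * (2 * k))" using l by (intro of_nat_mono mult_left_mono) auto
          moreover have "real M \<le> real (M - d * l) + real (d * l)"
            unfolding of_nat_add[symmetric] by (rule of_nat_mono) simp
          moreover have "s = 1 + real (d * (2 * k))" by (simp add: s_def)
          ultimately have "real n powr \<gamma> - s \<le> real (M - d * l)" using M(2) by linarith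
          then have "\<rho> powr real (M - d * l) \<le> \<rho> powr (real n powr \<gamma> - s)"
            using \<rho> by (intro powr_mono') auto
          moreover have "\<rho> powr real (M - d * l) = \<rho> ^ (M - d * l)" using \<rho> by (intro powr_realpow) auto
          moreover have "\<rho> powr (real n powr \<gamma> - s) = exp (- c * (real n powr \<gamma> - s))"
            using \<rho> by (simp add: powr_def c_def mult.commute)
          ultimately show "\<rho> ^ (M - d * l) \<le> exp (- c * (real n powr \<gamma> - s))" by simp
        qed (use \<rho> B1 in auto)
        also have "\<dots> = KK * (real n ^ v) ^ (2 * k) * exp (- c * (real n powr \<gamma> - s))"
          by (simp add: KK_def power_mult_distrib)
        also have "(real n ^ v) ^ (2 * k) = real n powr (2 * real v * real k)"
        proof -
          have e1: "(real n ^ v) ^ (2 * k) = real n ^ (v * (2 * k))" by (simp only: power_mult)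
          have e2: "2 * real v * real k = real (v * (2 * k))" by simp
          show ?thesis unfolding e1 e2 using n1 by (intro powr_realpow[symmetric]) simp
        qed
        also have "KK * real n powr (2 * real v * real k) * exp (- c * (real n powr \<gamma> - s)) \<le> real n powr (- Q) / 2" by (rule elim(1))
        finally show ?thesis .
      qed
      also have "(8 ^ d * (1 + (4 ^ (k + 1)) ^ d * (16 * bad_const)) * (real M / real n)) ^ k \<le> real n powr (- Q) / 2"
      proof -
        have "real M / real n \<le> real n powr (- (1 / 2))"
        proof -
          have "real M / real n \<le> real n powr \<gamma> / real n powr 1" using M(1) n1 by (simp add: divide_right_mono)
          also have "\<dots> = real n powr (\<gamma> - 1)" by (simp add: powr_diff)
          also have "\<dots> \<le> real n powr (- (1 / 2))" using n1 \<gamma> by (intro powr_mono) auto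
          finally show ?thesis .
        qed
        then have "(D0 * (real M / real n)) ^ k \<le> (D0 * real n powr (- (1 / 2))) ^ k"
          using D0 by (intro power_mono mult_left_mono) auto
        also have "\<dots> = D0 ^ k * real n powr (- (1 / 2) * real k)"
        proof -
          have "(real n powr (- (1 / 2))) powr real k = (real n powr (- (1 / 2))) ^ k"
            using n1 by (intro powr_realpow) simp
          then show ?thesis by (simp add: power_mult_distrib powr_powr)
        qed
        also have "\<dots> \<le> D0 ^ k * real n powr (- 1 + - Q)"
        proof (intro mult_left_mono powr_mono)
          have "2 * (1 + Q) \<le> real k" using k0 by (simp add: k_def)
          then have "1 + Q \<le> real k / 2" by simp
          then show "- (1 / 2) * real k \<le> - 1 + - Q" by simp
        qed (use n1 D0 in auto)
        also have "\<dots> = (D0 ^ k * real n powr (- 1)) * real n powr (- Q)" by (simp only: powr_add mult.assoc)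
        also have "\<dots> \<le> 1 / 2 * real n powr (- Q)" by (intro mult_right_mono elim(2)) auto
        finally show ?thesis by (simp add: D0_def)
      qed
      finally have "norm (charf n p \<theta>) ^ (2 ^ d) \<le> real n powr (- Q)" by simp
      also have "real n powr (- Q) = (real n powr (- A)) ^ (2 ^ d)"
      proof -
        have "(real n powr (- A)) powr real (2 ^ d) = (real n powr (- A)) ^ (2 ^ d)"
          using n1 by (intro powr_realpow) simp
        then show ?thesis by (simp add: Q_def powr_powr)
      qed
      finally show "norm (charf n p \<theta>) \<le> real n powr (- A)"
        by (rule power_le_imp_le_base[of _ "2 ^ d - 1", simplified]) auto
    qed
  qed
  then show ?thesis unfolding eventually_sequentially .
qed

end

section \<open>Fourier inversion for lattice variables\<close>

lemma set_integrable_cis: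
  "set_integrable lborel {a..b} (\<lambda>\<theta>. cis (\<theta> * y))"
  unfolding cis_conv_exp by (intro borel_integrable_atLeastAtMost' continuous_intros)

lemma integrable_indicator_Icc: "integrable lborel (indicator {a..b} :: real \<Rightarrow> real)"
  by (rule integrable_real_indicator) (auto simp: emeasure_lborel_Icc_eq)

text \<open>Orthogonality of the characters of the circle: for j \<noteq> 0 the antiderivative has
  equal values at both ends.\<close>

lemma integral_cis_int:
  "(LINT \<theta>:{-pi..pi}|lborel. cis (\<theta> * of_int j)) = (if j = 0 then 2 * pi else 0)"
proof (cases "j = 0")
  case True
  have "(LINT \<theta>:{-pi..pi}|lborel. cis (\<theta> * of_int j)) = (LINT \<theta>:{-pi..pi}|lborel. (1::complex))"
    using True by (simp add: set_lebesgue_integral_def)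
  also have "\<dots> = complex_of_real (LINT \<theta>|lborel. indicator {-pi..pi} \<theta>)"
    unfolding set_lebesgue_integral_def by (simp only: scaleR_conv_of_real mult_1_right integral_complex_of_real)
  finally show ?thesis using True pi_ge_zero by simp
next
  case False
  define F where "F \<theta> = cis (\<theta> * of_int j) / (\<i> * of_int j)" for \<theta> :: real
  have "(LBINT \<theta>=-pi..pi. cis (\<theta> * of_int j)) = F pi - F (-pi)"
  proof (rule interval_integral_FTC_finite)
    show "continuous_on {min (- pi) pi..max (- pi) pi} (\<lambda>\<theta>. cis (\<theta> * of_int j))"
      unfolding cis_conv_exp by (intro continuous_intros)
    fix x :: real
    have "((\<lambda>z. exp (\<i> * (z * of_int j)) / (\<i> * of_int j)) has_field_derivative
        exp (\<i> * (of_real x * of_int j)) * (\<i> * of_int j) / (\<i> * of_int j)) (at (of_real x))"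
      by (intro DERIV_cdivide) (rule derivative_eq_intros refl | simp)+
    then have "((\<lambda>z. exp (\<i> * (z * of_int j)) / (\<i> * of_int j)) has_field_derivative exp (\<i> * (of_real x * of_int j))) (at (of_real x))"
      using False by simp
    then have "((\<lambda>\<theta>. exp (\<i> * (of_real \<theta> * of_int j)) / (\<i> * of_int j)) has_vector_derivative exp (\<i> * (of_real x * of_int j))) (at x within {min (- pi) pi..max (- pi) pi})"
      by (rule has_vector_derivative_real_field)
    then show "(F has_vector_derivative cis (x * of_int j)) (at x within {min (- pi) pi..max (- pi) pi})"
      unfolding F_def cis_conv_exp by simp
  qed
  also have "cis (pi * of_int j) = cis (- pi * of_int j)"
  proof -
    have "sin (pi * of_int j) = 0" using sin_zero_iff_int2[of "pi * of_int j"] by (auto simp: mult.commute)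
    then show ?thesis by (simp add: complex_eq_iff)
  qed
  then have "F pi - F (-pi) = 0" by (simp add: F_def)
  finally show ?thesis using False pi_ge_zero by (simp add: interval_integral_Icc)
qed

text \<open>The characteristic function of the standard normal law, rescaled; the cosmetic
  difference is that the Gaussian factor is not normalised.\<close>

lemma gaussian_fourier:
  assumes "s > 0"
  shows "(LINT \<theta>|lborel. of_real (exp (- (s * \<theta>)\<^sup>2 / 2)) * cis (\<theta> * y)) = of_real (sqrt (2 * pi) / s * exp (- (y / s)\<^sup>2 / 2))"
    "integrable lborel (\<lambda>\<theta>. of_real (exp (- (s * \<theta>)\<^sup>2 / 2)) * cis (\<theta> * y))"
    "integrable lborel (\<lambda>\<theta>. exp (- (s * \<theta>)\<^sup>2 / 2))"
    "(LINT \<theta>|lborel. exp (- (s * \<theta>)\<^sup>2 / 2)) = sqrt (2 * pi) / s"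
proof -
  have int0: "integrable lborel std_normal_density" by simp
  have dens: "exp (- (s * \<theta>)\<^sup>2 / 2) = sqrt (2 * pi) * std_normal_density (0 + s * \<theta>)" for \<theta>
    by (simp add: std_normal_density_def)
  have "integrable lborel (\<lambda>\<theta>. std_normal_density (0 + s * \<theta>))"
    using assms by (intro lborel_integrable_real_affine int0) auto
  then show int1: "integrable lborel (\<lambda>\<theta>. exp (- (s * \<theta>)\<^sup>2 / 2))"
    unfolding dens by (rule integrable_mult_right)
  show "integrable lborel (\<lambda>\<theta>. of_real (exp (- (s * \<theta>)\<^sup>2 / 2)) * cis (\<theta> * y))"
  proof (rule Bochner_Integration.integrable_bound[OF int1])
    show "(\<lambda>\<theta>. complex_of_real (exp (- (s * \<theta>)\<^sup>2 / 2)) * cis (\<theta> * y)) \<in> borel_measurable lborel"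
      unfolding cis_conv_exp by measurable
  qed (simp add: norm_mult)
  have eq: "(LINT \<theta>|lborel. of_real (exp (- (s * \<theta>)\<^sup>2 / 2)) * cis (\<theta> * y)) = of_real (sqrt (2 * pi) / s * exp (- (y / s)\<^sup>2 / 2))" for y
  proof -
    define J where "J = (LINT \<theta>|lborel. of_real (std_normal_density (0 + s * \<theta>)) * cis (\<theta> * y))"
    define e where "e = exp (- (y / s)\<^sup>2 / 2)"
    have "complex_of_real e = char std_normal_distribution (y / s)"
      by (simp add: char_std_normal_distribution e_def)
    also have "\<dots> = (LINT x|lborel. of_real (std_normal_density x) * cis (y / s * x))"
      unfolding char_def cis_conv_exp
      by (subst integral_density) (auto simp: scaleR_conv_of_real normal_density_nonneg)
    also have "\<dots> = \<bar>s\<bar> *\<^sub>R (LINT \<theta>|lborel. of_real (std_normal_density (0 + s * \<theta>)) * cis (y / s * (0 + s * \<theta>)))"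
      using assms by (intro lborel_integral_real_affine) auto
    also have "\<dots> = of_real s * J"
      using assms by (simp add: J_def mult.commute scaleR_conv_of_real)
    finally have "of_real (sqrt (2 * pi)) * J = of_real (sqrt (2 * pi) / s * e)" using assms by simp
    moreover have "(LINT \<theta>|lborel. of_real (exp (- (s * \<theta>)\<^sup>2 / 2)) * cis (\<theta> * y)) = of_real (sqrt (2 * pi)) * J"
      unfolding dens of_real_mult mult.assoc J_def by (rule integral_mult_right_zero)
    ultimately show ?thesis unfolding e_def by simp
  qed
  then show "(LINT \<theta>|lborel. of_real (exp (- (s * \<theta>)\<^sup>2 / 2)) * cis (\<theta> * y)) = of_real (sqrt (2 * pi) / s * exp (- (y / s)\<^sup>2 / 2))" .
  show "(LINT \<theta>|lborel. exp (- (s * \<theta>)\<^sup>2 / 2)) = sqrt (2 * pi) / s"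
  proof -
    have "complex_of_real (LINT \<theta>|lborel. exp (- (s * \<theta>)\<^sup>2 / 2)) = (LINT \<theta>|lborel. of_real (exp (- (s * \<theta>)\<^sup>2 / 2)) * cis (\<theta> * 0))"
      by (simp del: of_real_exp)
    also have "\<dots> = of_real (sqrt (2 * pi) / s)" using eq[of 0] by simp
    finally show ?thesis using of_real_eq_iff by blast
  qed
qed

text \<open>The point probability of an integer variable is an integral over [-pi, pi], the normal
  density one over the whole line. Their integrands are compared on three ranges: up to \<Theta> by
  \<open>small\<close>, up to pi by \<open>large\<close> together with the Gaussian tail, and beyond
  pi by the Gaussian tail alone.\<close>

theorem (in weights) local_limit_bound:
  fixes X :: "('i \<Rightarrow> 'b) \<Rightarrow> int" and s \<mu> \<Theta> \<delta>1 \<delta>2 :: real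
  assumes "finite I" "s > 0" and \<Theta>: "0 \<le> \<Theta>" "\<Theta> \<le> pi" and \<delta>: "0 \<le> \<delta>1" "0 \<le> \<delta>2"
    and small: "\<And>\<theta>. \<bar>\<theta>\<bar> \<le> \<Theta> \<Longrightarrow> norm (E I (\<lambda>x. cis (\<theta> * (of_int (X x) - \<mu>))) - of_real (exp (- (s * \<theta>)\<^sup>2 / 2))) \<le> \<delta>1"
    and large: "\<And>\<theta>. \<Theta> < \<bar>\<theta>\<bar> \<Longrightarrow> \<bar>\<theta>\<bar> \<le> pi \<Longrightarrow> norm (E I (\<lambda>x. cis (\<theta> * (of_int (X x) - \<mu>)))) \<le> \<delta>2"
  shows "\<bar>s * E I (\<lambda>x. if X x = k then 1 else 0) - std_normal_density ((of_int k - \<mu>) / s)\<bar>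
    \<le> s * \<Theta> * \<delta>1 + s * \<delta>2 + exp (- (s * \<Theta>)\<^sup>2 / 4)"
proof -
  define P where "P = E I (\<lambda>x. if X x = k then 1 else 0 :: real)"
  \<comment> \<open>The sign is such that the factor cis (\<theta> y) turns the centred variable
    into X - k, an integer.\<close>
  define y where "y = \<mu> - of_int k"
  define \<phi> where "\<phi> \<theta> = E I (\<lambda>x. cis (\<theta> * (of_int (X x) - \<mu>)))" for \<theta>
  define G where "G \<theta> = complex_of_real (exp (- (s * \<theta>)\<^sup>2 / 2))" for \<theta>
  define g where "g \<theta> = indicator {-pi..pi} \<theta> *\<^sub>R (\<phi> \<theta> * cis (\<theta> * y)) - G \<theta> * cis (\<theta> * y)" for \<theta>
  \<comment> \<open>Beyond \<Theta> half of the Gaussian exponent is frozen at its value at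
    \<Theta>, and the other half, a Gaussian with parameter s / sqrt 2, keeps the tail
    integrable.\<close>
  define h where "h \<theta> = \<delta>1 * indicator {-\<Theta>..\<Theta>} \<theta> + \<delta>2 * indicator {-pi..pi} \<theta>
     + exp (- (s * \<Theta>)\<^sup>2 / 4) * exp (- (s / sqrt 2 * \<theta>)\<^sup>2 / 2)" for \<theta>
  have \<phi>y: "\<phi> \<theta> * cis (\<theta> * y) = (\<Sum>x\<in>PiE I (\<lambda>_. UNIV). (\<Prod>i\<in>I. q (x i)) *\<^sub>R cis (\<theta> * of_int (X x - k)))" for \<theta>
    unfolding \<phi>_def pexp_def sum_distrib_right
    by (intro sum.cong refl) (simp add: y_def cis_mult algebra_simps)
  have intc: "set_integrable lborel {-pi..pi} (\<lambda>\<theta>. c *\<^sub>R cis (\<theta> * of_int j))" for c :: real and j :: int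
    by (intro set_integrable_scaleR_right set_integrable_cis)
  have int\<phi>: "set_integrable lborel {-pi..pi} (\<lambda>\<theta>. \<phi> \<theta> * cis (\<theta> * y))"
    unfolding \<phi>y set_integrable_def scaleR_sum_right
    by (intro Bochner_Integration.integrable_sum intc[unfolded set_integrable_def])
  have "(LINT \<theta>:{-pi..pi}|lborel. \<phi> \<theta> * cis (\<theta> * y)) =
    (\<Sum>x\<in>PiE I (\<lambda>_. UNIV). LINT \<theta>:{-pi..pi}|lborel. (\<Prod>i\<in>I. q (x i)) *\<^sub>R cis (\<theta> * of_int (X x - k)))"
    unfolding \<phi>y set_lebesgue_integral_def scaleR_sum_right
    by (intro Bochner_Integration.integral_sum intc[unfolded set_integrable_def])
  also have "\<dots> = (\<Sum>x\<in>PiE I (\<lambda>_. UNIV). (\<Prod>i\<in>I. q (x i)) *\<^sub>R of_real (2 * pi * (if X x = k then 1 else 0)))"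
    unfolding set_integral_scaleR_right integral_cis_int by (intro sum.cong refl) simp
  also have "\<dots> = of_real (2 * pi * P)"
    unfolding P_def pexp_def by (simp add: sum_distrib_left scaleR_conv_of_real mult_ac)
  finally have I1: "(LINT \<theta>:{-pi..pi}|lborel. \<phi> \<theta> * cis (\<theta> * y)) = of_real (2 * pi * P)" .
  have intG: "integrable lborel (\<lambda>\<theta>. G \<theta> * cis (\<theta> * y))" unfolding G_def by (rule gaussian_fourier[OF assms(2)])
  have "(LINT \<theta>|lborel. g \<theta>) = of_real (2 * pi * P) - of_real (sqrt (2 * pi) / s * exp (- (y / s)\<^sup>2 / 2))"
    unfolding g_def I1[symmetric] gaussian_fourier(1)[OF assms(2), of y, symmetric] G_def[symmetric]
    using int\<phi> intG unfolding set_lebesgue_integral_def set_integrable_def by (intro Bochner_Integration.integral_diff)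
  also have "sqrt (2 * pi) / s * exp (- (y / s)\<^sup>2 / 2) = 2 * pi * (std_normal_density ((of_int k - \<mu>) / s) / s)"
  proof -
    have e1: "(y / s)\<^sup>2 = ((of_int k - \<mu>) / s)\<^sup>2" by (simp add: y_def power_divide power2_commute)
    have "2 * pi = sqrt (2 * pi) * sqrt (2 * pi)" using pi_ge_zero by simp
    then have e2: "sqrt (2 * pi) = 2 * pi / sqrt (2 * pi)" using pi_gt_zero by (simp add: field_simps)
    show ?thesis unfolding e1 std_normal_density_def by (subst e2) simp
  qed
  finally have "(LINT \<theta>|lborel. g \<theta>) = of_real (2 * pi * (P - std_normal_density ((of_int k - \<mu>) / s) / s))"
    by (simp add: right_diff_distrib)
  then have Ig: "norm (LINT \<theta>|lborel. g \<theta>) = 2 * pi * \<bar>P - std_normal_density ((of_int k - \<mu>) / s) / s\<bar>"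
    using pi_ge_zero by (simp only: norm_of_real abs_mult)
  have inth: "integrable lborel h"
    unfolding h_def using assms(2) by (intro Bochner_Integration.integrable_add integrable_mult_right gaussian_fourier(3) integrable_indicator_Icc) auto
  have gh: "norm (g \<theta>) \<le> h \<theta>" for \<theta>
  proof -
    have e: "exp (- (s * \<theta>)\<^sup>2 / 2) \<le> exp (- (s * \<Theta>)\<^sup>2 / 4) * exp (- (s / sqrt 2 * \<theta>)\<^sup>2 / 2)" if "\<Theta> < \<bar>\<theta>\<bar>"
    proof -
      have "\<Theta>\<^sup>2 \<le> \<bar>\<theta>\<bar>\<^sup>2" using that \<Theta> by (intro power_mono) auto
      then have "s\<^sup>2 * \<Theta>\<^sup>2 \<le> s\<^sup>2 * \<theta>\<^sup>2" by (intro mult_left_mono) auto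
      then show ?thesis by (simp add: exp_add[symmetric] power_mult_distrib power_divide)
    qed
    have nG: "norm (G \<theta> * cis (\<theta> * y)) = exp (- (s * \<theta>)\<^sup>2 / 2)" by (simp add: G_def norm_mult)
    have n\<phi>: "norm (\<phi> \<theta> * cis (\<theta> * y)) = norm (\<phi> \<theta>)" by (simp add: norm_mult)
    have h3: "0 \<le> exp (- (s * \<Theta>)\<^sup>2 / 4) * exp (- (s / sqrt 2 * \<theta>)\<^sup>2 / 2)" by simp
    consider "\<bar>\<theta>\<bar> \<le> \<Theta>" | "\<Theta> < \<bar>\<theta>\<bar>" "\<bar>\<theta>\<bar> \<le> pi" | "\<Theta> < \<bar>\<theta>\<bar>" "pi < \<bar>\<theta>\<bar>" by linarith
    then show ?thesis
    proof cases
      case 1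
      then have "g \<theta> = (\<phi> \<theta> - G \<theta>) * cis (\<theta> * y)" using \<Theta> by (auto simp: g_def left_diff_distrib indicator_def abs_le_iff)
      then have "norm (g \<theta>) \<le> \<delta>1" using small[OF 1] by (simp add: norm_mult \<phi>_def G_def)
      moreover have "\<delta>1 \<le> h \<theta>" using 1 \<delta> h3 by (auto simp: h_def indicator_def abs_le_iff)
      ultimately show ?thesis by simp
    next
      case 2
      have "norm (g \<theta>) \<le> norm (\<phi> \<theta> * cis (\<theta> * y)) + norm (G \<theta> * cis (\<theta> * y))"
        using 2 norm_triangle_ineq4 by (auto simp: g_def indicator_def abs_le_iff)
      also have "\<dots> \<le> \<delta>2 + exp (- (s * \<Theta>)\<^sup>2 / 4) * exp (- (s / sqrt 2 * \<theta>)\<^sup>2 / 2)"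
        unfolding nG n\<phi> using large[OF 2] e[OF 2(1)] by (intro add_mono) (auto simp: \<phi>_def)
      also have "\<dots> \<le> h \<theta>" using 2 \<delta> by (auto simp: h_def indicator_def abs_le_iff)
      finally show ?thesis .
    next
      case 3
      have "norm (g \<theta>) = norm (G \<theta> * cis (\<theta> * y))"
        using 3 by (auto simp: g_def indicator_def abs_le_iff)
      also have "\<dots> \<le> exp (- (s * \<Theta>)\<^sup>2 / 4) * exp (- (s / sqrt 2 * \<theta>)\<^sup>2 / 2)" unfolding nG by (rule e[OF 3(1)])
      also have "\<dots> \<le> h \<theta>" using \<delta> by (auto simp: h_def)
      finally show ?thesis .
    qed
  qed
  have "norm (LINT \<theta>|lborel. g \<theta>) \<le> (LINT \<theta>|lborel. h \<theta>)"
    by (rule Bochner_Integration.integral_norm_bound_integral[OF _ inth gh])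
       (use int\<phi> intG in \<open>simp add: g_def set_integrable_def\<close>)
  also have "\<dots> = \<delta>1 * (2 * \<Theta>) + \<delta>2 * (2 * pi) + exp (- (s * \<Theta>)\<^sup>2 / 4) * (sqrt (2 * pi) / (s / sqrt 2))"
  proof -
    have a: "integrable lborel (\<lambda>\<theta>. \<delta>1 * indicator {-\<Theta>..\<Theta>} \<theta> :: real)" "integrable lborel (\<lambda>\<theta>. \<delta>2 * indicator {-pi..pi} \<theta> :: real)"
      by (intro integrable_mult_right integrable_indicator_Icc)+
    have b: "integrable lborel (\<lambda>\<theta>. exp (- (s * \<Theta>)\<^sup>2 / 4) * exp (- (s / sqrt 2 * \<theta>)\<^sup>2 / 2))"
      using assms(2) by (intro integrable_mult_right gaussian_fourier(3)) simp
    have "(LINT \<theta>|lborel. h \<theta>) = (LINT \<theta>|lborel. \<delta>1 * indicator {-\<Theta>..\<Theta>} \<theta>) + (LINT \<theta>|lborel. \<delta>2 * indicator {-pi..pi} \<theta>)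
      + (LINT \<theta>|lborel. exp (- (s * \<Theta>)\<^sup>2 / 4) * exp (- (s / sqrt 2 * \<theta>)\<^sup>2 / 2))"
      unfolding h_def using a b by (simp only: Bochner_Integration.integral_add Bochner_Integration.integrable_add)
    also have "(LINT \<theta>|lborel. exp (- (s * \<Theta>)\<^sup>2 / 4) * exp (- (s / sqrt 2 * \<theta>)\<^sup>2 / 2)) = exp (- (s * \<Theta>)\<^sup>2 / 4) * (sqrt (2 * pi) / (s / sqrt 2))"
      using gaussian_fourier(4)[of "s / sqrt 2"] assms(2) by (simp only: integral_mult_right_zero) simp
    finally show ?thesis using \<Theta> pi_ge_zero by simp
  qed
  finally have main: "2 * pi * \<bar>P - std_normal_density ((of_int k - \<mu>) / s) / s\<bar> \<le>
    \<delta>1 * (2 * \<Theta>) + \<delta>2 * (2 * pi) + exp (- (s * \<Theta>)\<^sup>2 / 4) * (sqrt (2 * pi) / (s / sqrt 2))" unfolding Ig .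
  have "\<bar>s * P - std_normal_density ((of_int k - \<mu>) / s)\<bar> = s * \<bar>P - std_normal_density ((of_int k - \<mu>) / s) / s\<bar>"
  proof -
    have "s * P - std_normal_density ((of_int k - \<mu>) / s) = s * (P - std_normal_density ((of_int k - \<mu>) / s) / s)"
      using assms(2) by (simp add: right_diff_distrib)
    then show ?thesis using assms(2) by (simp add: abs_mult)
  qed
  also have "\<dots> = (s / (2 * pi)) * (2 * pi * \<bar>P - std_normal_density ((of_int k - \<mu>) / s) / s\<bar>)" by simp
  also have "\<dots> \<le> (s / (2 * pi)) * (\<delta>1 * (2 * \<Theta>) + \<delta>2 * (2 * pi) + exp (- (s * \<Theta>)\<^sup>2 / 4) * (sqrt (2 * pi) / (s / sqrt 2)))"
    using assms(2) pi_ge_zero by (intro mult_left_mono main) auto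
  also have "\<dots> = s * \<Theta> * \<delta>1 * (1 / pi) + s * \<delta>2 + exp (- (s * \<Theta>)\<^sup>2 / 4) * (sqrt (2 * pi) * sqrt 2 / (2 * pi))"
    using assms(2) by (simp add: field_simps)
  also have "\<dots> \<le> s * \<Theta> * \<delta>1 * 1 + s * \<delta>2 + exp (- (s * \<Theta>)\<^sup>2 / 4) * 1"
  proof (intro add_mono mult_left_mono order_refl)
    show "1 / pi \<le> 1" using pi_gt3 by simp
    have "sqrt (2 * pi) * sqrt 2 \<le> sqrt (2 * pi) * sqrt (2 * pi)" using pi_gt3 by (intro mult_left_mono) auto
    then show "sqrt (2 * pi) * sqrt 2 / (2 * pi) \<le> 1" using pi_gt_zero by simp
    show "0 \<le> s * \<Theta> * \<delta>1" using assms(2) \<Theta> \<delta> by simp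
  qed (use assms(2) in auto)
  finally show ?thesis unfolding P_def by simp
qed

section \<open>Gaussian comparison near the origin\<close>

lemma norm_cis_diff_le: "norm (cis a - cis b) \<le> \<bar>a - b\<bar>"
proof -
  have "cis a - cis b = cis b * (cis (a - b) - 1)" by (simp add: right_diff_distrib cis_mult)
  then have "norm (cis a - cis b) = norm (cis (a - b) - 1)" by (simp add: norm_mult)
  also have "\<dots> \<le> \<bar>a - b\<bar>" using iexp_approx1[of "a - b" 0] by (simp add: cis_conv_exp)
  finally show ?thesis .
qed

lemma exp_minus_diff_le: "\<bar>exp (- a) - exp (- b)\<bar> \<le> b - a" if "0 \<le> a" "a \<le> b" for a b :: real
proof -
  have "1 - (b - a) \<le> exp (- (b - a))" using exp_ge_add_one_self[of "- (b - a)"] by linarith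
  then have "exp (- a) * (1 - (b - a)) \<le> exp (- a) * exp (- (b - a))"
    by (rule mult_left_mono) simp
  also have "\<dots> = exp (- b)" by (simp add: exp_add[symmetric])
  finally have "exp (- a) - exp (- b) \<le> exp (- a) * (b - a)" by (simp add: algebra_simps)
  also have "\<dots> \<le> 1 * (b - a)" using that by (intro mult_right_mono) auto
  finally have "exp (- a) - exp (- b) \<le> b - a" by simp
  moreover have "exp (- b) \<le> exp (- a)" using that by simp
  ultimately show ?thesis by simp
qed

lemma exp_minus_quadratic: "\<bar>exp (- y) - (1 - y)\<bar> \<le> y\<^sup>2 \<and> \<bar>exp (- y) - (1 - y)\<bar> \<le> y" if "0 \<le> y" for y :: real
proof -
  have 1: "1 - y \<le> exp (- y)" using exp_ge_add_one_self[of "- y"] by simp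
  have "exp (- y) \<le> 1 / (1 + y)"
    using exp_ge_add_one_self[of y] that by (simp add: exp_minus inverse_eq_divide frac_le)
  also have "1 / (1 + y) = (1 - y) + y\<^sup>2 / (1 + y)" using that by (simp add: field_simps power2_eq_square)
  also have "y\<^sup>2 / (1 + y) \<le> y\<^sup>2" using that mult_left_mono[of 1 "1 + y" "y\<^sup>2"] by (simp add: divide_le_eq)
  finally have "exp (- y) - (1 - y) \<le> y\<^sup>2" by simp
  moreover have "exp (- y) \<le> 1" using that by simp
  ultimately show ?thesis using 1 by auto
qed

context centred
begin

text \<open>Both functions differ from 1 - var t^2 / 2 by at most |t|^3: the first by Taylor
  expansion with vanishing mean, the second by the quadratic estimate for |t| \<le> 1 and by the
  linear one otherwise.\<close>

lemma char_single:
  assumes "finite I" "e \<in> I"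
  shows "norm (E I (\<lambda>x. cis (t * \<zeta> (x e))) - of_real (exp (- (var * t\<^sup>2 / 2)))) \<le> 2 * \<bar>t\<bar> ^ 3"
proof -
  define Y where "Y x = t * \<zeta> (x e)" for x :: "'a \<Rightarrow> 'b"
  have m1: "E I Y = 0"
  proof -
    have "Y = (\<lambda>x. t * \<zeta> (x e))" by (simp add: Y_def fun_eq_iff)
    then show ?thesis
      using pexp_single[OF assms, of "\<lambda>b. t * \<zeta> b"] centred by (simp add: sum_distrib_left[symmetric] mult.left_commute)
  qed
  have m2: "E I (\<lambda>x. (Y x)\<^sup>2) = var * t\<^sup>2"
    using pexp_single[OF assms, of "\<lambda>b. (t * \<zeta> b)\<^sup>2"]
    by (simp add: Y_def var_def power_mult_distrib sum_distrib_left mult_ac)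
  define T where "T x = 1 + \<i> * Y x - (Y x)\<^sup>2 / 2" for x
  have "E I T = of_real (1 - var * t\<^sup>2 / 2)"
  proof -
    have "E I T = E I (\<lambda>x. (1 + \<i> * Y x) - (1 / 2) * of_real ((Y x)\<^sup>2))"
    proof -
      have "T = (\<lambda>x. (1 + \<i> * Y x) - (1 / 2) * of_real ((Y x)\<^sup>2))" by (simp add: T_def fun_eq_iff)
      then show ?thesis by simp
    qed
    also have "\<dots> = 1 + \<i> * of_real (E I Y) - (1 / 2) * of_real (E I (\<lambda>x. (Y x)\<^sup>2))"
      using assms(1) by (simp only: pexp_diff pexp_add pexp_mult_left pexp_of_real pexp_const)
    finally show ?thesis by (simp add: m1 m2)
  qed
  then have "norm (E I (\<lambda>x. cis (Y x)) - of_real (1 - var * t\<^sup>2 / 2)) = norm (E I (\<lambda>x. cis (Y x) - T x))"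
    by (simp only: pexp_diff)
  also have "\<dots> \<le> E I (\<lambda>x. norm (cis (Y x) - T x))" by (rule norm_pexp_le)
  also have "\<dots> \<le> E I (\<lambda>x. \<bar>t\<bar> ^ 3)"
  proof (rule pexp_mono)
    fix x
    define y where "y = Y x"
    have "norm (cis y - (1 + \<i> * y - y\<^sup>2 / 2)) \<le> \<bar>y\<bar> ^ 3 / 6"
      using iexp_approx1[of y 2]
      by (simp add: cis_conv_exp numeral_2_eq_2 power2_eq_square fact_numeral mult_ac numeral_3_eq_3 algebra_simps)
    also have "\<dots> \<le> \<bar>y\<bar> ^ 3" by simp
    also have "\<dots> \<le> \<bar>t\<bar> ^ 3" unfolding y_def Y_def abs_mult using bounded by (intro power_mono mult_left_le) auto
    finally show "norm (cis (Y x) - T x) \<le> \<bar>t\<bar> ^ 3" by (simp add: y_def T_def)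
  qed
  finally have 1: "norm (E I (\<lambda>x. cis (Y x)) - of_real (1 - var * t\<^sup>2 / 2)) \<le> \<bar>t\<bar> ^ 3" using assms(1) by simp
  define y where "y = var * t\<^sup>2 / 2"
  have y0: "0 \<le> y" using var_nonneg by (simp add: y_def)
  have yt: "y \<le> t\<^sup>2" using mult_right_mono[OF var_le_1, of "t\<^sup>2"] zero_le_power2[of t] unfolding y_def by linarith
  have "\<bar>exp (- y) - (1 - y)\<bar> \<le> \<bar>t\<bar> ^ 3"
  proof (cases "\<bar>t\<bar> \<le> 1")
    case True
    have "\<bar>exp (- y) - (1 - y)\<bar> \<le> y\<^sup>2" using exp_minus_quadratic[OF y0] by simp
    also have "\<dots> \<le> (t\<^sup>2)\<^sup>2" using y0 yt by (intro power_mono) auto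
    also have "\<dots> = \<bar>t\<bar> ^ 4" by (simp add: power_even_abs)
    also have "\<dots> \<le> \<bar>t\<bar> ^ 3" using True by (intro power_decreasing) auto
    finally show ?thesis .
  next
    case False
    have "\<bar>exp (- y) - (1 - y)\<bar> \<le> y" using exp_minus_quadratic[OF y0] by simp
    also have "\<dots> \<le> \<bar>t\<bar> ^ 2" using yt by simp
    also have "\<dots> \<le> \<bar>t\<bar> ^ 3" using False by (intro power_increasing) auto
    finally show ?thesis .
  qed
  then have 2: "norm (complex_of_real (1 - y) - of_real (exp (- y))) \<le> \<bar>t\<bar> ^ 3"
    unfolding of_real_diff[symmetric] norm_of_real by (simp add: abs_minus_commute)
  have "norm (E I (\<lambda>x. cis (Y x)) - of_real (exp (- y))) \<le> \<bar>t\<bar> ^ 3 + \<bar>t\<bar> ^ 3"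
    using norm_triangle_mono[OF 1[folded y_def] 2] by simp
  then show ?thesis unfolding Y_def y_def by simp
qed

lemma pol_split_linear:
  assumes "finite I"
  shows "pol \<zeta> I c x - c {} = (\<Sum>e\<in>I. c {e} * \<zeta> (x e)) + pol \<zeta> I (\<lambda>F. if card F \<ge> 2 then c F else 0) x"
proof -
  let ?S = "(\<lambda>e. {e}) ` I"
  have fin: "finite F" if "F \<in> Pow I" for F using that assms finite_subset by auto
  have "pol \<zeta> I c x - pol \<zeta> I (\<lambda>F. if card F \<ge> 2 then c F else 0) x = (\<Sum>F\<in>Pow I. (if card F \<ge> 2 then 0 else c F) * mon \<zeta> F x)"
    unfolding pol_def sum_subtractf[symmetric] by (intro sum.cong) auto
  also have "\<dots> = (\<Sum>F\<in>insert {} ?S. c F * mon \<zeta> F x)"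
  proof (rule sum.mono_neutral_cong_right)
    show "\<forall>F\<in>Pow I - insert {} ?S. (if card F \<ge> 2 then 0 else c F) * mon \<zeta> F x = 0"
    proof
      fix F assume F: "F \<in> Pow I - insert {} ?S"
      have "card F \<noteq> 0" using F fin[of F] by auto
      moreover have "card F \<noteq> 1" using F by (auto simp: card_1_singleton_iff)
      ultimately show "(if card F \<ge> 2 then 0 else c F) * mon \<zeta> F x = 0" by simp
    qed
  qed (use assms in auto)
  also have "\<dots> = c {} + (\<Sum>F\<in>?S. c F * mon \<zeta> F x)"
    using assms by (subst sum.insert) (auto simp: mon_def)
  also have "(\<Sum>F\<in>?S. c F * mon \<zeta> F x) = (\<Sum>e\<in>I. c {e} * \<zeta> (x e))"
    by (subst sum.reindex) (auto simp: mon_def)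
  finally show ?thesis by simp
qed

lemma sum_split_linear:
  fixes f :: "'i set \<Rightarrow> real"
  assumes "finite I"
  shows "(\<Sum>F\<in>Pow I - {{}}. f F) = (\<Sum>e\<in>I. f {e}) + (\<Sum>F\<in>{F\<in>Pow I. card F \<ge> 2}. f F)"
proof -
  let ?S = "(\<lambda>e. {e}) ` I"
  have eq: "Pow I - {{}} = ?S \<union> {F\<in>Pow I. card F \<ge> 2}"
  proof
    show "Pow I - {{}} \<subseteq> ?S \<union> {F\<in>Pow I. card F \<ge> 2}"
    proof
      fix F assume F: "F \<in> Pow I - {{}}"
      then have "finite F" using assms finite_subset by auto
      then have "card F \<noteq> 0" using F by auto
      then have "card F = 1 \<or> card F \<ge> 2" by linarith
      then show "F \<in> ?S \<union> {F\<in>Pow I. card F \<ge> 2}" using F by (auto simp: card_1_singleton_iff)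
    qed
  qed auto
  have "sum f (Pow I - {{}}) = sum f ?S + sum f {F\<in>Pow I. card F \<ge> 2}"
    unfolding eq using assms by (intro sum.union_disjoint) auto
  also have "sum f ?S = (\<Sum>e\<in>I. f {e})" by (subst sum.reindex) auto
  finally show ?thesis .
qed

text \<open>Three replacements, one for each error term: the part of degree at least 2 is dropped,
  with its L^1 norm bounded by its L^2 norm; the independent linear summands are exchanged for
  Gaussian factors one at a time, all moduli being at most 1; and the variance of the linear part is
  replaced by the full variance.\<close>

theorem gaussian_comparison:
  fixes c :: "'i set \<Rightarrow> real"
  assumes "finite I"
    and S: "S = (\<Sum>F\<in>Pow I - {{}}. var ^ card F * (c F)\<^sup>2)"
    and V: "(\<Sum>F\<in>{F\<in>Pow I. card F \<ge> 2}. (c F)\<^sup>2) \<le> V"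
  shows "norm (E I (\<lambda>x. cis (\<theta> * (pol \<zeta> I c x - c {}))) - of_real (exp (- (\<theta>\<^sup>2 * S / 2))))
    \<le> \<bar>\<theta>\<bar> * sqrt V + 2 * \<bar>\<theta>\<bar> ^ 3 * (\<Sum>e\<in>I. \<bar>c {e}\<bar> ^ 3) + \<theta>\<^sup>2 * V / 2"
proof -
  define L where "L x = (\<Sum>e\<in>I. c {e} * \<zeta> (x e))" for x
  define c2 where "c2 F = (if card F \<ge> 2 then c F else 0)" for F
  define Q where "Q x = pol \<zeta> I c2 x" for x
  define SL where "SL = (\<Sum>e\<in>I. var * (c {e})\<^sup>2)"
  have XLQ: "pol \<zeta> I c x - c {} = L x + Q x" for x
    unfolding L_def Q_def c2_def by (rule pol_split_linear) fact
  have varp: "0 \<le> var ^ j" "var ^ j \<le> 1" for j using var_nonneg var_le_1 by (auto intro: power_le_one)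
  define V2 where "V2 = (\<Sum>F\<in>{F\<in>Pow I. card F \<ge> 2}. var ^ card F * (c F)\<^sup>2)"
  have V2: "0 \<le> V2" "V2 \<le> V"
  proof -
    show "0 \<le> V2" unfolding V2_def using varp by (intro sum_nonneg) auto
    have "V2 \<le> (\<Sum>F\<in>{F\<in>Pow I. card F \<ge> 2}. 1 * (c F)\<^sup>2)"
      unfolding V2_def using varp by (intro sum_mono mult_right_mono) auto
    then show "V2 \<le> V" using V by simp
  qed
  have SSL: "S = SL + V2" unfolding S SL_def V2_def using sum_split_linear[OF assms(1), of "\<lambda>F. var ^ card F * (c F)\<^sup>2"] by simp
  have SL0: "0 \<le> SL" unfolding SL_def using var_nonneg by (intro sum_nonneg) auto
  have EQ2: "E I (\<lambda>x. (Q x)\<^sup>2) = V2"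
  proof -
    have "E I (\<lambda>x. (Q x)\<^sup>2) = (\<Sum>F\<in>Pow I. var ^ card F * (c2 F)\<^sup>2)" unfolding Q_def by (rule pexp_pol_square) fact
    also have "\<dots> = V2" unfolding V2_def using assms(1) by (intro sum.mono_neutral_cong_right) (auto simp: c2_def)
    finally show ?thesis .
  qed
  have 1: "norm (E I (\<lambda>x. cis (\<theta> * (L x + Q x))) - E I (\<lambda>x. cis (\<theta> * L x))) \<le> \<bar>\<theta>\<bar> * sqrt V"
  proof -
    have "norm (E I (\<lambda>x. cis (\<theta> * (L x + Q x))) - E I (\<lambda>x. cis (\<theta> * L x))) \<le> E I (\<lambda>x. norm (cis (\<theta> * (L x + Q x)) - cis (\<theta> * L x)))"
      unfolding pexp_diff[symmetric] by (rule norm_pexp_le)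
    also have "\<dots> \<le> E I (\<lambda>x. \<bar>\<theta>\<bar> * \<bar>Q x\<bar>)"
    proof (rule pexp_mono)
      fix x
      have "\<theta> * (L x + Q x) - \<theta> * L x = \<theta> * Q x" by (simp add: algebra_simps)
      then show "norm (cis (\<theta> * (L x + Q x)) - cis (\<theta> * L x)) \<le> \<bar>\<theta>\<bar> * \<bar>Q x\<bar>"
        using norm_cis_diff_le[of "\<theta> * (L x + Q x)" "\<theta> * L x"] by (simp add: abs_mult)
    qed
    also have "\<dots> = \<bar>\<theta>\<bar> * E I (\<lambda>x. \<bar>Q x\<bar>)" by (simp add: pexp_mult_left)
    also have "E I (\<lambda>x. \<bar>Q x\<bar>) \<le> sqrt V"
    proof (rule real_le_rsqrt)
      have "(E I (\<lambda>x. \<bar>Q x\<bar>))\<^sup>2 \<le> E I (\<lambda>x. \<bar>Q x\<bar>\<^sup>2)" by (rule pexp_square_le) fact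
      then show "(E I (\<lambda>x. \<bar>Q x\<bar>))\<^sup>2 \<le> V" using EQ2 V2 by simp
    qed
    finally show ?thesis by (simp add: mult_left_mono)
  qed
  have 2: "norm (E I (\<lambda>x. cis (\<theta> * L x)) - of_real (exp (- (\<theta>\<^sup>2 * SL / 2)))) \<le> 2 * \<bar>\<theta>\<bar> ^ 3 * (\<Sum>e\<in>I. \<bar>c {e}\<bar> ^ 3)"
  proof -
    have "E I (\<lambda>x. cis (\<theta> * L x)) = E I (\<lambda>x. \<Prod>e\<in>I. cis (\<theta> * c {e} * \<zeta> (x e)))"
      unfolding L_def sum_distrib_left using assms(1) by (simp add: cis_sum mult.assoc)
    also have "\<dots> = (\<Prod>e\<in>I. E I (\<lambda>x. cis (\<theta> * c {e} * \<zeta> (x e))))"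
      by (rule pexp_prod_indep[where A = "\<lambda>e. {e}"]) (use assms(1) in \<open>auto simp: depends_on_def disjoint_family_on_def\<close>)
    finally have eq1: "E I (\<lambda>x. cis (\<theta> * L x)) = (\<Prod>e\<in>I. E I (\<lambda>x. cis (\<theta> * c {e} * \<zeta> (x e))))" .
    have "- (\<theta>\<^sup>2 * SL / 2) = (\<Sum>e\<in>I. - (var * (\<theta> * c {e})\<^sup>2 / 2))"
      by (simp add: SL_def sum_distrib_left sum_divide_distrib sum_negf power_mult_distrib mult_ac)
    then have eq2: "complex_of_real (exp (- (\<theta>\<^sup>2 * SL / 2))) = (\<Prod>e\<in>I. of_real (exp (- (var * (\<theta> * c {e})\<^sup>2 / 2))))"
      using assms(1) by (simp only: exp_sum of_real_prod)
    have "norm (E I (\<lambda>x. cis (\<theta> * L x)) - of_real (exp (- (\<theta>\<^sup>2 * SL / 2))))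
      \<le> (\<Sum>e\<in>I. norm (E I (\<lambda>x. cis (\<theta> * c {e} * \<zeta> (x e))) - of_real (exp (- (var * (\<theta> * c {e})\<^sup>2 / 2)))))"
      unfolding eq1 eq2
    proof (rule norm_prod_diff)
      fix e assume "e \<in> I"
      show "norm (E I (\<lambda>x. cis (\<theta> * c {e} * \<zeta> (x e)))) \<le> 1" by (rule norm_pexp_bound) (use assms(1) in auto)
      show "norm (complex_of_real (exp (- (var * (\<theta> * c {e})\<^sup>2 / 2)))) \<le> 1"
        unfolding norm_of_real using var_nonneg by simp
    qed
    also have "\<dots> \<le> (\<Sum>e\<in>I. 2 * \<bar>\<theta> * c {e}\<bar> ^ 3)" by (intro sum_mono char_single assms(1))
    also have "\<dots> = 2 * \<bar>\<theta>\<bar> ^ 3 * (\<Sum>e\<in>I. \<bar>c {e}\<bar> ^ 3)"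
      by (simp add: sum_distrib_left abs_mult power_mult_distrib mult_ac)
    finally show ?thesis .
  qed
  have 3: "norm (complex_of_real (exp (- (\<theta>\<^sup>2 * SL / 2))) - of_real (exp (- (\<theta>\<^sup>2 * S / 2)))) \<le> \<theta>\<^sup>2 * V / 2"
  proof -
    have "\<bar>exp (- (\<theta>\<^sup>2 * SL / 2)) - exp (- (\<theta>\<^sup>2 * S / 2))\<bar> \<le> \<theta>\<^sup>2 * S / 2 - \<theta>\<^sup>2 * SL / 2"
    proof (rule exp_minus_diff_le)
      show "0 \<le> \<theta>\<^sup>2 * SL / 2" using SL0 by simp
      show "\<theta>\<^sup>2 * SL / 2 \<le> \<theta>\<^sup>2 * S / 2" using SSL V2 by (intro divide_right_mono mult_left_mono) auto
    qed
    also have "\<dots> = \<theta>\<^sup>2 * V2 / 2" by (simp add: SSL algebra_simps add_divide_distrib)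
    also have "\<dots> \<le> \<theta>\<^sup>2 * V / 2" using V2 by (intro divide_right_mono mult_left_mono) auto
    finally show ?thesis unfolding of_real_diff[symmetric] norm_of_real .
  qed
  have "norm (E I (\<lambda>x. cis (\<theta> * (L x + Q x))) - of_real (exp (- (\<theta>\<^sup>2 * S / 2)))) \<le>
    (\<bar>\<theta>\<bar> * sqrt V + 2 * \<bar>\<theta>\<bar> ^ 3 * (\<Sum>e\<in>I. \<bar>c {e}\<bar> ^ 3)) + \<theta>\<^sup>2 * V / 2"
    using norm_triangle_mono[OF norm_triangle_mono[OF 1 2] 3] by simp
  then show ?thesis unfolding XLQ .
qed

lemma centred_moment:
  assumes "finite I" "k \<ge> 1" "\<delta> > 0"
  shows "E I (\<lambda>x. (pol \<zeta> I c x - c {}) ^ (2 * k)) \<le> (\<delta> + (\<Sum>F\<in>Pow I - {{}}. (4 ^ (k + 1)) ^ card F * (c F)\<^sup>2)) ^ k"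
    and "E I (\<lambda>x. (pol \<zeta> I c x - c {})\<^sup>2) = (\<Sum>F\<in>Pow I - {{}}. var ^ card F * (c F)\<^sup>2)"
proof -
  define c' where "c' F = (if F = {} then 0 else c F)" for F
  have eq: "pol \<zeta> I c x - c {} = pol \<zeta> I c' x" for x
  proof -
    have "pol \<zeta> I c x = c {} * mon \<zeta> {} x + (\<Sum>F\<in>Pow I - {{}}. c F * mon \<zeta> F x)"
      unfolding pol_def using assms(1) by (intro sum.remove) auto
    moreover have "pol \<zeta> I c' x = (\<Sum>F\<in>Pow I - {{}}. c F * mon \<zeta> F x)"
      unfolding pol_def using assms(1) by (intro sum.mono_neutral_cong_right) (auto simp: c'_def)
    ultimately show ?thesis by (simp add: mon_def)
  qed
  have s: "(\<Sum>F\<in>Pow I. t ^ card F * (c' F)\<^sup>2) = (\<Sum>F\<in>Pow I - {{}}. t ^ card F * (c F)\<^sup>2)" for t :: real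
    using assms(1) by (intro sum.mono_neutral_cong_right) (auto simp: c'_def)
  show "E I (\<lambda>x. (pol \<zeta> I c x - c {}) ^ (2 * k)) \<le> (\<delta> + (\<Sum>F\<in>Pow I - {{}}. (4 ^ (k + 1)) ^ card F * (c F)\<^sup>2)) ^ k"
    unfolding eq s[symmetric] by (rule hypercontractivity) fact+
  show "E I (\<lambda>x. (pol \<zeta> I c x - c {})\<^sup>2) = (\<Sum>F\<in>Pow I - {{}}. var ^ card F * (c F)\<^sup>2)"
    unfolding eq s[symmetric] by (rule pexp_pol_square) fact
qed

end

section \<open>Size of the coefficients\<close>

lemma card_all_edges: "card (all_edges n) = n choose 2"
  unfolding all_edges_def using n_subsets[of "{..<n}" 2] by simp

context connected_pattern
begin

definition "V_const = real v * 2 ^ (2 ^ v) * (2 ^ (2 ^ v))\<^sup>2"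
definition "sg2 n p = (\<Sum>F\<in>Pow (all_edges n) - {{}}. (p * (1 - p)) ^ card F * (coef n p F)\<^sup>2)"

text \<open>Two different edges span at least 3 vertices. On t vertices there are at most a constant
  times n^t edge sets, with squared coefficients of order n^(2(v-t)); the total n^(2v-t) is
  therefore at least a factor n below n^(2v-2), the order of the variance.\<close>

lemma sum_high_le:
  assumes p: "0 \<le> p" "p \<le> 1" and n: "n \<ge> 1"
  shows "(\<Sum>F\<in>{F\<in>Pow (all_edges n). card F \<ge> 2}. (coef n p F)\<^sup>2) \<le> V_const * real n ^ (2 * v - 3)"
proof -
  let ?H = "{F\<in>Pow (all_edges n). card F \<ge> 2 \<and> coef n p F \<noteq> 0}"
  define A0 where "A0 = (2 ^ (2 ^ v) :: real)"
  have A0: "0 \<le> A0" by (simp add: A0_def)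
  have finH: "finite ?H" by (rule finite_subset[of _ "Pow (all_edges n)"]) auto
  have range: "card (\<Union>F) \<in> {3..v}" if F: "F \<in> ?H" for F
  proof -
    have nz: "card (\<Union>F) \<le> v" "\<Union>F \<subseteq> {..<n}" using coef_nonzero_card[of n p F] F by auto
    have "\<not> card F \<le> 1" using F by auto
    moreover have "finite F" using F by (metis (mono_tags, lifting) PowD finite_all_edges finite_subset mem_Collect_eq)
    ultimately obtain e e' where e: "e \<in> F" "e' \<in> F" "e \<noteq> e'" by (metis One_nat_def card_le_Suc0_iff_eq)
    have ce: "card e = 2" "card e' = 2" using e F by (auto simp: all_edges_def)
    have fU: "finite (\<Union>F)" using nz(2) finite_subset by auto
    have "\<not> e' \<subseteq> e" using ce e(3) by (metis card_subset_eq card.infinite zero_neq_numeral)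
    then obtain x where x: "x \<in> e'" "x \<notin> e" by auto
    have "finite e" using ce by (metis card.infinite zero_neq_numeral)
    then have "card (insert x e) = 3" using x ce by simp
    moreover have "insert x e \<subseteq> \<Union>F" using e x by auto
    ultimately have "3 \<le> card (\<Union>F)" using card_mono[OF fU] by metis
    then show ?thesis using nz by simp
  qed
  have "(\<Sum>F\<in>{F\<in>Pow (all_edges n). card F \<ge> 2}. (coef n p F)\<^sup>2) = (\<Sum>F\<in>?H. (coef n p F)\<^sup>2)"
    by (rule sum.mono_neutral_right) (auto intro: finite_subset[of _ "Pow (all_edges n)"])
  also have "\<dots> = (\<Sum>t\<in>{3..v}. \<Sum>F\<in>{F\<in>?H. card (\<Union>F) = t}. (coef n p F)\<^sup>2)"
    using finH range by (intro sum.group[symmetric]) auto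
  also have "\<dots> \<le> (\<Sum>t\<in>{3..v}. A0 * A0\<^sup>2 * real n ^ (2 * v - 3))"
  proof (rule sum_mono)
    fix t assume t: "t \<in> {3..v}"
    let ?B = "{F\<in>?H. card (\<Union>F) = t}"
    let ?S = "{A. A \<subseteq> {..<n} \<and> card A = t \<and> {} \<subseteq> A}"
    have finS: "finite ?S" by (rule finite_subset[of _ "Pow {..<n}"]) auto
    have cB: "card ?B \<le> n ^ t * 2 ^ (2 ^ v)"
    proof -
      have "?B \<subseteq> (\<Union>A\<in>?S. Pow (Pow A))"
      proof
        fix F assume F: "F \<in> ?B"
        then have "\<Union>F \<in> ?S" using coef_nonzero_card[of n p F] by auto
        then show "F \<in> (\<Union>A\<in>?S. Pow (Pow A))" by blast
      qed
      moreover have "finite (Pow (Pow A))" if "A \<in> ?S" for A using that finite_subset[of A "{..<n}"] by auto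
      then have "finite (\<Union>A\<in>?S. Pow (Pow A))" using finS by blast
      ultimately have "card ?B \<le> card (\<Union>A\<in>?S. Pow (Pow A))" by (rule card_mono[rotated])
      also have "\<dots> \<le> (\<Sum>A\<in>?S. card (Pow (Pow A)))" by (rule card_UN_le) (rule finS)
      also have "\<dots> \<le> (\<Sum>A\<in>?S. 2 ^ (2 ^ v))"
      proof (rule sum_mono)
        fix A assume "A \<in> ?S"
        then have "finite A" "card A = t" using finite_subset[of A "{..<n}"] by auto
        then show "card (Pow (Pow A)) \<le> 2 ^ (2 ^ v)" using t by (simp add: card_Pow power_increasing)
      qed
      also have "\<dots> = card ?S * 2 ^ (2 ^ v)" by simp
      also have "\<dots> \<le> n ^ t * 2 ^ (2 ^ v)"
        using card_supersets_le[of "{..<n}" "{}" t] by (intro mult_right_mono) auto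
      finally show ?thesis .
    qed
    have "(\<Sum>F\<in>?B. (coef n p F)\<^sup>2) \<le> (\<Sum>F\<in>?B. (A0 * real n ^ (v - t))\<^sup>2)"
    proof (rule sum_mono)
      fix F assume "F \<in> ?B"
      then have "coef n p F \<le> A0 * real n ^ (v - t)" using coef_le[OF p, of n F] by (simp add: A0_def)
      then show "(coef n p F)\<^sup>2 \<le> (A0 * real n ^ (v - t))\<^sup>2"
        using coef_nonneg[OF p(1), of n F] by (intro power_mono) auto
    qed
    also have "\<dots> = real (card ?B) * (A0 * real n ^ (v - t))\<^sup>2" by simp
    also have "\<dots> \<le> real (n ^ t * 2 ^ (2 ^ v)) * (A0 * real n ^ (v - t))\<^sup>2"
      by (intro mult_right_mono of_nat_mono cB) auto
    also have "\<dots> = A0 * A0\<^sup>2 * (real n ^ t * (real n ^ (v - t))\<^sup>2)"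
      by (simp add: A0_def power_mult_distrib mult_ac)
    also have "real n ^ t * (real n ^ (v - t))\<^sup>2 = real n ^ (t + (v - t) * 2)"
      by (simp only: power_add power_mult)
    also have "A0 * A0\<^sup>2 * real n ^ (t + (v - t) * 2) \<le> A0 * A0\<^sup>2 * real n ^ (2 * v - 3)"
      using t n A0 by (intro mult_left_mono power_increasing) auto
    finally show "(\<Sum>F\<in>?B. (coef n p F)\<^sup>2) \<le> A0 * A0\<^sup>2 * real n ^ (2 * v - 3)" .
  qed
  also have "\<dots> = real (card {3..v}) * (A0 * A0\<^sup>2 * real n ^ (2 * v - 3))" by simp
  also have "\<dots> \<le> real v * (A0 * A0\<^sup>2 * real n ^ (2 * v - 3))"
    using A0 by (intro mult_right_mono) auto
  finally show ?thesis by (simp add: V_const_def A0_def mult_ac)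
qed

lemma coef_edge:
  assumes p: "0 < lam" "lam < p" "p < 1 - lam" and e: "e \<in> all_edges n"
  shows "coef n p {e} \<le> 2 ^ (2 ^ v) * real n ^ (v - 2)"
    and "n \<ge> 2 * v \<Longrightarrow> lam ^ d * (1 / (2 * real v)) ^ v * real n ^ (v - 2) \<le> coef n p {e}"
proof -
  have ce: "card e = 2" "e \<subseteq> {..<n}" using e by (auto simp: all_edges_def)
  show "coef n p {e} \<le> 2 ^ (2 ^ v) * real n ^ (v - 2)" using coef_le[of p n "{e}"] p ce by simp
  assume n: "n \<ge> 2 * v"
  obtain g where g: "g \<in> EH" using EH_nonempty by auto
  have cg: "card g = 2" "g \<subseteq> VH" using edge[OF g] by auto
  have fin: "finite g" "finite e" using cg ce by (metis card.infinite zero_neq_numeral)+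
  obtain f where f: "bij_betw f g e" using finite_same_card_bij[OF fin] cg ce by auto
  \<comment> \<open>A pair of vertices spans at most one edge, so the lower bound for partial
    embeddings applies with the single edge \<open>g\<close> as the embedded set.\<close>
  have sub: "{g' \<in> EH. g' \<subseteq> g} = {g}"
  proof
    show "{g' \<in> EH. g' \<subseteq> g} \<subseteq> {g}"
    proof
      fix g' assume "g' \<in> {g' \<in> EH. g' \<subseteq> g}"
      then have "g' \<subseteq> g" "card g' = card g" using edge[of g'] cg by auto
      then show "g' \<in> {g}" using card_subset_eq[OF fin(1)] by auto
    qed
  qed (use g in auto)
  have "(real n / (2 * real v)) ^ (v - card g) \<le> real (deg n {e})"
  proof (rule deg_ge[OF cg(2) _ _ n])
    show "inj_on f g" "f ` g \<subseteq> {..<n}" using f ce by (auto simp: bij_betw_def)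
    show "{e} = (\<lambda>e. f ` e) ` {g' \<in> EH. g' \<subseteq> g}" unfolding sub using f by (simp add: bij_betw_def)
  qed
  then have dg: "(real n / (2 * real v)) ^ (v - 2) \<le> real (deg n {e})" using cg by simp
  have v2: "2 \<le> v" by (rule v_ge_2)
  have "lam ^ d * (1 / (2 * real v)) ^ v * real n ^ (v - 2) \<le> lam ^ d * (1 / (2 * real v)) ^ (v - 2) * real n ^ (v - 2)"
    using v2 p by (intro mult_right_mono mult_left_mono power_decreasing) auto
  also have "\<dots> = (real n / (2 * real v)) ^ (v - 2) * lam ^ d" by (simp add: power_divide power_one_over)
  also have "\<dots> \<le> real (deg n {e}) * p ^ (d - card {e})"
  proof (intro mult_mono dg)
    have "lam ^ d \<le> lam ^ (d - card {e})" using p by (intro power_decreasing) auto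
    also have "\<dots> \<le> p ^ (d - card {e})" using p by (intro power_mono) auto
    finally show "lam ^ d \<le> p ^ (d - card {e})" .
  qed (use p in auto)
  finally show "lam ^ d * (1 / (2 * real v)) ^ v * real n ^ (v - 2) \<le> coef n p {e}" by (simp add: coef_def)
qed

lemma pq_bounds:
  fixes lam p :: real
  assumes p: "0 < lam" "lam < p" "p < 1 - lam"
  shows "lam / 2 \<le> p * (1 - p)" "p * (1 - p) \<le> 1"
proof -
  have "0 \<le> (p - lam) * (1 - lam - p)" using p by (intro mult_nonneg_nonneg) auto
  then have "lam * (1 - lam) \<le> p * (1 - p)" by (simp add: algebra_simps)
  moreover have "lam * (1 / 2) \<le> lam * (1 - lam)" using p by (intro mult_left_mono) auto
  ultimately show "lam / 2 \<le> p * (1 - p)" by linarith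
  show "p * (1 - p) \<le> 1" using p mult_mono[of p 1 "1 - p" 1] by simp
qed

lemma sg2_le:
  assumes p: "0 < lam" "lam < p" "p < 1 - lam" and n: "n \<ge> 1"
  shows "sg2 n p \<le> ((2 ^ (2 ^ v))\<^sup>2 + V_const) * real n ^ (2 * v - 2)"
proof -
  interpret spread "bern p" "cbern p" by (rule spread_bern) (use p in auto)
  have v2: "2 \<le> v" by (rule v_ge_2)
  have pq: "0 \<le> p * (1 - p)" "p * (1 - p) \<le> 1" using pq_bounds[OF p] p by auto
  have V0: "0 \<le> V_const" by (simp add: V_const_def)
  have "sg2 n p \<le> (\<Sum>F\<in>Pow (all_edges n) - {{}}. 1 * (coef n p F)\<^sup>2)"
    unfolding sg2_def using pq by (intro sum_mono mult_right_mono power_le_one) auto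
  also have "\<dots> = (\<Sum>e\<in>all_edges n. (coef n p {e})\<^sup>2) + (\<Sum>F\<in>{F\<in>Pow (all_edges n). card F \<ge> 2}. (coef n p F)\<^sup>2)"
    using sum_split_linear[of "all_edges n" "\<lambda>F. (coef n p F)\<^sup>2"] by simp
  also have "\<dots> \<le> (2 ^ (2 ^ v))\<^sup>2 * real n ^ (2 * v - 2) + V_const * real n ^ (2 * v - 2)"
  proof (rule add_mono)
    have "(\<Sum>e\<in>all_edges n. (coef n p {e})\<^sup>2) \<le> (\<Sum>e\<in>all_edges n. (2 ^ (2 ^ v) * real n ^ (v - 2))\<^sup>2)"
      using coef_edge(1)[OF p] coef_nonneg[of p n] p by (intro sum_mono power_mono) auto
    also have "\<dots> = real (card (all_edges n)) * (2 ^ (2 ^ v) * real n ^ (v - 2))\<^sup>2" by simp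
    also have "\<dots> \<le> real n ^ 2 * (2 ^ (2 ^ v) * real n ^ (v - 2))\<^sup>2"
    proof (intro mult_right_mono)
      have "card (all_edges n) \<le> n ^ 2" unfolding card_all_edges
        by (cases "2 \<le> n") (simp_all add: binomial_le_pow binomial_eq_0)
      then have "real (card (all_edges n)) \<le> real (n ^ 2)" by (rule of_nat_mono)
      then show "real (card (all_edges n)) \<le> real n ^ 2" by simp
    qed simp
    also have "\<dots> = (2 ^ (2 ^ v))\<^sup>2 * real n ^ (2 + (v - 2) * 2)"
    proof -
      have "real n ^ (2 + (v - 2) * 2) = real n ^ 2 * (real n ^ (v - 2))\<^sup>2" by (simp only: power_add power_mult)
      then show ?thesis by (simp add: power_mult_distrib)
    qed
    also have "2 + (v - 2) * 2 = 2 * v - 2" using v2 by simp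
    finally show "(\<Sum>e\<in>all_edges n. (coef n p {e})\<^sup>2) \<le> (2 ^ (2 ^ v))\<^sup>2 * real n ^ (2 * v - 2)" .
    have "(\<Sum>F\<in>{F\<in>Pow (all_edges n). card F \<ge> 2}. (coef n p F)\<^sup>2) \<le> V_const * real n ^ (2 * v - 3)"
      using p n by (intro sum_high_le) auto
    also have "\<dots> \<le> V_const * real n ^ (2 * v - 2)" using V0 n by (intro mult_left_mono power_increasing) auto
    finally show "(\<Sum>F\<in>{F\<in>Pow (all_edges n). card F \<ge> 2}. (coef n p F)\<^sup>2) \<le> V_const * real n ^ (2 * v - 2)" .
  qed
  finally show ?thesis by (simp add: algebra_simps)
qed

text \<open>Single edges alone reach the order n^(2v-2): there are at least (n / 2)^2 of them, each
  with squared coefficient of order n^(2v-4).\<close>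

lemma sg2_ge:
  assumes p: "0 < lam" "lam < p" "p < 1 - lam" and n: "n \<ge> 2 * v"
  shows "lam / 8 * (lam ^ d * (1 / (2 * real v)) ^ v)\<^sup>2 * real n ^ (2 * v - 2) \<le> sg2 n p"
proof -
  interpret spread "bern p" "cbern p" by (rule spread_bern) (use p in auto)
  define a where "a = lam ^ d * (1 / (2 * real v)) ^ v"
  have a0: "0 \<le> a" using p by (simp add: a_def)
  have v2: "2 \<le> v" by (rule v_ge_2)
  have pq: "0 \<le> p * (1 - p)" "lam / 2 \<le> p * (1 - p)" using pq_bounds[OF p] p by auto
  have c2: "(real n / 2) ^ 2 \<le> real (card (all_edges n))"
    unfolding card_all_edges using binomial_ge_n_over_k_pow_k[of 2 n, where 'a = real] n v2 by simp
  have "lam / 8 * a\<^sup>2 * real n ^ (2 * v - 2) = (real n / 2) ^ 2 * ((lam / 2) * (a * real n ^ (v - 2))\<^sup>2)"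
  proof -
    have "2 * v - 2 = 2 + (v - 2) * 2" using v2 by simp
    then have "real n ^ (2 * v - 2) = real n ^ 2 * (real n ^ (v - 2))\<^sup>2" by (simp only: power_add power_mult)
    then show ?thesis by (simp add: power_mult_distrib power_divide)
  qed
  also have "\<dots> \<le> real (card (all_edges n)) * ((lam / 2) * (a * real n ^ (v - 2))\<^sup>2)"
    using c2 p by (intro mult_right_mono) auto
  also have "\<dots> = (\<Sum>e\<in>all_edges n. (lam / 2) * (a * real n ^ (v - 2))\<^sup>2)" by simp
  also have "\<dots> \<le> (\<Sum>e\<in>all_edges n. (p * (1 - p)) ^ card {e} * (coef n p {e})\<^sup>2)"
  proof (rule sum_mono)
    fix e assume "e \<in> all_edges n"
    then show "(lam / 2) * (a * real n ^ (v - 2))\<^sup>2 \<le> (p * (1 - p)) ^ card {e} * (coef n p {e})\<^sup>2"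
      using coef_edge(2)[OF p _ n] pq a0 p by (intro mult_mono power_mono) (auto simp: a_def)
  qed
  also have "\<dots> \<le> sg2 n p"
    unfolding sg2_def using pq(1)
    by (subst sum_split_linear) (auto intro!: sum_nonneg)
  finally show ?thesis unfolding a_def .
qed

end

section \<open>The local limit theorem\<close>

lemma frac_le_cross: "x / y \<le> z / w" if "0 < y" "0 < w" "x * w \<le> z * y" for x :: real
proof (rule mult_imp_div_pos_le[OF that(1)])
  have "x \<le> (z * y) / w" by (rule mult_imp_le_div_pos[OF that(2,3)])
  then show "x \<le> z / w * y" by simp
qed

lemma one_plus_square_pos: "0 < 1 + (x::real)\<^sup>2"
  using zero_le_power2[of x] by linarith

text \<open>Telescoping: with M = N + 1 the two new terms are together at most 4 / M - 4 / (M +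
  1).\<close>

lemma sum_lattice_symmetric_le: "(\<Sum>j\<in>{- int N..int N}. 1 / (1 + (real_of_int j)\<^sup>2)) \<le> 7 - 4 / (real N + 1)"
proof (induction N)
  case (Suc N)
  let ?f = "\<lambda>j::int. 1 / (1 + (real_of_int j)\<^sup>2)"
  have "{- int (Suc N)..int (Suc N)} = insert (- int (Suc N)) (insert (int (Suc N)) {- int N..int N})" by auto
  then have "(\<Sum>j\<in>{- int (Suc N)..int (Suc N)}. ?f j) = ?f (- int (Suc N)) + (?f (int (Suc N)) + (\<Sum>j\<in>{- int N..int N}. ?f j))"
    by (simp del: of_nat_Suc)
  moreover have "real_of_int (int (Suc N)) = real N + 1" by simp
  ultimately have "(\<Sum>j\<in>{- int (Suc N)..int (Suc N)}. ?f j) = 2 * (1 / (1 + (real N + 1)\<^sup>2)) + (\<Sum>j\<in>{- int N..int N}. ?f j)"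
    by (simp only: of_int_minus power2_minus)
  also have "\<dots> \<le> 2 * (1 / (1 + (real N + 1)\<^sup>2)) + (7 - 4 / (real N + 1))" using Suc by simp
  also have "\<dots> \<le> 7 - 4 / (real (Suc N) + 1)"
  proof -
    define M where "M = real N + 1"
    have M: "0 < M" by (simp add: M_def)
    have "2 * (M * (M + 1)) \<le> 4 * (1 + M\<^sup>2)"
    proof -
      have "0 \<le> (M - 1)\<^sup>2" by simp
      then have "2 * M \<le> M\<^sup>2 + 1" by (simp add: power2_diff)
      then have "2 * M + 2 * M\<^sup>2 \<le> 4 + 4 * M\<^sup>2" using zero_le_power2[of M] by linarith
      then show ?thesis by (simp add: power2_eq_square algebra_simps)
    qed
    then have "2 / (1 + M\<^sup>2) \<le> 4 / (M * (M + 1))"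
      using M by (intro frac_le_cross one_plus_square_pos) auto
    also have "\<dots> = 4 / M - 4 / (M + 1)" using M by (simp add: field_simps)
    finally show ?thesis by (simp add: M_def add_ac)
  qed
  finally show ?case .
qed simp

text \<open>Moving the centre to the integer below \<mu> costs a factor 3, whence 21 = 3 * 7,
  uniformly in \<mu>.\<close>

lemma sum_lattice_le:
  assumes "finite (F :: int set)"
  shows "(\<Sum>k\<in>F. 1 / (1 + (real_of_int k - \<mu>)\<^sup>2)) \<le> 21"
proof -
  define m where "m = \<lfloor>\<mu>\<rfloor>"
  define N where "N = nat (Max (insert 0 ((\<lambda>k. \<bar>k - m\<bar>) ` F)))"
  have N: "\<bar>k - m\<bar> \<le> int N" if "k \<in> F" for k
  proof -
    have "\<bar>k - m\<bar> \<le> Max (insert 0 ((\<lambda>k. \<bar>k - m\<bar>) ` F))" using assms that by (intro Max_ge) auto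
    then show ?thesis unfolding N_def by linarith
  qed
  have "(\<Sum>k\<in>F. 1 / (1 + (real_of_int k - \<mu>)\<^sup>2)) \<le> (\<Sum>k\<in>F. 3 * (1 / (1 + (real_of_int (k - m))\<^sup>2)))"
  proof (rule sum_mono)
    fix k
    define a b where "a = real_of_int k - \<mu>" and "b = real_of_int (k - m)"
    have "\<bar>b - a\<bar> \<le> 1" unfolding a_def b_def m_def of_int_diff by linarith
    then have "(b - a)\<^sup>2 \<le> 1" by (simp add: abs_square_le_1)
    moreover have "b\<^sup>2 = (b - a)\<^sup>2 + 2 * (a * (b - a)) + a\<^sup>2" by (simp add: power2_eq_square algebra_simps)
    moreover have "2 * (a * (b - a)) \<le> a\<^sup>2 + (b - a)\<^sup>2" using sum_squares_bound[of a "b - a"] by (simp only: mult.assoc)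
    ultimately have "b\<^sup>2 \<le> 2 * a\<^sup>2 + 2" by linarith
    then have "1 + b\<^sup>2 \<le> 3 * (1 + a\<^sup>2)" using zero_le_power2[of a] unfolding distrib_left by linarith
    then have "1 / (1 + a\<^sup>2) \<le> 3 / (1 + b\<^sup>2)"
      by (intro frac_le_cross one_plus_square_pos) simp
    then show "1 / (1 + (real_of_int k - \<mu>)\<^sup>2) \<le> 3 * (1 / (1 + (real_of_int (k - m))\<^sup>2))"
      unfolding a_def b_def by simp
  qed
  also have "\<dots> = 3 * (\<Sum>k\<in>F. 1 / (1 + (real_of_int (k - m))\<^sup>2))" by (simp add: sum_distrib_left)
  also have "(\<Sum>k\<in>F. 1 / (1 + (real_of_int (k - m))\<^sup>2)) = (\<Sum>j\<in>(\<lambda>k. k - m) ` F. 1 / (1 + (real_of_int j)\<^sup>2))"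
    by (subst sum.reindex) (auto simp: inj_on_def)
  also have "\<dots> \<le> (\<Sum>j\<in>{- int N..int N}. 1 / (1 + (real_of_int j)\<^sup>2))"
    by (intro sum_mono2) (auto dest!: N simp: abs_le_iff)
  also have "\<dots> \<le> 7 - 4 / (real N + 1)" by (rule sum_lattice_symmetric_le)
  also have "\<dots> \<le> 7" by simp
  finally show ?thesis by simp
qed

lemma card_lattice_interval:
  assumes "0 \<le> r"
  shows "finite {k::int. \<bar>real_of_int k - \<mu>\<bar> \<le> r}" "real (card {k::int. \<bar>real_of_int k - \<mu>\<bar> \<le> r}) \<le> 2 * r + 1"
proof -
  have sub: "{k::int. \<bar>real_of_int k - \<mu>\<bar> \<le> r} \<subseteq> {\<lceil>\<mu> - r\<rceil>..\<lfloor>\<mu> + r\<rfloor>}"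
    by (auto simp: ceiling_le_iff le_floor_iff abs_le_iff)
  then show "finite {k::int. \<bar>real_of_int k - \<mu>\<bar> \<le> r}" by (rule finite_subset) simp
  have "card {k::int. \<bar>real_of_int k - \<mu>\<bar> \<le> r} \<le> card {\<lceil>\<mu> - r\<rceil>..\<lfloor>\<mu> + r\<rfloor>}" using sub by (intro card_mono) auto
  also have "\<dots> = nat (\<lfloor>\<mu> + r\<rfloor> - \<lceil>\<mu> - r\<rceil> + 1)" by simp
  finally have "real (card {k::int. \<bar>real_of_int k - \<mu>\<bar> \<le> r}) \<le> real (nat (\<lfloor>\<mu> + r\<rfloor> - \<lceil>\<mu> - r\<rceil> + 1))" by (rule of_nat_mono)
  also have "\<dots> \<le> max 0 (real_of_int (\<lfloor>\<mu> + r\<rfloor> - \<lceil>\<mu> - r\<rceil> + 1))" by linarith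
  also have "\<dots> \<le> 2 * r + 1"
    using of_int_floor_le[of "\<mu> + r"] le_of_int_ceiling[of "\<mu> - r"] assms by (simp only: max.bounded_iff of_int_add of_int_diff of_int_1) linarith
  finally show "real (card {k::int. \<bar>real_of_int k - \<mu>\<bar> \<le> r}) \<le> 2 * r + 1" .
qed

text \<open>Half of the exponent supplies the tail factor, the other half a factor that is summable
  over the lattice.\<close>

lemma std_normal_density_le:
  "std_normal_density z \<le> 1" "std_normal_density z \<le> exp (- (a\<^sup>2 / 4)) * (4 / (1 + z\<^sup>2))" if "\<bar>a\<bar> \<le> \<bar>z\<bar>"
proof -
  have sq: "1 \<le> sqrt (2 * pi)" using pi_gt3 by simp
  have e: "std_normal_density z \<le> exp (- (z\<^sup>2 / 2))"
    unfolding std_normal_density_def using mult_right_mono[of "1 / sqrt (2 * pi)" 1 "exp (- z\<^sup>2 / 2)"] sq by simp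
  then show "std_normal_density z \<le> 1" by (rule order_trans) simp
  have az: "a\<^sup>2 \<le> z\<^sup>2" using that by (simp add: abs_le_square_iff)
  have "exp (- (z\<^sup>2 / 2)) = exp (- (z\<^sup>2 / 4)) * exp (- (z\<^sup>2 / 4))" by (simp add: exp_add[symmetric])
  also have "\<dots> \<le> exp (- (a\<^sup>2 / 4)) * (4 / (1 + z\<^sup>2))"
  proof (rule mult_mono)
    have "1 + z\<^sup>2 / 4 \<le> exp (z\<^sup>2 / 4)" by (rule exp_ge_add_one_self)
    moreover have "(1 + z\<^sup>2) / 4 \<le> 1 + z\<^sup>2 / 4" by (simp add: add_divide_distrib)
    ultimately have "(1 + z\<^sup>2) / 4 \<le> exp (z\<^sup>2 / 4)" by (rule order_trans[rotated])
    then have "1 / exp (z\<^sup>2 / 4) \<le> 1 / ((1 + z\<^sup>2) / 4)" by (intro divide_left_mono mult_pos_pos divide_pos_pos one_plus_square_pos) auto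
    then show "exp (- (z\<^sup>2 / 4)) \<le> 4 / (1 + z\<^sup>2)" by (simp add: exp_minus inverse_eq_divide)
  qed (use az in auto)
  finally show "std_normal_density z \<le> exp (- (a\<^sup>2 / 4)) * (4 / (1 + z\<^sup>2))" using e by linarith
qed

section \<open>The distribution of the count\<close>

context connected_pattern
begin

definition "cnt n x = copies VH EH n {e \<in> all_edges n. x e}"
definition "mu n p = coef n p {}"
definition "sg n p = sqrt (sg2 n p)"
definition "Pr n p k = pexp (bern p) (all_edges n) (\<lambda>x. if int (cnt n x) = k then 1 else 0 :: real)"
text \<open>If the standard deviation is 0, division by zero makes the argument 0, so the value
  stays bounded in that case too.\<close>

definition "dn n p k = std_normal_density ((real_of_int k - mu n p) / sg n p)"

lemma cnt_pol: "real (cnt n x) = pol (cbern p) (all_edges n) (coef n p) x"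
  unfolding cnt_def by (rule copies_pol)

context
  fixes lam p :: real
  assumes p: "0 < lam" "lam < p" "p < 1 - lam"
begin

interpretation spread "bern p" "cbern p" by (rule spread_bern) (use p in auto)

lemma p01: "0 \<le> p" "p \<le> 1" using p by auto

lemma var_eq: "var = p * (1 - p)" by (rule var_bern[OF p01])

lemma mean_gnp: "measure_pmf.expectation (gnp n p) (\<lambda>E. real (copies VH EH n E)) = mu n p"
  unfolding expectation_gnp[OF p01] copies_pol[of n _ p] mu_def by (rule pexp_pol) simp

lemma sg2_eq: "sg2 n p = pexp (bern p) (all_edges n) (\<lambda>x. (real (cnt n x) - mu n p)\<^sup>2)"
  unfolding cnt_pol[of n _ p] mu_def centred_moment(2)[OF finite_all_edges order_refl zero_less_one] sg2_def var_eq ..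

lemma variance_gnp: "measure_pmf.variance (gnp n p) (\<lambda>E. real (copies VH EH n E)) = sg2 n p"
  unfolding mean_gnp unfolding expectation_gnp[OF p01] sg2_eq cnt_def ..

lemma prob_gnp: "measure_pmf.prob (gnp n p) {E. real (copies VH EH n E) = real_of_int k} = Pr n p k"
proof -
  have "measure_pmf.prob (gnp n p) {E. real (copies VH EH n E) = real_of_int k}
     = measure_pmf.expectation (gnp n p) (indicator {E. real (copies VH EH n E) = real_of_int k})" by simp
  also have "\<dots> = pexp (bern p) (all_edges n) (\<lambda>x. indicator {E. real (copies VH EH n E) = real_of_int k} {e \<in> all_edges n. x e})"
    by (rule expectation_gnp[OF p01])
  also have "\<dots> = Pr n p k"
    unfolding Pr_def
  proof (rule pexp_cong)
    fix x
    have "real (cnt n x) = real_of_int k \<longleftrightarrow> int (cnt n x) = k" by linarith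
    then show "indicator {E. real (copies VH EH n E) = real_of_int k} {e \<in> all_edges n. x e} = (if int (cnt n x) = k then 1 else 0 :: real)"
      by (simp add: indicator_def cnt_def)
  qed
  finally show ?thesis .
qed

lemma sum_Pr: "finite F \<Longrightarrow> (\<Sum>k\<in>F. Pr n p k) = pexp (bern p) (all_edges n) (\<lambda>x. if int (cnt n x) \<in> F then 1 else 0)"
  unfolding Pr_def pexp_sum[symmetric] by simp

lemma Pr_nonneg: "0 \<le> Pr n p k" unfolding Pr_def by (rule pexp_nonneg) simp

lemma sum_Pr_le_1: "finite F \<Longrightarrow> (\<Sum>k\<in>F. Pr n p k) \<le> 1"
proof -
  assume "finite F"
  then have "(\<Sum>k\<in>F. Pr n p k) \<le> pexp (bern p) (all_edges n) (\<lambda>x. 1)"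
    unfolding sum_Pr[OF \<open>finite F\<close>] by (intro pexp_mono) auto
  then show ?thesis by simp
qed

lemma dn_bounds: "0 \<le> dn n p k" "dn n p k \<le> 1"
  unfolding dn_def using std_normal_density_le(1)[of 0] by (auto intro: normal_density_nonneg)

lemma sg2_nonneg: "0 \<le> sg2 n p"
  unfolding sg2_eq by (rule pexp_nonneg) simp

lemma sg_nonneg: "0 \<le> sg n p" by (simp add: sg_def sg2_nonneg)

text \<open>If a copy exists, its full edge set has coefficient at least 1 and contributes at least
  (lam / 2)^d to the variance. If none exists, all coefficients vanish.\<close>

lemma sg_cases: "sg n p = 0 \<or> sqrt ((lam / 2) ^ d) \<le> sg n p"
proof (cases "KK n = {}")
  case True
  then have "sg2 n p = 0" by (simp add: sg2_def coef_def deg_def)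
  then show ?thesis by (simp add: sg_def)
next
  case False
  then obtain K where K: "K \<in> KK n" by auto
  have cK: "card K = d" "K \<subseteq> all_edges n" using KK_props[OF K] by auto
  then have Kne: "K \<noteq> {}" using d_pos by auto
  have "deg n K \<ge> card {K}" unfolding deg_def using K finite_KK[of n] by (intro card_mono) auto
  then have "deg n K \<ge> 1" by simp
  then have "1 \<le> coef n p K" using cK by (simp add: coef_def)
  then have "1\<^sup>2 \<le> (coef n p K)\<^sup>2" by (intro power_mono) auto
  moreover have "(lam / 2) ^ d \<le> (p * (1 - p)) ^ d" using pq_bounds[OF p] p by (intro power_mono) auto
  ultimately have "(lam / 2) ^ d * 1 \<le> (p * (1 - p)) ^ card K * (coef n p K)\<^sup>2"
    unfolding cK using p by (intro mult_mono) auto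
  also have "\<dots> \<le> sg2 n p"
    unfolding sg2_def using cK Kne p by (intro member_le_sum) auto
  finally show ?thesis unfolding sg_def by simp
qed

lemma sg_le:
  assumes n: "n \<ge> 1"
  shows "sg n p \<le> sqrt ((2 ^ (2 ^ v))\<^sup>2 + V_const) * real n ^ (v - 1)"
proof -
  have "sg n p \<le> sqrt (((2 ^ (2 ^ v))\<^sup>2 + V_const) * real n ^ (2 * v - 2))"
    unfolding sg_def using sg2_le[OF p n] by simp
  also have "real n ^ (2 * v - 2) = (real n ^ (v - 1))\<^sup>2"
  proof -
    have "2 * v - 2 = (v - 1) * 2" by simp
    then show ?thesis by (simp only: power_mult)
  qed
  finally show ?thesis by (simp add: real_sqrt_mult)
qed

text \<open>Returning from the normalised variable to the lattice costs 1 + \<sigma>^2, which is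
  polynomial in n and harmless against the exponential factor; 84 = 4 * 21. For \<sigma> = 0 every
  summand is a division by zero and vanishes.\<close>

lemma sum_dn_tail:
  assumes "finite F" and F: "\<And>k. k \<in> F \<Longrightarrow> a \<le> \<bar>(real_of_int k - mu n p) / sg n p\<bar>" and a: "0 \<le> a"
  shows "(\<Sum>k\<in>F. dn n p k / sg n p) \<le> 84 * exp (- (a\<^sup>2 / 4)) * (1 + (sg n p)\<^sup>2) / sqrt ((lam / 2) ^ d)"
proof (cases "sg n p = 0")
  case False
  define s where "s = sg n p"
  define s0 where "s0 = sqrt ((lam / 2) ^ d)"
  have s0: "0 < s0" "s0 \<le> s" using sg_cases False p by (auto simp: s0_def s_def)
  then have s: "0 < s" by linarith
  have "(\<Sum>k\<in>F. dn n p k / s) \<le> (\<Sum>k\<in>F. (exp (- (a\<^sup>2 / 4)) * 4 * (1 + s\<^sup>2) / s0) * (1 / (1 + (real_of_int k - mu n p)\<^sup>2)))"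
  proof (rule sum_mono)
    fix k assume k: "k \<in> F"
    define y where "y = real_of_int k - mu n p"
    define z where "z = y / s"
    have "a \<le> \<bar>z\<bar>" using F[OF k] by (simp add: z_def y_def s_def)
    then have "dn n p k \<le> exp (- (a\<^sup>2 / 4)) * (4 / (1 + z\<^sup>2))"
      using std_normal_density_le(2)[of a z] a by (simp add: dn_def z_def y_def s_def)
    also have "4 / (1 + z\<^sup>2) \<le> 4 * (1 + s\<^sup>2) / (1 + y\<^sup>2)"
    proof -
      have "s\<^sup>2 * z\<^sup>2 = y\<^sup>2" using s by (simp add: z_def power_divide)
      then have "1 + y\<^sup>2 \<le> (1 + s\<^sup>2) * (1 + z\<^sup>2)" by (simp add: algebra_simps)
      then have "4 * (1 + y\<^sup>2) \<le> 4 * ((1 + s\<^sup>2) * (1 + z\<^sup>2))" by (rule mult_left_mono) simp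
      then have "4 * (1 + y\<^sup>2) \<le> 4 * (1 + s\<^sup>2) * (1 + z\<^sup>2)" by (simp only: mult.assoc)
      then show ?thesis by (rule frac_le_cross[OF one_plus_square_pos one_plus_square_pos])
    qed
    finally have "dn n p k \<le> exp (- (a\<^sup>2 / 4)) * (4 * (1 + s\<^sup>2) / (1 + y\<^sup>2))" by (simp add: mult_left_mono)
    then have "dn n p k / s \<le> exp (- (a\<^sup>2 / 4)) * (4 * (1 + s\<^sup>2) / (1 + y\<^sup>2)) / s0"
      using s0 s dn_bounds by (intro frac_le) (auto intro!: divide_nonneg_nonneg mult_nonneg_nonneg)
    then show "dn n p k / s \<le> (exp (- (a\<^sup>2 / 4)) * 4 * (1 + s\<^sup>2) / s0) * (1 / (1 + (real_of_int k - mu n p)\<^sup>2))"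
      unfolding y_def
      by (simp only: times_divide_eq_left times_divide_eq_right divide_divide_eq_left mult_1_right mult.assoc mult.commute mult.left_commute)
  qed
  also have "\<dots> = (exp (- (a\<^sup>2 / 4)) * 4 * (1 + s\<^sup>2) / s0) * (\<Sum>k\<in>F. 1 / (1 + (real_of_int k - mu n p)\<^sup>2))"
    by (simp add: sum_distrib_left)
  also have "\<dots> \<le> (exp (- (a\<^sup>2 / 4)) * 4 * (1 + s\<^sup>2) / s0) * 21"
    using s0 by (intro mult_left_mono sum_lattice_le assms(1)) (auto intro!: divide_nonneg_nonneg mult_nonneg_nonneg)
  finally show ?thesis unfolding s_def s0_def by (simp add: mult_ac)
qed (use p in simp)

text \<open>Markov's inequality for the moment of order 2K. Hypercontractivity charges 4^(K+1) per
  variable where the variance has p (1 - p) \<ge> lam / 2; as the degree is at most d, the two sums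
  differ by at most (4^(K+1) * 2 / lam)^d.\<close>

lemma tail_bound:
  assumes K: "K \<ge> 1" and "finite F" and r: "0 < r" "0 < sg n p"
    and F: "\<And>k. k \<in> F \<Longrightarrow> sg n p * r < \<bar>real_of_int k - mu n p\<bar>"
  shows "(\<Sum>k\<in>F. Pr n p k) \<le> (1 + (4 ^ (K + 1) * (2 / lam)) ^ d) ^ K / r ^ (2 * K)"
proof -
  define s where "s = sg n p"
  define B where "B = (4 ^ (K + 1) * (2 / lam)) ^ d"
  have s: "0 < s" "s\<^sup>2 = sg2 n p" using r sg2_nonneg by (auto simp: s_def sg_def)
  have sr: "0 < (s * r) ^ (2 * K)" using s r by simp
  have pq: "lam / 2 \<le> p * (1 - p)" "0 < lam / 2" using pq_bounds[OF p] p by auto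
  have "(\<Sum>k\<in>F. Pr n p k) \<le> pexp (bern p) (all_edges n) (\<lambda>x. (1 / (s * r) ^ (2 * K)) * (pol (cbern p) (all_edges n) (coef n p) x - coef n p {}) ^ (2 * K))"
    unfolding sum_Pr[OF assms(2)]
  proof (rule pexp_mono)
    fix x
    define y where "y = real (cnt n x) - mu n p"
    have y: "pol (cbern p) (all_edges n) (coef n p) x - coef n p {} = y" by (simp add: y_def cnt_pol[of n x p] mu_def)
    have y0: "0 \<le> y ^ (2 * K)" by simp
    show "(if int (cnt n x) \<in> F then 1 else 0) \<le> (1 / (s * r) ^ (2 * K)) * (pol (cbern p) (all_edges n) (coef n p) x - coef n p {}) ^ (2 * K)"
    proof (cases "int (cnt n x) \<in> F")
      case True
      then have "s * r \<le> \<bar>y\<bar>" using F[OF True] by (simp add: s_def y_def)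
      then have "(s * r) ^ (2 * K) \<le> \<bar>y\<bar> ^ (2 * K)" using s r by (intro power_mono) auto
      then have "(s * r) ^ (2 * K) \<le> y ^ (2 * K)" by (simp add: power_even_abs)
      then show ?thesis unfolding y using sr True by (simp add: le_divide_eq)
    next
      case False
      then show ?thesis unfolding y using sr y0 by simp
    qed
  qed
  also have "\<dots> = (1 / (s * r) ^ (2 * K)) * pexp (bern p) (all_edges n) (\<lambda>x. (pol (cbern p) (all_edges n) (coef n p) x - coef n p {}) ^ (2 * K))"
    by (rule pexp_mult_left)
  also have "\<dots> \<le> (1 / (s * r) ^ (2 * K)) * (s\<^sup>2 * (1 + B)) ^ K"
  proof (intro mult_left_mono)
    \<comment> \<open>The free parameter is the variance itself, which gives the 1 in 1 + B.\<close>
    have "pexp (bern p) (all_edges n) (\<lambda>x. (pol (cbern p) (all_edges n) (coef n p) x - coef n p {}) ^ (2 * K))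
      \<le> (s\<^sup>2 + (\<Sum>F\<in>Pow (all_edges n) - {{}}. (4 ^ (K + 1)) ^ card F * (coef n p F)\<^sup>2)) ^ K"
      by (rule centred_moment(1)[OF finite_all_edges K zero_less_power[OF s(1)]])
    also have "\<dots> \<le> (s\<^sup>2 * (1 + B)) ^ K"
    proof (intro power_mono)
      have "(\<Sum>F\<in>Pow (all_edges n) - {{}}. (4 ^ (K + 1)) ^ card F * (coef n p F)\<^sup>2)
        \<le> (\<Sum>F\<in>Pow (all_edges n) - {{}}. B * ((p * (1 - p)) ^ card F * (coef n p F)\<^sup>2))"
      proof (rule sum_mono)
        fix F
        show "(4 ^ (K + 1)) ^ card F * (coef n p F)\<^sup>2 \<le> B * ((p * (1 - p)) ^ card F * (coef n p F)\<^sup>2)"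
        proof (cases "coef n p F = 0")
          case False
          then have cF: "card F \<le> d" using coef_nonzero_card by blast
          have "1 * 1 \<le> 4 ^ (K + 1) * (2 / lam)"
            using p by (intro mult_mono one_le_power) (auto simp: le_divide_eq)
          then have "(4 ^ (K + 1) * (2 / lam)) ^ card F \<le> B"
            unfolding B_def using cF by (intro power_increasing) auto
          then have "(4 ^ (K + 1) * (2 / lam)) ^ card F * (p * (1 - p)) ^ card F \<le> B * (p * (1 - p)) ^ card F"
            using pq by (intro mult_right_mono) auto
          moreover have "(4 ^ (K + 1)) ^ card F \<le> (4 ^ (K + 1) * (2 / lam)) ^ card F * (p * (1 - p)) ^ card F"
          proof -
            have "1 \<le> (2 / lam) * (p * (1 - p))" using pq p by (simp add: field_simps)
            then have "4 ^ (K + 1) * 1 \<le> 4 ^ (K + 1) * ((2 / lam) * (p * (1 - p)))" by (intro mult_left_mono) auto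
            then have "(4 ^ (K + 1)) ^ card F \<le> (4 ^ (K + 1) * (2 / lam) * (p * (1 - p))) ^ card F"
              by (intro power_mono) (simp_all add: mult.assoc)
            then show ?thesis by (simp only: power_mult_distrib)
          qed
          ultimately have "(4 ^ (K + 1)) ^ card F \<le> B * (p * (1 - p)) ^ card F" by linarith
          then have "(4 ^ (K + 1)) ^ card F * (coef n p F)\<^sup>2 \<le> B * (p * (1 - p)) ^ card F * (coef n p F)\<^sup>2"
            by (rule mult_right_mono) simp
          then show ?thesis by (simp only: mult.assoc)
        qed simp
      qed
      also have "\<dots> = B * s\<^sup>2" unfolding s(2) sg2_def by (simp add: sum_distrib_left)
      finally show "s\<^sup>2 + (\<Sum>F\<in>Pow (all_edges n) - {{}}. (4 ^ (K + 1)) ^ card F * (coef n p F)\<^sup>2) \<le> s\<^sup>2 * (1 + B)"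
        by (simp add: algebra_simps)
      show "0 \<le> s\<^sup>2 + (\<Sum>F\<in>Pow (all_edges n) - {{}}. (4 ^ (K + 1)) ^ card F * (coef n p F)\<^sup>2)"
        by (intro add_nonneg_nonneg sum_nonneg) auto
    qed
    finally show "pexp (bern p) (all_edges n) (\<lambda>x. (pol (cbern p) (all_edges n) (coef n p) x - coef n p {}) ^ (2 * K)) \<le> (s\<^sup>2 * (1 + B)) ^ K" .
  qed (use sr in simp)
  also have "\<dots> = (1 + B) ^ K / r ^ (2 * K)"
  proof -
    have "(s\<^sup>2) ^ K = s ^ (2 * K)" by (simp only: power_mult)
    then show ?thesis using s r by (simp add: power_mult_distrib)
  qed
  finally show ?thesis unfolding B_def .
qed

text \<open>With \<Theta> = n^(\<epsilon>-(v-1)) the product \<sigma> \<Theta> has order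
  n^\<epsilon>. It multiplies the comparison error n^(3\<epsilon>-1/2), which gives 4\<epsilon> -
  1/2, and makes the Gaussian tail beyond \<Theta> smaller than any power. Decay of order v leaves 1
  / n after multiplication by \<sigma>.\<close>

lemma pointwise_bound:
  assumes n: "n \<ge> 2 * v" and \<epsilon>: "0 < \<epsilon>" "\<epsilon> \<le> 1"
    and decay: "\<And>\<theta>. real n powr (\<epsilon> - (real v - 1)) \<le> \<bar>\<theta>\<bar> \<Longrightarrow> \<bar>\<theta>\<bar> \<le> pi \<Longrightarrow> norm (charf n p \<theta>) \<le> real n powr (- real v)"
    and ev: "exp (- (lam / 8 * (lam ^ d * (1 / (2 * real v)) ^ v)\<^sup>2 * real n powr (2 * \<epsilon>) / 4)) \<le> real n powr (- 1)"
    and C1: "C1 = sqrt V_const + 2 * (2 ^ (2 ^ v)) ^ 3 + V_const" and C2: "C2 = sqrt ((2 ^ (2 ^ v))\<^sup>2 + V_const)"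
  shows "\<bar>sg n p * Pr n p k - dn n p k\<bar> \<le> (C2 * C1 + C2 + 1) * real n powr (4 * \<epsilon> - 1 / 2)"
proof -
  define N where "N = real n"
  define s where "s = sg n p"
  define \<Theta> where "\<Theta> = N powr (\<epsilon> - (real v - 1))"
  have v2: "2 \<le> v" by (rule v_ge_2)
  have N1: "1 \<le> N" using n v2 by (simp add: N_def)
  have N0: "0 < N" using N1 by simp
  have Np: "N ^ j = N powr real j" for j using N0 by (rule powr_realpow[symmetric])
  have V0: "0 \<le> V_const" by (simp add: V_const_def)
  have C: "0 \<le> C1" "0 \<le> C2" using V0 by (auto simp: C1 C2)
  define c where "c = lam / 8 * (lam ^ d * (1 / (2 * real v)) ^ v)\<^sup>2"
  have c0: "0 < c" using p v2 by (simp add: c_def)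
  have s2: "c * N powr (2 * real v - 2) \<le> s\<^sup>2"
  proof -
    have "c * N ^ (2 * v - 2) \<le> sg2 n p" unfolding c_def N_def by (rule sg2_ge[OF p n])
    moreover have "s\<^sup>2 = sg2 n p" using sg2_nonneg by (simp add: s_def sg_def)
    moreover have "real (2 * v - 2) = 2 * real v - 2" using v2 by (simp add: of_nat_diff)
    ultimately show ?thesis by (simp add: Np)
  qed
  have "0 < c * N powr (2 * real v - 2)" using c0 N0 by simp
  then have "0 < s\<^sup>2" using s2 by linarith
  then have s0: "0 < s" using sg_nonneg[of n] by (simp add: s_def)
  have s_le: "s \<le> C2 * N powr (real v - 1)"
  proof -
    have "s \<le> C2 * N ^ (v - 1)" unfolding s_def C2 N_def using n v2 by (intro sg_le) auto
    then show ?thesis using v2 by (simp add: Np of_nat_diff)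
  qed
  have \<Theta>: "0 \<le> \<Theta>" "\<Theta> \<le> 1"
  proof -
    have "N powr (\<epsilon> - (real v - 1)) \<le> N powr 0" using N1 \<epsilon> v2 by (intro powr_mono) auto
    then show "\<Theta> \<le> 1" using N0 by (simp add: \<Theta>_def)
  qed (simp add: \<Theta>_def)
  define \<delta>1 where "\<delta>1 = C1 * N powr (3 * \<epsilon> - 1 / 2)"
  define \<delta>2 where "\<delta>2 = N powr (- real v)"
  have cnt: "of_int (int (cnt n x)) - mu n p = pol (cbern p) (all_edges n) (coef n p) x - coef n p {}" for x
    by (simp add: cnt_pol[of n x p] mu_def)
  have "\<bar>s * pexp (bern p) (all_edges n) (\<lambda>x. if int (cnt n x) = k then 1 else 0) - std_normal_density ((of_int k - mu n p) / s)\<bar>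
    \<le> s * \<Theta> * \<delta>1 + s * \<delta>2 + exp (- (s * \<Theta>)\<^sup>2 / 4)"
  proof (rule local_limit_bound[OF finite_all_edges s0 \<Theta>(1)])
    show "\<Theta> \<le> pi" using \<Theta>(2) pi_gt3 by linarith
    show "0 \<le> \<delta>1" "0 \<le> \<delta>2" using C by (auto simp: \<delta>1_def \<delta>2_def)
    fix \<theta> :: real assume \<theta>: "\<bar>\<theta>\<bar> \<le> \<Theta>"
    define V where "V = V_const * N ^ (2 * v - 3)"
    have V: "V = V_const * N powr (2 * real v - 3)" using v2 by (simp add: V_def Np of_nat_diff)
    have V00: "0 \<le> V" using V0 N0 by (simp add: V)
    have "norm (E (all_edges n) (\<lambda>x. cis (\<theta> * (pol (cbern p) (all_edges n) (coef n p) x - coef n p {}))) - of_real (exp (- (\<theta>\<^sup>2 * sg2 n p / 2))))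
      \<le> \<bar>\<theta>\<bar> * sqrt V + 2 * \<bar>\<theta>\<bar> ^ 3 * (\<Sum>e\<in>all_edges n. \<bar>coef n p {e}\<bar> ^ 3) + \<theta>\<^sup>2 * V / 2"
    proof (rule gaussian_comparison[OF finite_all_edges])
      show "sg2 n p = (\<Sum>F\<in>Pow (all_edges n) - {{}}. var ^ card F * (coef n p F)\<^sup>2)" by (simp add: sg2_def var_eq)
      show "(\<Sum>F\<in>{F\<in>Pow (all_edges n). card F \<ge> 2}. (coef n p F)\<^sup>2) \<le> V"
        unfolding V_def N_def using n v2 by (intro sum_high_le p01) auto
    qed
    also have "\<dots> \<le> \<Theta> * sqrt V + 2 * \<Theta> ^ 3 * ((2 ^ (2 ^ v)) ^ 3 * N powr (3 * real v - 4)) + \<Theta>\<^sup>2 * V"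
    proof (intro add_mono mult_mono)
      have "(\<Sum>e\<in>all_edges n. \<bar>coef n p {e}\<bar> ^ 3) \<le> (\<Sum>e\<in>all_edges n. (2 ^ (2 ^ v) * N ^ (v - 2)) ^ 3)"
        using coef_edge(1)[OF p] coef_nonneg[OF p01(1), of n] by (intro sum_mono power_mono) (auto simp: N_def)
      also have "\<dots> = real (card (all_edges n)) * (2 ^ (2 ^ v) * N ^ (v - 2)) ^ 3" by simp
      also have "\<dots> \<le> N ^ 2 * (2 ^ (2 ^ v) * N ^ (v - 2)) ^ 3"
      proof (intro mult_right_mono)
        have "card (all_edges n) \<le> n ^ 2" unfolding card_all_edges
          by (cases "2 \<le> n") (simp_all add: binomial_le_pow binomial_eq_0)
        then have "real (card (all_edges n)) \<le> real (n ^ 2)" by (rule of_nat_mono)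
        then show "real (card (all_edges n)) \<le> N ^ 2" by (simp add: N_def)
      qed (use N0 in simp)
      also have "\<dots> = (2 ^ (2 ^ v)) ^ 3 * N ^ (2 + (v - 2) * 3)"
        unfolding power_add power_mult power_mult_distrib by (simp only: mult.left_commute)
      also have "N ^ (2 + (v - 2) * 3) = N powr (3 * real v - 4)" using v2 unfolding Np by (simp add: of_nat_diff mult.commute)
      finally show "(\<Sum>e\<in>all_edges n. \<bar>coef n p {e}\<bar> ^ 3) \<le> (2 ^ (2 ^ v)) ^ 3 * N powr (3 * real v - 4)" .
      have "\<theta>\<^sup>2 \<le> \<Theta>\<^sup>2" using \<theta> \<Theta>(1) by (simp add: abs_le_square_iff[symmetric])
      then have "\<theta>\<^sup>2 * V \<le> \<Theta>\<^sup>2 * V" using V00 by (rule mult_right_mono)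
      moreover have "0 \<le> \<theta>\<^sup>2 * V" using V00 by simp
      ultimately show "\<theta>\<^sup>2 * V / 2 \<le> \<Theta>\<^sup>2 * V" by linarith
    qed (use \<theta> \<Theta> V00 in \<open>auto intro!: power_mono sum_nonneg\<close>)
    \<comment> \<open>The three exponents are \<epsilon> - 1/2, 3\<epsilon> - 1 and 2\<epsilon> - 1,
      all at most 3\<epsilon> - 1/2.\<close>
    also have "\<dots> \<le> sqrt V_const * N powr (3 * \<epsilon> - 1 / 2) + 2 * (2 ^ (2 ^ v)) ^ 3 * N powr (3 * \<epsilon> - 1 / 2) + V_const * N powr (3 * \<epsilon> - 1 / 2)"
    proof (intro add_mono)
      have "sqrt V = sqrt V_const * N powr (real v - 3 / 2)"
        unfolding V real_sqrt_mult powr_half_sqrt[symmetric, OF powr_ge_zero] powr_powr by (simp add: field_simps)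
      then have "\<Theta> * sqrt V = sqrt V_const * N powr (\<epsilon> - 1 / 2)"
        by (simp add: \<Theta>_def powr_add[symmetric] mult.left_commute)
      also have "\<dots> \<le> sqrt V_const * N powr (3 * \<epsilon> - 1 / 2)" using N1 \<epsilon> V0 by (intro mult_left_mono powr_mono) auto
      finally show "\<Theta> * sqrt V \<le> sqrt V_const * N powr (3 * \<epsilon> - 1 / 2)" .
      have \<Theta>j: "\<Theta> ^ j = N powr ((\<epsilon> - (real v - 1)) * real j)" for j
        unfolding \<Theta>_def using N0 by (simp add: powr_realpow[symmetric] powr_powr)
      have "\<Theta> ^ 3 * N powr (3 * real v - 4) = N powr (3 * \<epsilon> - 1)"
        unfolding \<Theta>j powr_add[symmetric] by (simp add: algebra_simps)
      then have "2 * \<Theta> ^ 3 * ((2 ^ (2 ^ v)) ^ 3 * N powr (3 * real v - 4)) = 2 * (2 ^ (2 ^ v)) ^ 3 * N powr (3 * \<epsilon> - 1)"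
        by (simp add: mult_ac)
      also have "\<dots> \<le> 2 * (2 ^ (2 ^ v)) ^ 3 * N powr (3 * \<epsilon> - 1 / 2)" using N1 by (intro mult_left_mono powr_mono) auto
      finally show "2 * \<Theta> ^ 3 * ((2 ^ (2 ^ v)) ^ 3 * N powr (3 * real v - 4)) \<le> 2 * (2 ^ (2 ^ v)) ^ 3 * N powr (3 * \<epsilon> - 1 / 2)" .
      have "\<Theta>\<^sup>2 * N powr (2 * real v - 3) = N powr (2 * \<epsilon> - 1)"
        unfolding \<Theta>j powr_add[symmetric] by (simp add: algebra_simps)
      then have "\<Theta>\<^sup>2 * V = V_const * N powr (2 * \<epsilon> - 1)" by (simp add: V mult_ac)
      also have "\<dots> \<le> V_const * N powr (3 * \<epsilon> - 1 / 2)" using N1 \<epsilon> V0 by (intro mult_left_mono powr_mono) auto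
      finally show "\<Theta>\<^sup>2 * V \<le> V_const * N powr (3 * \<epsilon> - 1 / 2)" .
    qed
    also have "\<dots> = \<delta>1" by (simp add: \<delta>1_def C1 algebra_simps)
    also have "\<theta>\<^sup>2 * sg2 n p = (s * \<theta>)\<^sup>2" using sg2_nonneg by (simp add: s_def sg_def power_mult_distrib)
    finally show "norm (E (all_edges n) (\<lambda>x. cis (\<theta> * (of_int (int (cnt n x)) - mu n p))) - of_real (exp (- (s * \<theta>)\<^sup>2 / 2))) \<le> \<delta>1"
      unfolding cnt by simp
  next
    fix \<theta> :: real assume \<theta>: "\<Theta> < \<bar>\<theta>\<bar>" "\<bar>\<theta>\<bar> \<le> pi"
    have "E (all_edges n) (\<lambda>x. cis (\<theta> * (of_int (int (cnt n x)) - mu n p))) = E (all_edges n) (\<lambda>x. cis (\<theta> * real (cnt n x)) * cis (- (\<theta> * mu n p)))"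
      by (simp add: cis_mult right_diff_distrib)
    also have "\<dots> = charf n p \<theta> * cis (- (\<theta> * mu n p))"
      unfolding pexp_mult_right charf_def cnt_def ..
    finally have "norm (E (all_edges n) (\<lambda>x. cis (\<theta> * (of_int (int (cnt n x)) - mu n p)))) = norm (charf n p \<theta>)"
      by (simp add: norm_mult)
    also have "\<dots> \<le> \<delta>2" unfolding \<delta>2_def N_def using \<theta> by (intro decay) (auto simp: \<Theta>_def N_def)
    finally show "norm (E (all_edges n) (\<lambda>x. cis (\<theta> * (of_int (int (cnt n x)) - mu n p)))) \<le> \<delta>2" .
  qed
  also have "\<dots> \<le> C2 * C1 * N powr (4 * \<epsilon> - 1 / 2) + C2 * N powr (4 * \<epsilon> - 1 / 2) + N powr (4 * \<epsilon> - 1 / 2)"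
  proof (intro add_mono)
    have "s * \<Theta> * \<delta>1 \<le> (C2 * N powr (real v - 1)) * \<Theta> * \<delta>1"
      using s_le \<Theta> C by (intro mult_right_mono) (auto simp: \<delta>1_def)
    also have "\<dots> = C2 * C1 * (N powr (real v - 1) * N powr (\<epsilon> - (real v - 1)) * N powr (3 * \<epsilon> - 1 / 2))"
      by (simp add: \<delta>1_def \<Theta>_def mult_ac)
    also have "N powr (real v - 1) * N powr (\<epsilon> - (real v - 1)) * N powr (3 * \<epsilon> - 1 / 2) = N powr (4 * \<epsilon> - 1 / 2)"
      unfolding powr_add[symmetric] by simp
    finally show "s * \<Theta> * \<delta>1 \<le> C2 * C1 * N powr (4 * \<epsilon> - 1 / 2)" .
    have "s * \<delta>2 \<le> (C2 * N powr (real v - 1)) * \<delta>2" using s_le by (intro mult_right_mono) (auto simp: \<delta>2_def)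
    also have "\<dots> = C2 * N powr (- 1)" by (simp add: \<delta>2_def mult.assoc powr_add[symmetric])
    also have "\<dots> \<le> C2 * N powr (4 * \<epsilon> - 1 / 2)" using N1 \<epsilon> C by (intro mult_left_mono powr_mono) auto
    finally show "s * \<delta>2 \<le> C2 * N powr (4 * \<epsilon> - 1 / 2)" .
    have "c * N powr (2 * \<epsilon>) \<le> (s * \<Theta>)\<^sup>2"
    proof -
      have "\<Theta>\<^sup>2 = N powr (2 * \<epsilon> - (2 * real v - 2))"
        unfolding \<Theta>_def power2_eq_square powr_add[symmetric] by (simp add: algebra_simps)
      then have "c * N powr (2 * \<epsilon>) = (c * N powr (2 * real v - 2)) * \<Theta>\<^sup>2"
        by (simp add: mult.assoc powr_add[symmetric])
      also have "\<dots> \<le> s\<^sup>2 * \<Theta>\<^sup>2" using s2 by (intro mult_right_mono) auto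
      finally show ?thesis by (simp add: power_mult_distrib)
    qed
    then have "exp (- (s * \<Theta>)\<^sup>2 / 4) \<le> exp (- (c * N powr (2 * \<epsilon>) / 4))" by simp
    also have "\<dots> \<le> N powr (- 1)" using ev by (simp add: c_def N_def)
    also have "\<dots> \<le> N powr (4 * \<epsilon> - 1 / 2)" using N1 \<epsilon> by (intro powr_mono) auto
    finally show "exp (- (s * \<Theta>)\<^sup>2 / 4) \<le> N powr (4 * \<epsilon> - 1 / 2)" .
  qed
  finally show ?thesis unfolding s_def N_def Pr_def dn_def by (simp add: algebra_simps)
qed

text \<open>The window |k - \<mu>| \<le> \<sigma> n^\<epsilon> holds about 2 \<sigma> n^\<epsilon>
  integers, each with error of order n^(4\<epsilon>-1/2) / \<sigma>; this is the loss from
  4\<epsilon> to 5\<epsilon>. Outside, the two masses are bounded separately, and 2 K \<epsilon>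
  \<ge> 1/2 brings the moment bound down to n^(-1/2).\<close>

lemma sum_bound_large:
  assumes n: "n \<ge> 1" and sg: "0 < sg n p" and \<epsilon>: "0 < \<epsilon>" "1 / 2 \<le> 2 * real K * \<epsilon>" "K \<ge> 1" and A: "0 \<le> A"
    and pt: "\<And>k. \<bar>sg n p * Pr n p k - dn n p k\<bar> \<le> A * real n powr (4 * \<epsilon> - 1 / 2)"
    and ev: "84 * (1 + C2\<^sup>2) / s0 * (real n powr (2 * real v) * exp (- ((real n powr \<epsilon>)\<^sup>2 / 4))) \<le> real n powr (- 1 / 2)"
    and C2: "C2 = sqrt ((2 ^ (2 ^ v))\<^sup>2 + V_const)" and s0: "s0 = sqrt ((lam / 2) ^ d)"
    and F: "finite F"
  shows "(\<Sum>k\<in>F. \<bar>Pr n p k - dn n p k / sg n p\<bar>) \<le>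
    (A * (2 + 1 / s0) + (1 + (4 ^ (K + 1) * (2 / lam)) ^ d) ^ K + 1) * real n powr (5 * \<epsilon> - 1 / 2)"
proof -
  define N where "N = real n"
  define s where "s = sg n p"
  define r where "r = N powr \<epsilon>"
  have N1: "1 \<le> N" using n by (simp add: N_def)
  have N0: "0 < N" using N1 by simp
  have r1: "1 \<le> r" unfolding r_def using N1 \<epsilon> by (intro ge_one_powr_ge_zero) auto
  have s: "0 < s" "s0 \<le> s" "0 < s0" using sg sg_cases[of n] p by (auto simp: s_def s0)
  define I where "I = {k::int. \<bar>real_of_int k - mu n p\<bar> \<le> s * r}"
  have sr: "0 \<le> s * r" using s r1 by simp
  have I: "finite I" "real (card I) \<le> 2 * (s * r) + 1" unfolding I_def using card_lattice_interval[OF sr] by auto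
  have near: "\<bar>Pr n p k - dn n p k / s\<bar> \<le> A * N powr (4 * \<epsilon> - 1 / 2) / s" for k
  proof -
    have "Pr n p k - dn n p k / s = (s * Pr n p k - dn n p k) / s" using s by (simp add: diff_divide_distrib)
    then have "\<bar>Pr n p k - dn n p k / s\<bar> = \<bar>s * Pr n p k - dn n p k\<bar> / s" using s by simp
    then show ?thesis using pt[of k] s by (simp add: s_def N_def divide_right_mono)
  qed
  have "(\<Sum>k\<in>F. \<bar>Pr n p k - dn n p k / s\<bar>) = (\<Sum>k\<in>F \<inter> I. \<bar>Pr n p k - dn n p k / s\<bar>) + (\<Sum>k\<in>F - I. \<bar>Pr n p k - dn n p k / s\<bar>)"
    using F by (rule sum.Int_Diff)
  also have "(\<Sum>k\<in>F \<inter> I. \<bar>Pr n p k - dn n p k / s\<bar>) \<le> A * (2 + 1 / s0) * N powr (5 * \<epsilon> - 1 / 2)"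
  proof -
    have "(\<Sum>k\<in>F \<inter> I. \<bar>Pr n p k - dn n p k / s\<bar>) \<le> (\<Sum>k\<in>F \<inter> I. A * N powr (4 * \<epsilon> - 1 / 2) / s)"
      by (intro sum_mono near)
    also have "\<dots> = real (card (F \<inter> I)) * (A * N powr (4 * \<epsilon> - 1 / 2) / s)" by simp
    also have "\<dots> \<le> (2 * (s * r) + 1) * (A * N powr (4 * \<epsilon> - 1 / 2) / s)"
    proof (intro mult_right_mono)
      have "real (card (F \<inter> I)) \<le> real (card I)" using I(1) by (intro of_nat_mono card_mono) auto
      then show "real (card (F \<inter> I)) \<le> 2 * (s * r) + 1" using I(2) by linarith
    qed (use A s in auto)
    also have "\<dots> = A * N powr (4 * \<epsilon> - 1 / 2) * (2 * r + 1 / s)" using s by (simp add: field_simps)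
    also have "\<dots> \<le> A * N powr (4 * \<epsilon> - 1 / 2) * ((2 + 1 / s0) * r)"
    \<comment> \<open>The additive 1 in the number of integers contributes 1 / \<sigma>, for which
      the lower bound on nonzero standard deviations is needed.\<close>
    proof (intro mult_left_mono)
      have "1 / s \<le> 1 / s0" using s by (intro divide_left_mono) auto
      also have "\<dots> \<le> 1 / s0 * r" using divide_right_mono[of 1 r s0] s r1 by simp
      finally show "2 * r + 1 / s \<le> (2 + 1 / s0) * r" by (simp add: algebra_simps)
    qed (use A in auto)
    also have "\<dots> = A * (2 + 1 / s0) * (N powr (4 * \<epsilon> - 1 / 2) * N powr \<epsilon>)" by (simp add: r_def)
    also have "N powr (4 * \<epsilon> - 1 / 2) * N powr \<epsilon> = N powr (5 * \<epsilon> - 1 / 2)" unfolding powr_add[symmetric] by simp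
    finally show ?thesis .
  qed
  also have "(\<Sum>k\<in>F - I. \<bar>Pr n p k - dn n p k / s\<bar>) \<le>
     (1 + (4 ^ (K + 1) * (2 / lam)) ^ d) ^ K * N powr (5 * \<epsilon> - 1 / 2) + N powr (5 * \<epsilon> - 1 / 2)"
  proof -
    have "(\<Sum>k\<in>F - I. \<bar>Pr n p k - dn n p k / s\<bar>) \<le> (\<Sum>k\<in>F - I. Pr n p k + dn n p k / s)"
    proof (rule sum_mono)
      fix k
      have "0 \<le> dn n p k / s" using dn_bounds s by simp
      then show "\<bar>Pr n p k - dn n p k / s\<bar> \<le> Pr n p k + dn n p k / s" using Pr_nonneg[of n k] by (simp add: abs_le_iff)
    qed
    also have "\<dots> = (\<Sum>k\<in>F - I. Pr n p k) + (\<Sum>k\<in>F - I. dn n p k / s)" by (rule sum.distrib)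
    also have "(\<Sum>k\<in>F - I. Pr n p k) \<le> (1 + (4 ^ (K + 1) * (2 / lam)) ^ d) ^ K * N powr (5 * \<epsilon> - 1 / 2)"
    proof -
      have "(\<Sum>k\<in>F - I. Pr n p k) \<le> (1 + (4 ^ (K + 1) * (2 / lam)) ^ d) ^ K / r ^ (2 * K)"
        using F r1 sg by (intro tail_bound \<epsilon>) (auto simp: I_def s_def)
      also have "\<dots> = (1 + (4 ^ (K + 1) * (2 / lam)) ^ d) ^ K * (1 / r ^ (2 * K))" by simp
      also have "\<dots> \<le> (1 + (4 ^ (K + 1) * (2 / lam)) ^ d) ^ K * N powr (5 * \<epsilon> - 1 / 2)"
      proof (intro mult_left_mono)
        have "r ^ (2 * K) = N powr (2 * real K * \<epsilon>)"
          unfolding r_def using powr_realpow[of "N powr \<epsilon>" "2 * K"] N0 by (simp add: powr_powr mult_ac)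
        then have "1 / r ^ (2 * K) = N powr (- (2 * real K * \<epsilon>))" by (simp add: powr_minus_divide)
        also have "\<dots> \<le> N powr (5 * \<epsilon> - 1 / 2)" using N1 \<epsilon> by (intro powr_mono) auto
        finally show "1 / r ^ (2 * K) \<le> N powr (5 * \<epsilon> - 1 / 2)" .
        show "0 \<le> (1 + (4 ^ (K + 1) * (2 / lam)) ^ d) ^ K" using p by (intro zero_le_power add_nonneg_nonneg) auto
      qed
      finally show ?thesis .
    qed
    also have "(\<Sum>k\<in>F - I. dn n p k / s) \<le> N powr (5 * \<epsilon> - 1 / 2)"
    proof -
      have "(\<Sum>k\<in>F - I. dn n p k / s) \<le> 84 * exp (- (r\<^sup>2 / 4)) * (1 + s\<^sup>2) / s0"
        unfolding s_def s0
      proof (rule sum_dn_tail)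
        fix k assume "k \<in> F - I"
        then have "s * r < \<bar>real_of_int k - mu n p\<bar>" by (simp add: I_def)
        then show "r \<le> \<bar>(real_of_int k - mu n p) / sg n p\<bar>" using s unfolding s_def[symmetric]
          by (simp add: le_divide_eq mult.commute)
      qed (use F r1 in auto)
      also have "\<dots> \<le> 84 * exp (- (r\<^sup>2 / 4)) * ((1 + C2\<^sup>2) * N powr (2 * real v)) / s0"
      proof (intro divide_right_mono mult_left_mono)
        have "s \<le> C2 * N ^ (v - 1)" unfolding s_def C2 N_def by (rule sg_le[OF n])
        also have "\<dots> \<le> C2 * N ^ v" using N1 by (intro mult_left_mono power_increasing) (auto simp: C2 V_const_def)
        finally have "s\<^sup>2 \<le> (C2 * N ^ v)\<^sup>2" using s by (intro power_mono) auto
        also have "\<dots> = C2\<^sup>2 * N powr (2 * real v)"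
        proof -
          have "N powr real (v * 2) = (N ^ v)\<^sup>2" using powr_realpow[OF N0, of "v * 2"] by (simp only: power_mult)
          then show ?thesis by (simp add: power_mult_distrib mult.commute)
        qed
        finally have "s\<^sup>2 \<le> C2\<^sup>2 * N powr (2 * real v)" .
        moreover have "1 \<le> N powr (2 * real v)" using N1 by (intro ge_one_powr_ge_zero) auto
        ultimately show "1 + s\<^sup>2 \<le> (1 + C2\<^sup>2) * N powr (2 * real v)" by (simp add: algebra_simps)
      qed (use s in auto)
      also have "\<dots> = 84 * (1 + C2\<^sup>2) / s0 * (N powr (2 * real v) * exp (- ((N powr \<epsilon>)\<^sup>2 / 4)))"
        by (simp add: r_def mult_ac)
      also have "\<dots> \<le> N powr (- 1 / 2)" using ev unfolding N_def .
      also have "\<dots> \<le> N powr (5 * \<epsilon> - 1 / 2)" using N1 \<epsilon> by (intro powr_mono) auto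
      finally show ?thesis .
    qed
    finally show ?thesis by simp
  qed
  finally show ?thesis unfolding s_def N_def by (simp add: algebra_simps)
qed

text \<open>For bounded n total masses suffice, uniformly in p. The degenerate case of zero
  variance, which occurs when there is no room for a copy, is included.\<close>

lemma bounds_small:
  assumes n: "1 \<le> n" "n \<le> n0" and C2: "C2 = sqrt ((2 ^ (2 ^ v))\<^sup>2 + V_const)" and s0: "s0 = sqrt ((lam / 2) ^ d)"
  shows "\<bar>sg n p * Pr n p k - dn n p k\<bar> \<le> C2 * real n0 ^ (v - 1) + 1"
    and "finite F \<Longrightarrow> (\<Sum>k\<in>F. \<bar>Pr n p k - dn n p k / sg n p\<bar>) \<le> 1 + 84 * (1 + (C2 * real n0 ^ (v - 1))\<^sup>2) / s0"
proof -
  have C20: "0 \<le> C2" by (simp add: C2 V_const_def)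
  have s00: "0 < s0" using p by (simp add: s0)
  have "sg n p \<le> C2 * real n ^ (v - 1)" unfolding C2 by (rule sg_le[OF n(1)])
  also have "\<dots> \<le> C2 * real n0 ^ (v - 1)" using n C20 by (intro mult_left_mono power_mono) auto
  finally have sg: "sg n p \<le> C2 * real n0 ^ (v - 1)" .
  have "Pr n p k \<le> 1" using sum_Pr_le_1[of "{k}" n] by simp
  then have "sg n p * Pr n p k \<le> sg n p" using sg_nonneg[of n] Pr_nonneg[of n k] by (simp add: mult_left_le)
  moreover have "0 \<le> sg n p * Pr n p k" using sg_nonneg[of n] Pr_nonneg[of n k] by simp
  ultimately show "\<bar>sg n p * Pr n p k - dn n p k\<bar> \<le> C2 * real n0 ^ (v - 1) + 1"
    using dn_bounds[of n k] sg by (simp add: abs_le_iff)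
  assume F: "finite F"
  have "(\<Sum>k\<in>F. \<bar>Pr n p k - dn n p k / sg n p\<bar>) \<le> (\<Sum>k\<in>F. Pr n p k + dn n p k / sg n p)"
  proof (rule sum_mono)
    fix k
    have "0 \<le> dn n p k / sg n p" using dn_bounds[of n k] sg_nonneg[of n] by simp
    then show "\<bar>Pr n p k - dn n p k / sg n p\<bar> \<le> Pr n p k + dn n p k / sg n p" using Pr_nonneg[of n k] by (simp add: abs_le_iff)
  qed
  also have "\<dots> = (\<Sum>k\<in>F. Pr n p k) + (\<Sum>k\<in>F. dn n p k / sg n p)" by (rule sum.distrib)
  also have "\<dots> \<le> 1 + 84 * exp (- (0\<^sup>2 / 4)) * (1 + (sg n p)\<^sup>2) / s0"
    unfolding s0 by (intro add_mono sum_Pr_le_1 sum_dn_tail F) auto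
  also have "\<dots> \<le> 1 + 84 * (1 + (C2 * real n0 ^ (v - 1))\<^sup>2) / s0"
  proof -
    have "(sg n p)\<^sup>2 \<le> (C2 * real n0 ^ (v - 1))\<^sup>2" using sg sg_nonneg[of n] by (intro power_mono) auto
    then show ?thesis using s00 by (simp add: divide_right_mono)
  qed
  finally show "(\<Sum>k\<in>F. \<bar>Pr n p k - dn n p k / sg n p\<bar>) \<le> 1 + 84 * (1 + (C2 * real n0 ^ (v - 1))\<^sup>2) / s0" .
qed

end

section \<open>Choice of exponents and uniform constants\<close>

theorem local_limit:
  assumes lam: "0 < lam" "lam < 1 / 2" and eps: "0 < eps"
  shows "\<exists>C. \<forall>n p. n \<ge> 1 \<longrightarrow> lam < p \<longrightarrow> p < 1 - lam \<longrightarrow>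
    (\<forall>k. \<bar>sg n p * Pr n p k - dn n p k\<bar> \<le> C * real n powr (eps - 1 / 2)) \<and>
    (\<forall>F. finite F \<longrightarrow> (\<Sum>k\<in>F. \<bar>Pr n p k - dn n p k / sg n p\<bar>) \<le> C * real n powr (eps - 1 / 2))"
proof -
  \<comment> \<open>The sum bound loses 5\<epsilon> in the exponent; the cap at 1 serves the
    condition \<epsilon> \<le> 1 of \<open>pointwise_bound\<close>.\<close>
  define \<epsilon> where "\<epsilon> = min eps 1 / 5"
  have \<epsilon>: "0 < \<epsilon>" "\<epsilon> \<le> 1" "5 * \<epsilon> \<le> eps" using eps by (auto simp: \<epsilon>_def)
  define C1 where "C1 = sqrt V_const + 2 * (2 ^ (2 ^ v)) ^ 3 + V_const"
  define C2 where "C2 = sqrt ((2 ^ (2 ^ v))\<^sup>2 + V_const)"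
  define s0 where "s0 = sqrt ((lam / 2) ^ d)"
  define A where "A = C2 * C1 + C2 + 1"
  obtain K0 :: nat where K0: "1 / (4 * \<epsilon>) \<le> real K0" using real_arch_simple by blast
  define K where "K = Suc K0"
  have K: "K \<ge> 1" "1 / 2 \<le> 2 * real K * \<epsilon>"
  proof -
    have "1 / (4 * \<epsilon>) \<le> real K" using K0 by (simp add: K_def)
    then show "1 / 2 \<le> 2 * real K * \<epsilon>" using \<epsilon> by (simp add: divide_le_eq mult_ac)
  qed (simp add: K_def)
  define B where "B = A * (2 + 1 / s0) + (1 + (4 ^ (K + 1) * (2 / lam)) ^ d) ^ K + 1"
  define c where "c = lam / 8 * (lam ^ d * (1 / (2 * real v)) ^ v)\<^sup>2"
  have v2: "2 \<le> v" by (rule v_ge_2)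
  have c0: "0 < c" using lam v2 by (simp add: c_def)
  have V0: "0 \<le> V_const" by (simp add: V_const_def)
  have C0: "0 \<le> C1" "0 \<le> C2" "0 \<le> A" using V0 by (auto simp: C1_def C2_def A_def)
  have s00: "0 < s0" using lam by (simp add: s0_def)
  have "0 \<le> (1 + (4 ^ (K + 1) * (2 / lam)) ^ d) ^ K" using lam by (intro zero_le_power add_nonneg_nonneg) auto
  then have B0: "0 \<le> B" unfolding B_def using C0 s00 by (intro add_nonneg_nonneg mult_nonneg_nonneg) auto
  obtain n1 where n1: "\<And>n p \<theta>. n \<ge> n1 \<Longrightarrow> lam < p \<Longrightarrow> p < 1 - lam \<Longrightarrow> real n powr (\<epsilon> - (real v - 1)) \<le> \<bar>\<theta>\<bar> \<Longrightarrow> \<bar>\<theta>\<bar> \<le> pi \<Longrightarrow>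
    norm (charf n p \<theta>) \<le> real n powr (- real v)"
    using charf_decay[OF lam \<epsilon>(1), of "real v"] by auto
  have "eventually (\<lambda>n::nat. exp (- (c * real n powr (2 * \<epsilon>) / 4)) * real n powr 1 < 1) sequentially"
  proof (rule order_tendstoD)
    show "((\<lambda>n::nat. exp (- (c * real n powr (2 * \<epsilon>) / 4)) * real n powr 1) \<longlongrightarrow> 0) sequentially"
      using c0 \<epsilon>(1) by real_asymp
  qed simp
  moreover define D where "D = 84 * (1 + C2\<^sup>2) / s0"
  have D0: "0 \<le> D" using s00 by (simp add: D_def)
  have "eventually (\<lambda>n::nat. D * (real n powr (2 * real v) * exp (- ((real n powr \<epsilon>)\<^sup>2 / 4))) * real n powr (1 / 2) < 1) sequentially"
  proof (rule order_tendstoD)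
    show "((\<lambda>n::nat. D * (real n powr (2 * real v) * exp (- ((real n powr \<epsilon>)\<^sup>2 / 4))) * real n powr (1 / 2)) \<longlongrightarrow> 0) sequentially"
      using \<epsilon>(1) by real_asymp
  qed simp
  ultimately have "eventually (\<lambda>n::nat. exp (- (c * real n powr (2 * \<epsilon>) / 4)) \<le> real n powr (- 1) \<and>
     D * (real n powr (2 * real v) * exp (- ((real n powr \<epsilon>)\<^sup>2 / 4))) \<le> real n powr (- 1 / 2)) sequentially"
    using eventually_gt_at_top[of 0]
  proof eventually_elim
    case (elim n)
    then have "0 < real n powr (1 / 2)" "0 < real n" by auto
    then show ?case using elim by (simp add: powr_minus_divide le_divide_eq)
  qed
  then obtain n2 where n2: "\<And>n. n \<ge> n2 \<Longrightarrow> exp (- (c * real n powr (2 * \<epsilon>) / 4)) \<le> real n powr (- 1)"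
    "\<And>n. n \<ge> n2 \<Longrightarrow> D * (real n powr (2 * real v) * exp (- ((real n powr \<epsilon>)\<^sup>2 / 4))) \<le> real n powr (- 1 / 2)"
    unfolding eventually_sequentially by auto
  define n0 where "n0 = max (2 * v) (max n1 n2)"
  define S where "S = (C2 * real n0 ^ (v - 1) + 1) + (1 + 84 * (1 + (C2 * real n0 ^ (v - 1))\<^sup>2) / s0)"
  \<comment> \<open>For n \<le> n0 the factor n0^(1/2) compensates the decay n^(-1/2), so that the
    constant bound S fits the claimed form.\<close>
  define C where "C = A + B + S * real n0 powr (1 / 2)"
  have S0: "0 \<le> S" using C0 s00 by (simp add: S_def)
  show ?thesis
  proof (intro exI[of _ C] allI impI)
    fix n :: nat and p :: real
    assume n: "1 \<le> n" and p: "lam < p" "p < 1 - lam"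
    define N where "N = real n powr (eps - 1 / 2)"
    have N1: "1 \<le> real n" using n by simp
    have N0: "0 \<le> N" by (simp add: N_def)
    note pp = lam(1) p
    show "(\<forall>k. \<bar>sg n p * Pr n p k - dn n p k\<bar> \<le> C * real n powr (eps - 1 / 2)) \<and>
      (\<forall>F. finite F \<longrightarrow> (\<Sum>k\<in>F. \<bar>Pr n p k - dn n p k / sg n p\<bar>) \<le> C * real n powr (eps - 1 / 2))"
    proof (cases "n \<ge> n0")
      case True
      then have nn: "n \<ge> 2 * v" "n \<ge> n1" "n \<ge> n2" by (auto simp: n0_def)
      have pt: "\<bar>sg n p * Pr n p k - dn n p k\<bar> \<le> A * real n powr (4 * \<epsilon> - 1 / 2)" for k
        unfolding A_def
        by (rule pointwise_bound[OF pp nn(1) \<epsilon>(1,2) n1[OF nn(2) p] _ C1_def C2_def]) (use n2(1)[OF nn(3)] in \<open>simp_all add: c_def\<close>)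
      have le: "real n powr (4 * \<epsilon> - 1 / 2) \<le> N" "real n powr (5 * \<epsilon> - 1 / 2) \<le> N"
        unfolding N_def using N1 \<epsilon> by (intro powr_mono; simp)+
      have AC: "A \<le> C" "B \<le> C" using C0 B0 S0 by (auto simp: C_def)
      have "\<bar>sg n p * Pr n p k - dn n p k\<bar> \<le> C * N" for k
      proof (rule order_trans[OF pt mult_mono[OF AC(1) le(1)]])
        show "0 \<le> C" using AC(1) C0(3) by linarith
      qed simp
      moreover have "(\<Sum>k\<in>F. \<bar>Pr n p k - dn n p k / sg n p\<bar>) \<le> C * N" if F: "finite F" for F
      proof -
        have "0 < sg2 n p"
        proof -
          have "0 < c * real n ^ (2 * v - 2)" using c0 N1 by simp
          also have "\<dots> \<le> sg2 n p" unfolding c_def by (rule sg2_ge[OF pp nn(1)])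
          finally show ?thesis .
        qed
        then have sg: "0 < sg n p" by (simp add: sg_def)
        have "(\<Sum>k\<in>F. \<bar>Pr n p k - dn n p k / sg n p\<bar>) \<le> B * real n powr (5 * \<epsilon> - 1 / 2)"
          unfolding B_def
          by (rule sum_bound_large[OF pp n sg \<epsilon>(1) K(2,1) C0(3) pt _ C2_def s0_def F]) (use n2(2)[OF nn(3)] in \<open>simp add: D_def\<close>)
        also have "\<dots> \<le> C * N" using le AC B0 by (intro mult_mono) auto
        finally show ?thesis .
      qed
      ultimately show ?thesis unfolding N_def by blast
    next
      case False
      then have nn: "n \<le> n0" by simp
      have "1 \<le> real n0 powr (1 / 2) * real n powr (- 1 / 2)"
      proof -
        have "real n powr (1 / 2) \<le> real n0 powr (1 / 2)" using nn by (intro powr_mono2) auto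
        then show ?thesis using N1 by (simp add: powr_minus_divide)
      qed
      also have "\<dots> \<le> real n0 powr (1 / 2) * N" unfolding N_def using N1 eps by (intro mult_left_mono powr_mono) auto
      finally have "S * 1 \<le> S * (real n0 powr (1 / 2) * N)" using S0 by (intro mult_left_mono)
      also have "\<dots> \<le> (A + B) * N + S * (real n0 powr (1 / 2) * N)" using C0 B0 N0 by simp
      also have "\<dots> = C * N" by (simp only: C_def distrib_right mult.assoc)
      finally have SC: "S \<le> C * N" by simp
      have S12: "C2 * real n0 ^ (v - 1) + 1 \<le> S" "1 + 84 * (1 + (C2 * real n0 ^ (v - 1))\<^sup>2) / s0 \<le> S"
        using C0 s00 by (auto simp: S_def)
      have "\<bar>sg n p * Pr n p k - dn n p k\<bar> \<le> C * N" for k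
        using bounds_small(1)[OF pp n nn C2_def s0_def, of k] S12 SC by linarith
      moreover have "(\<Sum>k\<in>F. \<bar>Pr n p k - dn n p k / sg n p\<bar>) \<le> C * N" if "finite F" for F
        using bounds_small(2)[OF pp n nn C2_def s0_def that] S12 SC by linarith
      ultimately show ?thesis unfolding N_def by blast
    qed
  qed
qed

end

theorem theorem1p1:
  fixes VH :: "'a set" and EH :: "'a set set" and lam eps :: real
  assumes "simple_graph VH EH" and "connected_graph VH EH" and "card VH \<ge> 2"
    and "0 < lam" and "lam < 1/2" and "eps > 0"
  shows "\<exists>C. \<forall>(n::nat) (p::real). n \<ge> 1 \<longrightarrow> lam < p \<longrightarrow> p < 1 - lam \<longrightarrow>
    (let X = (\<lambda>E. real (copies VH EH n E));
         \<mu> = measure_pmf.expectation (gnp n p) X;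
         \<sigma> = sqrt (measure_pmf.variance (gnp n p) X)
     in (\<forall>k::int. \<bar>\<sigma> * measure_pmf.prob (gnp n p) {E. X E = real_of_int k}
                   - std_normal_density ((real_of_int k - \<mu>) / \<sigma>)\<bar>
                 \<le> C * real n powr (eps - 1/2)) \<and>
        (\<Sum>\<^sub>\<infinity>k::int. ennreal \<bar>measure_pmf.prob (gnp n p) {E. X E = real_of_int k}
                   - std_normal_density ((real_of_int k - \<mu>) / \<sigma>) / \<sigma>\<bar>)
          \<le> ennreal (C * real n powr (eps - 1/2)))"
proof -
  interpret connected_pattern VH EH by unfold_locales fact+
  obtain C where C: "\<And>n p k. n \<ge> 1 \<Longrightarrow> lam < p \<Longrightarrow> p < 1 - lam \<Longrightarrow> \<bar>sg n p * Pr n p k - dn n p k\<bar> \<le> C * real n powr (eps - 1 / 2)"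
    "\<And>n p F. n \<ge> 1 \<Longrightarrow> lam < p \<Longrightarrow> p < 1 - lam \<Longrightarrow> finite F \<Longrightarrow> (\<Sum>k\<in>F. \<bar>Pr n p k - dn n p k / sg n p\<bar>) \<le> C * real n powr (eps - 1 / 2)"
    using local_limit[OF assms(4-6)] by blast
  show ?thesis
  proof (intro exI[of _ C] allI impI)
    fix n :: nat and p :: real
    assume n: "1 \<le> n" and p: "lam < p" "p < 1 - lam"
    note pp = assms(4) p
    \<comment> \<open>In the extended nonnegative reals every family is summable, so uniform bounds
      for finite partial sums suffice.\<close>
    have "(\<Sum>\<^sub>\<infinity>k::int. ennreal \<bar>Pr n p k - dn n p k / sg n p\<bar>) \<le> ennreal (C * real n powr (eps - 1 / 2))"
    proof (rule infsum_le_finite_sums)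
      fix F :: "int set" assume "finite F"
      then show "(\<Sum>k\<in>F. ennreal \<bar>Pr n p k - dn n p k / sg n p\<bar>) \<le> ennreal (C * real n powr (eps - 1 / 2))"
        using C(2)[OF n p, of F] by (subst sum_ennreal) (auto intro: ennreal_leI)
    qed (rule nonneg_summable_on_complete, simp)
    then show "let X = (\<lambda>E. real (copies VH EH n E));
         \<mu> = measure_pmf.expectation (gnp n p) X;
         \<sigma> = sqrt (measure_pmf.variance (gnp n p) X)
     in (\<forall>k::int. \<bar>\<sigma> * measure_pmf.prob (gnp n p) {E. X E = real_of_int k}
                   - std_normal_density ((real_of_int k - \<mu>) / \<sigma>)\<bar>
                 \<le> C * real n powr (eps - 1/2)) \<and>
        (\<Sum>\<^sub>\<infinity>k::int. ennreal \<bar>measure_pmf.prob (gnp n p) {E. X E = real_of_int k}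
                   - std_normal_density ((real_of_int k - \<mu>) / \<sigma>) / \<sigma>\<bar>)
          \<le> ennreal (C * real n powr (eps - 1/2))"
      using C(1)[OF n p]
      unfolding Let_def unfolding prob_gnp[OF pp] variance_gnp[OF pp] unfolding mean_gnp[OF pp] sg_def[symmetric] dn_def[symmetric]
      by blast
  qed
qed

end
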